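(* Let $$\mathcal{Z}(Q, Q_m, Q_1; q, e^{-t}) = \sum_{\mu, \nu, \eta}(-Q)^{|\mu|} (-Q_1)^{|\nu|} (-Q_m)^{|\eta|}\,W_{\eta,\mu,\nu}(q, e^{-t})\,W_{\eta^t,\mu^t,\nu^t}(q, e^{-t}),$$ $$\mathcal{Z}(Q_1, Q_m; q, e^{-t}) = \sum_{\nu, \eta} (-Q_1)^{|\nu|} (-Q_m)^{|\eta|}\,W_{\eta,(0),\nu}(q, e^{-t})\,W_{\eta^t,(0),\nu^t}(q, e^{-t}),$$ where the sums are over all partitions and $W_{\mu^1,\mu^2,\mu^3}$ is the deformed topological vertex. Put $Q_\rho=Q_1Q_m$. Then, as formal power series in $Q,Q_1,Q_m$, $$\begin{aligned} \frac{\mathcal{Z}(Q, Q_m, Q_1; q, e^{-t})}{\mathcal{Z}(Q_1, Q_m; q, e^{-t})} = \sum_{\mu} Q^{|\mu|} \prod_{(i, j) \in \mu}\Bigg[ &\frac{(1 - e^{-t} q^{j-i})(1 - e^{-t} q^{-(j-i)})}{(1- q^{h(i,j)})(1-q^{-h(i,j)})} \\ \cdot\prod_{k=1}^{\infty}\Bigg(&\frac{(1 - Q_m Q_{\rho}^{k-1} q^{h(i,j)})(1 - Q_mQ_{\rho}^{k-1} q^{-h(i, j)})}{(1 - e^{-t} Q_m Q_{\rho}^{k-1} q^{j - i})(1 - e^{-t} Q_mQ_{\rho}^{k-1} q^{-(j - i)})} \\ &\cdot\frac{(1 - Q_1 Q_{\rho}^{k-1} q^{h(i,j)})(1 - Q_1Q_{\rho}^{k-1}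 q^{-h(i, j)})}{(1 - e^{-t} Q_1Q_{\rho}^{k-1}q^{j - i})(1 - e^{-t} Q_1Q_{\rho}^{k-1} q^{-(j - i)})} \\ &\cdot\frac{(1 - Q_{\rho}^ke^{-t} q^{j - i})^2(1 - Q_{\rho}^k e^{-t} q^{-(j - i)})^2}{(1 - Q_{\rho}^k q^{h(i,j)})^2(1 - Q_{\rho}^k q^{-h(i, j)})^2}\Bigg)\Bigg]. \end{aligned}$$
   Context: Partitions: $\mu=(\mu_1\ge\cdots\ge\mu_l>0)$, $l(\mu)=l$, $|\mu|=\sum_i\mu_i$, $\mu^t$ the transpose, $(0)$ the empty partition; for a box $x=(i,j)\in\mu$, $c(x)=j-i$ and $h(x)=h(i,j)=\mu_i+\mu^t_j-i-j+1$; $\kappa_\mu=2\sum_{x\in\mu}c(x)$. Quantum dimension: $W_\mu(q,e^{-t})=\prod_{x\in\mu}\dfrac{e^{t/2}q^{c(x)/2}-e^{-t/2}q^{-c(x)/2}}{q^{h(x)/2}-q^{-h(x)/2}}$, $W_{(0)}=1$. Specialization: for a power series $E(u)=1+\sum_{n\ge1}e_nu^n$ and a symmetric function $f$, $f(E(u))$ denotes the value of $f$, written as a polynomial in the elementary symmetric functions, when the $n$-th elementary symmetric function is replaced by the coefficient $e_n$. Put $$E^{\mu}(u; q, e^{-t})= \prod_{i=1}^{l(\mu)} \frac{1+q^{\mu_i-i}u}{1+q^{-i}u} \cdot\Big(1 + \sum_{n=1}^{\infty} u^n \prod_{i=1}^n \frac{1-e^{-t}q^{i-1}}{q^i - 1}\Big).$$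 Deformed topological vertex (with $s_{\mu/\eta}$ skew Schur functions): $$W_{\mu^1, \mu^2, \mu^3}(q, e^{-t}) = q^{\kappa_{\mu^3}/2} e^{-|\mu^2|t/2} W_{\mu^2}(q, e^{-t})\sum_{\eta}q^{(|\mu^1| - |\eta|)/2} s_{\mu^1/\eta}(E^{(\mu^2)^t}(u; q, e^{-t}))\,q^{(|\mu^3| - |\eta|)/2} s_{(\mu^3)^t/\eta}(E^{\mu^2}(u; q, e^{-t})).$$ *)

theory Defs
  imports
    "HOL-Analysis.Infinite_Products"
    "HOL-Computational_Algebra.Formal_Power_Series"
    "HOL-Library.Poly_Mapping"
    "HOL-Library.FuncSet"
begin

section \<open>Partitions\<close>

definition is_partition :: "nat list \<Rightarrow> bool" where
  "is_partition \<mu> \<longleftrightarrow> sorted_wrt (\<ge>) \<mu> \<and> 0 \<notin> set \<mu>"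

definition partitions :: "nat \<Rightarrow> nat list set" where
  "partitions n = {\<mu>. is_partition \<mu> \<and> sum_list \<mu> = n}"

text \<open>Rows, columns and parts are numbered from 1, as in \<open>\<mu> = (\<mu>\<^sub>1 \<ge> \<mu>\<^sub>2 \<ge> \<dots>)\<close>.\<close>

definition part :: "nat list \<Rightarrow> nat \<Rightarrow> nat" where
  "part \<mu> i = (if 1 \<le> i \<and> i \<le> length \<mu> then \<mu> ! (i - 1) else 0)"

definition boxes :: "nat list \<Rightarrow> (nat \<times> nat) set" where
  "boxes \<mu> = {(i, j). 1 \<le> i \<and> i \<le> length \<mu> \<and> 1 \<le> j \<and> j \<le> part \<mu> i}"

definition conjugate :: "nat list \<Rightarrow> nat list" where
  "conjugate \<mu> = map (\<lambda>j. card {i. (i, j) \<in> boxes \<mu>}) [1..<Suc (part \<mu> 1)]"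

definition box_content :: "nat \<times> nat \<Rightarrow> int" where
  "box_content x = int (snd x) - int (fst x)"

definition hook :: "nat list \<Rightarrow> nat \<times> nat \<Rightarrow> int" where
  "hook \<mu> x = int (part \<mu> (fst x)) + int (part (conjugate \<mu>) (snd x))
                - int (fst x) - int (snd x) + 1"

definition kappa :: "nat list \<Rightarrow> int" where
  "kappa \<mu> = 2 * (\<Sum>x\<in>boxes \<mu>. box_content x)"


section \<open>Symmetric functions and their specializations\<close>

text \<open>Integer polynomials in the variables \<open>x\<^sub>0, x\<^sub>1, x\<^sub>2, \<dots>\<close>; exponent vectors are finitely
  supported functions.\<close>

type_synonym int_mpoly = "(nat \<Rightarrow>\<^sub>0 nat) \<Rightarrow>\<^sub>0 int"

definition mvar :: "nat \<Rightarrow> int_mpoly" where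
  "mvar i = Poly_Mapping.single (Poly_Mapping.single i 1) 1"

definition mpoly_eval :: "int_mpoly \<Rightarrow> (nat \<Rightarrow> 'b) \<Rightarrow> 'b::comm_ring_1" where
  "mpoly_eval p v = (\<Sum>m\<in>Poly_Mapping.keys p. of_int (Poly_Mapping.lookup p m) *
     (\<Prod>i\<in>Poly_Mapping.keys m. v i ^ Poly_Mapping.lookup m i))"

text \<open>A symmetric function is represented by the family of its restrictions to the finitely many
  variables \<open>x\<^sub>0, \<dots>, x\<^bsub>N-1\<^esub>\<close>, for all \<open>N\<close>.\<close>

definition elem_sym :: "nat \<Rightarrow> nat \<Rightarrow> int_mpoly" where
  "elem_sym n N = (\<Sum>S | S \<subseteq> {..<N} \<and> card S = n. \<Prod>i\<in>S. mvar i)"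

definition skew_ssyt :: "nat list \<Rightarrow> nat list \<Rightarrow> nat \<Rightarrow> (nat \<times> nat \<Rightarrow> nat) set" where
  "skew_ssyt \<mu> \<eta> N = {T \<in> (boxes \<mu> - boxes \<eta>) \<rightarrow>\<^sub>E {..<N}.
     (\<forall>i j j'. (i, j) \<in> boxes \<mu> - boxes \<eta> \<longrightarrow> (i, j') \<in> boxes \<mu> - boxes \<eta> \<longrightarrow> j < j'
        \<longrightarrow> T (i, j) \<le> T (i, j')) \<and>
     (\<forall>i i' j. (i, j) \<in> boxes \<mu> - boxes \<eta> \<longrightarrow> (i', j) \<in> boxes \<mu> - boxes \<eta> \<longrightarrow> i < i'
        \<longrightarrow> T (i, j) < T (i', j))}"

definition skew_schur :: "nat list \<Rightarrow> nat list \<Rightarrow> nat \<Rightarrow> int_mpoly" where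
  "skew_schur \<mu> \<eta> N = (if boxes \<eta> \<subseteq> boxes \<mu>
     then \<Sum>T\<in>skew_ssyt \<mu> \<eta> N. \<Prod>x\<in>boxes \<mu> - boxes \<eta>. mvar (T x) else 0)"

text \<open>The expression of a symmetric function as a polynomial in the elementary symmetric functions,
  unique by the fundamental theorem of symmetric functions. The polynomial variable with index \<open>n\<close>
  stands for the elementary symmetric function of degree \<open>n + 1\<close>; the one of degree 0 is 1 and is
  not a variable.\<close>

definition elem_expansion :: "(nat \<Rightarrow> int_mpoly) \<Rightarrow> int_mpoly" where
  "elem_expansion f = (THE P. \<forall>N. f N = mpoly_eval P (\<lambda>n. elem_sym (Suc n) N))"

definition specialize :: "(nat \<Rightarrow> int_mpoly) \<Rightarrow> 'a::comm_ring_1 fps \<Rightarrow> 'a" where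
  "specialize f E = mpoly_eval (elem_expansion f) (\<lambda>n. fps_nth E (Suc n))"


section \<open>The deformed topological vertex\<close>

text \<open>Everything below depends on \<open>q\<close> and \<open>t\<close> only through \<open>qh = q\<^bsup>1/2\<^esup>\<close> and \<open>eh = e\<^bsup>t/2\<^esup>\<close>, which
  are elements of a coefficient field. This covers both numerical values and indeterminates
  (elements of a field of rational functions).\<close>

definition quantum_dim :: "'a::field \<Rightarrow> 'a \<Rightarrow> nat list \<Rightarrow> 'a" where
  "quantum_dim qh eh \<mu> = (\<Prod>x\<in>boxes \<mu>.
     (eh * qh powi box_content x - inverse eh * qh powi (- box_content x)) /
     (qh powi hook \<mu> x - qh powi (- hook \<mu> x)))"

definition E_series :: "'a::field \<Rightarrow> 'a \<Rightarrow> nat list \<Rightarrow> 'a fps" where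
  "E_series qh eh \<mu> = (let q = qh\<^sup>2; v = inverse (eh\<^sup>2) in
     (\<Prod>i = 1..length \<mu>. (1 + fps_const (q powi (int (part \<mu> i) - int i)) * fps_X) /
                          (1 + fps_const (q powi (- int i)) * fps_X)) *
     Abs_fps (\<lambda>n. \<Prod>i = 1..n. (1 - v * q ^ (i - 1)) / (q ^ i - 1)))"

text \<open>The sum over all partitions \<open>\<eta>\<close> is restricted to those contained in both outer shapes; all other
  terms vanish, because a skew Schur function is 0 unless the inner shape is contained in the outer
  one.\<close>

definition vertex :: "'a::field \<Rightarrow> 'a \<Rightarrow> nat list \<Rightarrow> nat list \<Rightarrow> nat list \<Rightarrow> 'a" where
  "vertex qh eh \<mu>1 \<mu>2 \<mu>3 =
     qh powi kappa \<mu>3 * eh powi (- int (sum_list \<mu>2)) * quantum_dim qh eh \<mu>2 *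
     (\<Sum>\<eta> | is_partition \<eta> \<and> boxes \<eta> \<subseteq> boxes \<mu>1 \<and> boxes \<eta> \<subseteq> boxes (conjugate \<mu>3).
        qh powi (int (sum_list \<mu>1) - int (sum_list \<eta>)) *
        specialize (skew_schur \<mu>1 \<eta>) (E_series qh eh (conjugate \<mu>2)) *
        (qh powi (int (sum_list \<mu>3) - int (sum_list \<eta>)) *
         specialize (skew_schur (conjugate \<mu>3) \<eta>) (E_series qh eh \<mu>2)))"


section \<open>Partition functions\<close>

text \<open>Formal power series in \<open>Q, Q\<^sub>1, Q\<^sub>m\<close> are nested univariate series: \<open>Q\<close> is the outermost
  variable, then \<open>Q\<^sub>1\<close>, and \<open>Q\<^sub>m\<close> is the innermost one. A sum over partitions weighted by
  \<open>Q\<^bsup>|\<mu>|\<^esup>\<close> etc. is given by its coefficients, which are finite sums.\<close>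

definition Z_full :: "'a::field \<Rightarrow> 'a \<Rightarrow> 'a fps fps fps" where
  "Z_full qh eh = Abs_fps (\<lambda>a. Abs_fps (\<lambda>b. Abs_fps (\<lambda>c.
     \<Sum>\<mu>\<in>partitions a. \<Sum>\<nu>\<in>partitions b. \<Sum>\<eta>\<in>partitions c.
       (- 1) ^ a * (- 1) ^ b * (- 1) ^ c *
       vertex qh eh \<eta> \<mu> \<nu> * vertex qh eh (conjugate \<eta>) (conjugate \<mu>) (conjugate \<nu>))))"

definition Z_pert :: "'a::field \<Rightarrow> 'a \<Rightarrow> 'a fps fps" where
  "Z_pert qh eh = Abs_fps (\<lambda>b. Abs_fps (\<lambda>c.
     \<Sum>\<nu>\<in>partitions b. \<Sum>\<eta>\<in>partitions c.
       (- 1) ^ b * (- 1) ^ c *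
       vertex qh eh \<eta> [] \<nu> * vertex qh eh (conjugate \<eta>) [] (conjugate \<nu>)))"

abbreviation Q\<^sub>1 :: "'a::field fps fps" where
  "Q\<^sub>1 \<equiv> fps_X"

abbreviation Q\<^sub>m :: "'a::field fps fps" where
  "Q\<^sub>m \<equiv> fps_const fps_X"

abbreviation Q\<^sub>\<rho> :: "'a::field fps fps" where
  "Q\<^sub>\<rho> \<equiv> Q\<^sub>1 * Q\<^sub>m"

abbreviation scalar :: "'a::field \<Rightarrow> 'a fps fps" where
  "scalar c \<equiv> fps_const (fps_const c)"

end

theory Submission
  imports Defs "HOL-Computational_Algebra.Fundamental_Theorem_Algebra"
begin

text \<open>For fixed \<open>\<mu>\<close> the sum over \<open>\<nu>\<close> and \<open>\<eta>\<close> is the trace of a cyclic product of four vertex operators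
  (a periodic Schur process): two of them add or remove horizontal strips, the other two vertical
  strips. Moving the operators past each other around the circle multiplies their variables by \<open>Q\<^sub>1\<close> or \<open>Q\<^sub>m\<close> and
  produces Cauchy kernels \<open>\<Prod>(1 - M x\<^sub>i y\<^sub>j)\<close>. In the limit the variables disappear, so the trace is an
  infinite product of kernels times a series that does not depend on \<open>\<mu>\<close>, and this series cancels in the
  quotient by the case \<open>\<mu> = (0)\<close>.

  The alphabet of \<open>E\<^sup>\<mu>\<close> is infinite, but for \<open>e\<^bsup>-t\<^esup> = q\<^bsup>-N\<^esup>\<close> with \<open>N\<close> large it collapses to the finite
  alphabet \<open>q\<^bsup>\<mu>\<^sub>i-i\<^esup>\<close>, \<open>i \<le> N\<close>. All coefficients are polynomials in \<open>e\<^bsup>-t\<^esup>\<close>, so these values suffice.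
  There the quotient of the kernels of \<open>\<mu>\<close> and of \<open>(0)\<close> is a product over the boxes of \<open>\<mu>\<close>, because the sets
  \<open>{\<mu>\<^sub>i - i}\<close> and \<open>{j - 1 - \<mu>\<^sup>t\<^sub>j}\<close>, \<open>i, j \<le> N\<close>, partition \<open>{-N, \<dots>, N - 1}\<close>.\<close>

text \<open>Three limits are kept apart: the size \<open>N\<close> of the alphabet, the number of
  turns around the circle, and the infinite products. After \<open>2*m\<close> turns the remainder
  has total degree at least \<open>m\<close> in \<open>Q\<^sub>1\<close> and
  \<open>Q\<^sub>m\<close>, whatever \<open>N\<close> is. So the result is first proved modulo
  degree \<open>m\<close>, between finite products and with all denominators cleared. In this form
  each coefficient is a polynomial in \<open>v\<close> = e^(-t) that does not depend on
  \<open>N\<close>, and the values q^(-N), pairwise different because \<open>q\<close> is not a root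
  of unity, determine it. Quotients and infinite products are formed only afterwards. The vertical
  strips come from the second vertex, all of whose shapes are transposed. Transposition also
  reverses contents, so the framing factors of the two vertices are inverse to each other. Kernels
  of mixed operators give the numerators with \<open>Q\<^sub>m\<close> and \<open>Q\<^sub>1\<close>.
  The two horizontal and the two vertical operators meet with the same power of
  \<open>Q\<^sub>\<rho>\<close>, which explains the squares.\<close>

unbundle no vec_syntax and fps_syntax

section \<open>Diagrams\<close>

text \<open>Rows are total functions, so containment, transposition and interlacing become pointwise
  statements, free of the side conditions on lists (no zero parts, index below the length). Rows and
  columns count from 0 here.\<close>

typedef diagram = "{f :: nat \<Rightarrow> nat. antimono f \<and> (\<exists>n. f n = 0)}"
  morphisms row Diagram
  by (rule exI[of _ "\<lambda>_. 0"]) (auto simp: antimono_def)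

lemma row_antimono: "i \<le> j \<Longrightarrow> row d j \<le> row d i"
  using row[of d] by (auto simp: antimono_def)

lemma ex_row_0: "\<exists>n. row d n = 0"
  using row[of d] by auto

lemma row_Diagram: "antimono f \<Longrightarrow> f n = 0 \<Longrightarrow> row (Diagram f) = f"
  by (subst Diagram_inverse) auto

lemma diagram_eqI: "(\<And>i. row c i = row d i) \<Longrightarrow> c = d"
  by (metis ext row_inject)

definition nrows :: "diagram \<Rightarrow> nat" where
  "nrows d = (LEAST n. row d n = 0)"

definition dsize :: "diagram \<Rightarrow> nat" where
  "dsize d = (\<Sum>i<nrows d. row d i)"

lemma row_eq_0_iff: "row d i = 0 \<longleftrightarrow> nrows d \<le> i"
proof
  assume "row d i = 0"
  thus "nrows d \<le> i" unfolding nrows_def by (rule Least_le)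
next
  assume "nrows d \<le> i"
  moreover have "row d (nrows d) = 0"
    unfolding nrows_def using ex_row_0 by (rule LeastI_ex)
  ultimately show "row d i = 0"
    using row_antimono[of "nrows d" i d] by simp
qed

lemma dsize_eq_sum: "nrows d \<le> n \<Longrightarrow> dsize d = (\<Sum>i<n. row d i)"
  unfolding dsize_def by (rule sum.mono_neutral_left) (auto simp: row_eq_0_iff not_less)

instantiation diagram :: order
begin
definition "c \<le> d \<longleftrightarrow> (\<forall>i. row c i \<le> row d i)"
definition "c < d \<longleftrightarrow> c \<le> d \<and> \<not> d \<le> (c :: diagram)"
instance
proof
  fix c d e :: diagram
  show "c < d \<longleftrightarrow> c \<le> d \<and> \<not> d \<le> c" by (simp add: less_diagram_def)
  show "c \<le> c" by (simp add: less_eq_diagram_def)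
  show "c \<le> e" if "c \<le> d" "d \<le> e"
    using that by (auto simp: less_eq_diagram_def intro: order_trans)
  show "c = d" if "c \<le> d" "d \<le> c"
    using that by (auto simp: less_eq_diagram_def intro!: diagram_eqI antisym)
qed
end

lemma row_mono: "c \<le> d \<Longrightarrow> row c i \<le> row d i"
  by (simp add: less_eq_diagram_def)

lemma nrows_mono: "c \<le> d \<Longrightarrow> nrows c \<le> nrows d"
  by (metis le_zero_eq order_refl row_eq_0_iff row_mono)

lemma dsize_mono: "c \<le> d \<Longrightarrow> dsize c \<le> dsize d"
  by (simp add: dsize_eq_sum[OF nrows_mono] dsize_eq_sum[OF order_refl[of "nrows d"]] sum_mono row_mono)

lemma dsize_eq_imp_eq: assumes "c \<le> d" "dsize c = dsize d" shows "c = d"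
proof (rule diagram_eqI)
  fix i
  have *: "(\<Sum>i<nrows d. row c i) = (\<Sum>i<nrows d. row d i)"
    using assms dsize_eq_sum[OF nrows_mono[OF assms(1)]] by (simp add: dsize_def)
  show "row c i = row d i"
  proof (cases "i < nrows d")
    case True
    show ?thesis
    proof (rule ccontr)
      assume "row c i \<noteq> row d i"
      hence "row c i < row d i" using row_mono[OF assms(1), of i] by simp
      hence "(\<Sum>i<nrows d. row c i) < (\<Sum>i<nrows d. row d i)"
        by (intro sum_strict_mono_ex1) (use True row_mono[OF assms(1)] in auto)
      thus False using * by simp
    qed
  next
    case False
    thus ?thesis using row_mono[OF assms(1), of i] row_eq_0_iff[of d i] by simp
  qed
qed

lemma row_le_dsize: "row d i \<le> dsize d"
proof (cases "i < nrows d")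
  case True thus ?thesis unfolding dsize_def by (intro member_le_sum) auto
next
  case False thus ?thesis using row_eq_0_iff[of d i] by simp
qed

lemma nrows_le_dsize: "nrows d \<le> dsize d"
proof -
  have "(\<Sum>i<nrows d. 1) \<le> (\<Sum>i<nrows d. row d i)"
    using row_eq_0_iff[of d] by (intro sum_mono) (metis One_nat_def Suc_leI gr0I leD lessThan_iff)
  thus ?thesis by (simp add: dsize_def)
qed

lemma finite_diagrams_bounded: "finite {d. nrows d \<le> n \<and> (\<forall>i. row d i \<le> m)}"
proof -
  have "finite {f :: nat \<Rightarrow> nat. \<forall>i. (i \<in> {..<n} \<longrightarrow> f i \<in> {..m}) \<and> (i \<notin> {..<n} \<longrightarrow> f i = 0)}"
    by (rule finite_set_of_finite_funs) auto
  moreover have "row ` {d. nrows d \<le> n \<and> (\<forall>i. row d i \<le> m)} \<subseteq>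
    {f :: nat \<Rightarrow> nat. \<forall>i. (i \<in> {..<n} \<longrightarrow> f i \<in> {..m}) \<and> (i \<notin> {..<n} \<longrightarrow> f i = 0)}"
    by (auto simp: row_eq_0_iff)
  ultimately have "finite (row ` {d. nrows d \<le> n \<and> (\<forall>i. row d i \<le> m)})"
    by (rule rev_finite_subset)
  thus ?thesis by (rule finite_imageD) (meson injI inj_on_subset row_inject subset_UNIV)
qed

lemma finite_dsize_le: "finite {d. dsize d \<le> n}"
  by (rule finite_subset[OF _ finite_diagrams_bounded[of n n]])
    (auto intro: order_trans[OF row_le_dsize] order_trans[OF nrows_le_dsize])

lemma finite_below: "finite {c. c \<le> (d :: diagram)}"
  by (rule finite_subset[OF _ finite_dsize_le[of "dsize d"]]) (auto dest: dsize_mono)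

definition cells :: "diagram \<Rightarrow> (nat \<times> nat) set" where
  "cells d = {(i, j). j < row d i}"

lemma mem_cells: "(i, j) \<in> cells d \<longleftrightarrow> j < row d i"
  by (simp add: cells_def)

lemma cells_subset_iff: "cells c \<subseteq> cells d \<longleftrightarrow> c \<le> d"
  unfolding cells_def less_eq_diagram_def
  by (auto dest: less_le_trans) (metis (no_types, lifting) case_prodI linorder_not_le mem_Collect_eq case_prodD subsetD nat_less_le)

lemma cells_Sigma: "cells d = (SIGMA i:{..<nrows d}. {..<row d i})"
  by (auto simp: cells_def) (metis less_zeroE linorder_not_le row_eq_0_iff)

lemma finite_cells: "finite (cells d)"
  by (simp add: cells_Sigma)

lemma card_cells: "card (cells d) = dsize d"
  by (simp add: cells_Sigma dsize_def)

section \<open>Transposition of diagrams\<close>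

definition mirror :: "diagram \<Rightarrow> diagram" where
  "mirror d = Diagram (\<lambda>j. card {i. j < row d i})"

lemma finite_column: "finite {i. j < row d i}"
  by (rule finite_subset[of _ "{..<nrows d}"]) (auto, metis less_zeroE linorder_not_le row_eq_0_iff)

lemma row_mirror: "row (mirror d) j = card {i. j < row d i}"
proof -
  have "antimono (\<lambda>j. card {i. j < row d i})"
    unfolding antimono_def by (auto intro!: card_mono finite_column)
  moreover have "{i. row d 0 < row d i} = {}"
    using row_antimono[of 0 _ d] by (auto simp: not_less)
  hence "card {i. row d 0 < row d i} = 0" by simp
  ultimately show ?thesis unfolding mirror_def by (subst row_Diagram) auto
qed

text \<open>Rows decrease weakly, so column \<open>j\<close> meets an initial segment of the rows
  and its length decides membership. Later facts about transposed diagrams are reduced to this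
  symmetric form.\<close>

lemma less_row_mirror_iff: "i < row (mirror d) j \<longleftrightarrow> j < row d i"
proof -
  have *: "\<exists>n. {i. j < row d i} = {..<n}"
  proof (rule exI[of _ "LEAST n. row d n \<le> j"], safe)
    have ex: "\<exists>n. row d n \<le> j" using ex_row_0[of d] by (metis le0)
    fix k
    show "k < (LEAST n. row d n \<le> j)" if "j < row d k"
    proof (rule ccontr)
      assume "\<not> k < (LEAST n. row d n \<le> j)"
      hence "row d k \<le> row d (LEAST n. row d n \<le> j)" by (intro row_antimono) simp
      also have "\<dots> \<le> j" using ex by (rule LeastI_ex)
      finally show False using that by simp
    qed
    show "j < row d k" if "k < (LEAST n. row d n \<le> j)"
      using not_less_Least[OF that] by simp
  qed
  then obtain n where n: "{i. j < row d i} = {..<n}" by blast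
  hence "row (mirror d) j = n" by (simp add: row_mirror)
  with n show ?thesis by auto
qed

lemma mirror_mirror [simp]: "mirror (mirror d) = d"
proof (rule diagram_eqI)
  fix i
  have "j < row (mirror (mirror d)) i \<longleftrightarrow> j < row d i" for j
    by (simp add: less_row_mirror_iff)
  thus "row (mirror (mirror d)) i = row d i" by (meson linorder_neqE_nat less_irrefl)
qed

lemma mirror_mono: "c \<le> d \<Longrightarrow> mirror c \<le> mirror d"
  unfolding cells_subset_iff[symmetric] by (auto simp: cells_def less_row_mirror_iff)

lemma mirror_le_iff [simp]: "mirror c \<le> mirror d \<longleftrightarrow> c \<le> d"
  using mirror_mono[of c d] mirror_mono[of "mirror c" "mirror d"] by auto

lemma bij_mirror: "bij mirror"
  by (rule o_bij[of mirror]) auto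

lemma cells_mirror: "cells (mirror d) = prod.swap ` cells d"
  by (auto simp: cells_def less_row_mirror_iff image_iff)

lemma dsize_mirror [simp]: "dsize (mirror d) = dsize d"
  by (simp add: card_cells[symmetric] cells_mirror card_image)

section \<open>Diagrams of lists of parts\<close>

definition diag :: "nat list \<Rightarrow> diagram" where
  "diag l = Diagram (\<lambda>i. part l (Suc i))"

lemma row_diag:
  assumes "is_partition l"
  shows "row (diag l) i = (if i < length l then l ! i else 0)"
proof -
  have "antimono (\<lambda>i. part l (Suc i))"
    using assms by (auto simp: antimono_iff_le_Suc part_def is_partition_def sorted_wrt_iff_nth_less)
  moreover have "part l (Suc (length l)) = 0" by (simp add: part_def)
  ultimately show ?thesis unfolding diag_def
    by (subst row_Diagram[where n = "length l"]) (auto simp: part_def)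
qed

lemma row_diag_part: "is_partition l \<Longrightarrow> row (diag l) i = part l (Suc i)"
  by (simp add: row_diag part_def)

lemma nrows_diag: assumes "is_partition l" shows "nrows (diag l) = length l"
proof -
  have "0 < row (diag l) i" if "i < length l" for i
    using that assms by (metis gr0I is_partition_def nth_mem row_diag)
  moreover have "row (diag l) (length l) = 0" by (simp add: row_diag assms)
  ultimately show ?thesis by (metis le_antisym linorder_not_le nat_less_le row_eq_0_iff)
qed

lemma dsize_diag: "is_partition l \<Longrightarrow> dsize (diag l) = sum_list l"
  by (simp add: dsize_def nrows_diag row_diag sum_list_sum_nth atLeast0LessThan)

lemma inj_on_diag: "inj_on diag {l. is_partition l}"
proof (rule inj_onI, safe)
  fix k l assume *: "is_partition k" "is_partition l" "diag k = diag l"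
  show "k = l"
  proof (rule nth_equalityI)
    show "length k = length l" using * nrows_diag by metis
    fix i assume "i < length k"
    thus "k ! i = l ! i" using * row_diag[of k i] row_diag[of l i] \<open>length k = length l\<close> by simp
  qed
qed

lemma diag_surj: "\<exists>l. is_partition l \<and> diag l = d"
proof (rule exI[of _ "map (row d) [0..<nrows d]"], rule conjI)
  show *: "is_partition (map (row d) [0..<nrows d])"
    using row_eq_0_iff[of d] by (auto simp: is_partition_def sorted_wrt_iff_nth_less row_antimono)
  show "diag (map (row d) [0..<nrows d]) = d"
    by (rule diagram_eqI) (use row_eq_0_iff[of d] in \<open>auto simp: row_diag[OF *] not_less\<close>)
qed

lemma bij_betw_diag: "bij_betw diag {l. is_partition l} UNIV"
  using inj_on_diag diag_surj by (auto simp: bij_betw_def image_iff) metis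

lemma bij_betw_diag_partitions: "bij_betw diag (partitions n) {d. dsize d = n}"
proof (rule bij_betw_subset[OF bij_betw_diag, THEN bij_betw_cong[THEN iffD1, rotated]])
qed (auto simp: partitions_def dsize_diag image_iff, metis diag_surj dsize_diag)

lemma boxes_eq: "is_partition l \<Longrightarrow> boxes l = map_prod Suc Suc ` cells (diag l)"
proof -
  assume l: "is_partition l"
  have "(i, j) \<in> boxes l \<longleftrightarrow> (\<exists>i' j'. i = Suc i' \<and> j = Suc j' \<and> j' < row (diag l) i')" for i j
    unfolding boxes_def by (cases i; cases j) (auto simp: row_diag_part[OF l] part_def split: if_splits)
  thus ?thesis by (force simp: cells_def)
qed

lemma boxes_subset_iff: 
  "is_partition k \<Longrightarrow> is_partition l \<Longrightarrow> boxes k \<subseteq> boxes l \<longleftrightarrow> diag k \<le> diag l"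
  by (simp add: boxes_eq cells_subset_iff[symmetric] inj_image_subset_iff prod.inj_map)

lemma is_partition_conjugate_diag: 
  assumes l: "is_partition l"
  shows "is_partition (conjugate l)" "diag (conjugate l) = mirror (diag l)"
proof -
  have *: "card {i. (i, Suc j) \<in> boxes l} = row (mirror (diag l)) j" for j
  proof -
    have "{i. (i, Suc j) \<in> boxes l} = Suc ` {i. j < row (diag l) i}"
      by (auto simp: boxes_eq[OF l] cells_def image_iff)
    thus ?thesis by (simp add: row_mirror card_image)
  qed
  have "conjugate l = map (\<lambda>j. row (mirror (diag l)) j) [0..<part l 1]"
    unfolding conjugate_def *[symmetric] by (simp del: upt_Suc add: map_Suc_upt[symmetric])
  also have "part l 1 = row (diag l) 0" by (simp add: row_diag_part[OF l])
  also have "row (diag l) 0 = nrows (mirror (diag l))"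
    by (metis less_row_mirror_iff linorder_not_le neq0_conv order_antisym row_eq_0_iff order_refl)
  finally have c: "conjugate l = map (row (mirror (diag l))) [0..<nrows (mirror (diag l))]" .
  let ?d = "mirror (diag l)"
  show p: "is_partition (conjugate l)" unfolding c
    using row_eq_0_iff[of ?d] by (auto simp: is_partition_def sorted_wrt_iff_nth_less row_antimono)
  show "diag (conjugate l) = ?d"
    by (rule diagram_eqI, subst row_diag[OF p]) (use row_eq_0_iff[of ?d] in \<open>auto simp: c not_less\<close>)
qed

section \<open>Formal sums of bivariate power series\<close>

text \<open>The filtration by total degree. The topology of \<open>'r fps fps\<close> sees only the outer variable, so it
  cannot be used for the sums over partitions below.\<close>

definition ord_ge :: "'r::comm_ring_1 fps fps \<Rightarrow> nat \<Rightarrow> bool" where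
  "ord_ge F n \<longleftrightarrow> (\<forall>b c. b + c < n \<longrightarrow> F $ b $ c = 0)"

lemma ord_ge_zero [simp]: "ord_ge 0 n" and ord_ge_trivial [simp]: "ord_ge F 0"
  by (auto simp: ord_ge_def)

lemma ord_ge_add: "ord_ge F n \<Longrightarrow> ord_ge G n \<Longrightarrow> ord_ge (F + G) n"
  and ord_ge_diff: "ord_ge F n \<Longrightarrow> ord_ge G n \<Longrightarrow> ord_ge (F - G) n"
  and ord_ge_uminus: "ord_ge F n \<Longrightarrow> ord_ge (- F) n"
  by (auto simp: ord_ge_def)

lemma ord_ge_mono: "ord_ge F n \<Longrightarrow> m \<le> n \<Longrightarrow> ord_ge F m"
  by (auto simp: ord_ge_def)

lemma ord_ge_sum: "(\<And>i. i \<in> A \<Longrightarrow> ord_ge (f i) n) \<Longrightarrow> ord_ge (sum f A) n"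
  by (induction A rule: infinite_finite_induct) (auto intro: ord_ge_add)

lemma fps2_mult_nth:
  "(F * G) $ b $ c = (\<Sum>i=0..b. \<Sum>j=0..c. F $ i $ j * G $ (b - i) $ (c - j))"
  by (simp add: fps_mult_nth fps_sum_nth)

lemma ord_ge_mult: "ord_ge F m \<Longrightarrow> ord_ge G n \<Longrightarrow> ord_ge (F * G) (m + n)"
  unfolding ord_ge_def fps2_mult_nth
proof (intro allI impI sum.neutral ballI)
  fix b c i j
  assume F: "\<forall>b c. b + c < m \<longrightarrow> F $ b $ c = 0" and G: "\<forall>b c. b + c < n \<longrightarrow> G $ b $ c = 0"
    and bc: "b + c < m + n" and ij: "i \<in> {0..b}" "j \<in> {0..c}"
  show "F $ i $ j * G $ (b - i) $ (c - j) = 0"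
  proof (cases "i + j < m")
    case False
    hence "b - i + (c - j) < n" using bc ij by auto
    thus ?thesis using G by simp
  qed (use F in simp)
qed

lemma ord_ge_mult_left: "ord_ge G n \<Longrightarrow> ord_ge (F * G) n"
  using ord_ge_mult[of F 0 G n] by simp

lemma ord_ge_mult_right: "ord_ge F n \<Longrightarrow> ord_ge (F * G) n"
  using ord_ge_mult[of F n G 0] by simp

lemma ord_ge_power: "ord_ge F 1 \<Longrightarrow> ord_ge (F ^ k) k"
  by (induction k) (use ord_ge_mult[of F 1] in auto)

lemma ord_ge_eqI: assumes "\<And>n. ord_ge (F - G) n" shows "F = G"
proof (intro fps_ext)
  fix b c
  show "F $ b $ c = G $ b $ c" using assms[of "Suc (b + c)"] by (auto simp: ord_ge_def)
qed

lemma ord_ge_trans: "ord_ge (F - G) n \<Longrightarrow> ord_ge (G - H) n \<Longrightarrow> ord_ge (F - H) n"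
  using ord_ge_add[of "F - G" n "G - H"] by simp

lemma ord_ge_commute: "ord_ge (F - G) n \<Longrightarrow> ord_ge (G - F) n"
  using ord_ge_uminus[of "F - G" n] by simp

lemma ord_ge_diff_mult: assumes "ord_ge (F - F') n" "ord_ge (G - G') n" shows "ord_ge (F * G - F' * G') n"
proof -
  have "F * G - F' * G' = (F - F') * G + F' * (G - G')" by (simp add: algebra_simps)
  thus ?thesis using assms by (simp add: ord_ge_add ord_ge_mult_left ord_ge_mult_right)
qed

text \<open>\<open>F = U * F - (U - 1) * F\<close>, and the last term has one degree more than is
  known of \<open>F\<close>, so the bound rises step by step. This takes the place of dividing by
  kernels.\<close>

lemma ord_ge_cancel_unit:
  assumes U: "ord_ge (U - 1) 1" and "ord_ge (U * F) n"
  shows "ord_ge F n"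
proof -
  have "ord_ge F m" if "m \<le> n" for m
    using that
  proof (induction m)
    case (Suc m)
    have "ord_ge ((U - 1) * F) (1 + m)" using ord_ge_mult[OF U Suc.IH] Suc.prems by simp
    moreover have "ord_ge (U * F) (1 + m)" using assms(2) Suc.prems by (auto intro: ord_ge_mono)
    ultimately have "ord_ge (U * F - (U - 1) * F) (1 + m)" by (intro ord_ge_diff)
    thus ?case by (simp add: algebra_simps)
  qed simp
  thus ?thesis by simp
qed

section \<open>Summable families and their formal sums\<close>

definition vanishing :: "('i \<Rightarrow> 'r::comm_ring_1 fps fps) \<Rightarrow> bool" where
  "vanishing f \<longleftrightarrow> (\<forall>n. finite {i. \<not> ord_ge (f i) n})"

text \<open>Selecting the nonzero contributions makes each coefficient a finite sum when the family
  is vanishing. Over an infinite selection \<open>sum\<close> is 0 by convention, so linearity and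
  exchange of summation assume \<open>vanishing\<close>.\<close>

definition fsum :: "('i \<Rightarrow> 'r::comm_ring_1 fps fps) \<Rightarrow> 'r fps fps" where
  "fsum f = Abs_fps (\<lambda>b. Abs_fps (\<lambda>c. \<Sum>i | f i $ b $ c \<noteq> 0. f i $ b $ c))"

lemma fsum_nth: "fsum f $ b $ c = (\<Sum>i | f i $ b $ c \<noteq> 0. f i $ b $ c)"
  by (simp add: fsum_def)

lemma vanishingD: "vanishing f \<Longrightarrow> finite {i. \<not> ord_ge (f i) n}"
  by (simp add: vanishing_def)

lemma fsum_approx:
  assumes "finite S" "{i. \<not> ord_ge (f i) n} \<subseteq> S"
  shows "ord_ge (fsum f - sum f S) n"
  unfolding ord_ge_def
proof (intro allI impI)
  fix b c assume bc: "b + c < n"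
  have "(\<Sum>i | f i $ b $ c \<noteq> 0. f i $ b $ c) = (\<Sum>i\<in>S. f i $ b $ c)"
    by (rule sum.mono_neutral_left) (use assms bc in \<open>auto simp: ord_ge_def\<close>)
  thus "(fsum f - sum f S) $ b $ c = 0" by (simp add: fsum_nth fps_sum_nth)
qed

text \<open>Modulo degree \<open>n\<close> a formal sum is a finite sum over any large enough index
  set. Linearity and Fubini follow by naming such a set for each \<open>n\<close> and applying the
  laws of finite sums.\<close>

lemma fsum_unique:
  assumes "\<And>n. \<exists>S. finite S \<and> {i. \<not> ord_ge (f i) n} \<subseteq> S \<and> ord_ge (F - sum f S) n"
  shows "F = fsum f"
proof (rule ord_ge_eqI)
  fix n
  from assms[of n] obtain S where "finite S" "{i. \<not> ord_ge (f i) n} \<subseteq> S" "ord_ge (F - sum f S) n" by blast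
  thus "ord_ge (F - fsum f) n" using ord_ge_commute[OF fsum_approx] ord_ge_trans by blast
qed

lemma not_ord_ge_subset: "(\<And>i. i \<notin> S \<Longrightarrow> f i = 0) \<Longrightarrow> {i. \<not> ord_ge (f i) n} \<subseteq> S"
proof
  fix i assume "\<And>i. i \<notin> S \<Longrightarrow> f i = 0" "i \<in> {i. \<not> ord_ge (f i) n}"
  thus "i \<in> S" by (cases "i \<in> S") auto
qed

lemma vanishing_finite: "finite S \<Longrightarrow> (\<And>i. i \<notin> S \<Longrightarrow> f i = 0) \<Longrightarrow> vanishing f"
  unfolding vanishing_def by (intro allI finite_subset[OF not_ord_ge_subset[of S]])

lemma fsum_finite:
  assumes "finite S" "\<And>i. i \<notin> S \<Longrightarrow> f i = 0"
  shows "fsum f = sum f S"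
proof (rule fsum_unique[symmetric])
  fix n
  show "\<exists>T. finite T \<and> {i. \<not> ord_ge (f i) n} \<subseteq> T \<and> ord_ge (sum f S - sum f T) n"
  proof (intro exI[of _ S] conjI)
    show "{i. \<not> ord_ge (f i) n} \<subseteq> S" using assms(2) by (rule not_ord_ge_subset)
  qed (use assms in auto)
qed

lemma fsum_mult_left:
  assumes "vanishing f" shows "fsum (\<lambda>i. c * f i) = c * fsum f"
proof (rule fsum_unique[symmetric])
  fix n
  let ?S = "{i. \<not> ord_ge (f i) n}"
  have "ord_ge (c * (fsum f - sum f ?S)) n"
    by (intro ord_ge_mult_left fsum_approx vanishingD assms order_refl)
  hence "ord_ge (c * fsum f - (\<Sum>i\<in>?S. c * f i)) n"
    by (simp add: sum_distrib_left right_diff_distrib)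
  thus "\<exists>S. finite S \<and> {i. \<not> ord_ge (c * f i) n} \<subseteq> S \<and> ord_ge (c * fsum f - (\<Sum>i\<in>S. c * f i)) n"
    using vanishingD[OF assms] by (intro exI[of _ ?S]) (auto intro: ord_ge_mult_left)
qed

lemma fsum_mult_right:
  "vanishing f \<Longrightarrow> fsum (\<lambda>i. f i * c) = fsum f * c"
  using fsum_mult_left[of f c] by (simp add: mult.commute)

lemma fsum_diff:
  assumes "vanishing f" "vanishing g" shows "fsum (\<lambda>i. f i - g i) = fsum f - fsum g"
proof (rule fsum_unique[symmetric])
  fix n
  let ?S = "{i. \<not> ord_ge (f i) n} \<union> {i. \<not> ord_ge (g i) n}"
  have fin: "finite ?S" using assms by (simp add: vanishingD)
  have "ord_ge ((fsum f - sum f ?S) - (fsum g - sum g ?S)) n"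
    by (intro ord_ge_diff fsum_approx fin) auto
  hence "ord_ge (fsum f - fsum g - (\<Sum>i\<in>?S. f i - g i)) n"
    by (simp add: sum_subtractf algebra_simps)
  thus "\<exists>S. finite S \<and> {i. \<not> ord_ge (f i - g i) n} \<subseteq> S \<and> ord_ge (fsum f - fsum g - (\<Sum>i\<in>S. f i - g i)) n"
    using fin by (intro exI[of _ ?S]) (auto intro: ord_ge_diff)
qed

lemma fsum_reindex:
  assumes "bij g" shows "fsum (\<lambda>i. f (g i)) = fsum f"
proof (intro fps_ext)
  fix b c
  have "bij_betw g {i. f (g i) $ b $ c \<noteq> 0} {j. f j $ b $ c \<noteq> 0}"
  proof (rule bij_betw_imageI)
    show "inj_on g {i. f (g i) $ b $ c \<noteq> 0}" using assms by (auto simp: bij_def inj_on_def)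
    show "g ` {i. f (g i) $ b $ c \<noteq> 0} = {j. f j $ b $ c \<noteq> 0}"
    proof (rule set_eqI)
      fix j
      have "g (inv g j) = j" using assms by (simp add: bij_is_surj surj_f_inv_f)
      thus "j \<in> g ` {i. f (g i) $ b $ c \<noteq> 0} \<longleftrightarrow> j \<in> {j. f j $ b $ c \<noteq> 0}"
        by (auto simp: image_iff intro!: exI[of _ "inv g j"])
    qed
  qed
  thus "fsum (\<lambda>i. f (g i)) $ b $ c = fsum f $ b $ c"
    unfolding fsum_nth by (rule sum.reindex_bij_betw)
qed

lemma vanishing_reindex:
  assumes "inj g" "vanishing f" shows "vanishing (\<lambda>i. f (g i))"
  unfolding vanishing_def
proof
  fix n
  have "g ` {i. \<not> ord_ge (f (g i)) n} \<subseteq> {j. \<not> ord_ge (f j) n}" by auto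
  hence "finite (g ` {i. \<not> ord_ge (f (g i)) n})" using vanishingD[OF assms(2)] by (rule finite_subset)
  thus "finite {i. \<not> ord_ge (f (g i)) n}" using assms(1) by (simp add: finite_image_iff inj_on_subset)
qed

lemma ord_ge_fsum: "(\<And>i. ord_ge (f i) n) \<Longrightarrow> ord_ge (fsum f) n"
  using fsum_approx[of "{}" f n] by simp

lemma fsum_cong_mod:
  assumes "vanishing f" "vanishing g" "\<And>i. ord_ge (f i - g i) n"
  shows "ord_ge (fsum f - fsum g) n"
  using ord_ge_fsum[of "\<lambda>i. f i - g i" n] assms by (simp add: fsum_diff)

lemma vanishing_swap:
  assumes "vanishing (\<lambda>(i, j). f i j)" shows "vanishing (\<lambda>(j, i). f i j)"
  using vanishing_reindex[of prod.swap "\<lambda>(i, j). f i j"] assms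
  by (simp add: prod.swap_def case_prod_unfold)

lemma vanishing_fsum:
  assumes "vanishing (\<lambda>(i, j). f i j)" shows "vanishing (\<lambda>i. fsum (f i))"
  unfolding vanishing_def
proof
  fix n
  have "{i. \<not> ord_ge (fsum (f i)) n} \<subseteq> fst ` {(i, j). \<not> ord_ge (f i j) n}"
  proof safe
    fix i assume "\<not> ord_ge (fsum (f i)) n"
    then obtain j where "\<not> ord_ge (f i j) n" using ord_ge_fsum[of "f i" n] by blast
    hence "(i, j) \<in> {(i, j). \<not> ord_ge (f i j) n}" by simp
    thus "i \<in> fst ` {(i, j). \<not> ord_ge (f i j) n}" by (metis fst_conv imageI)
  qed
  moreover have "finite {(i, j). \<not> ord_ge (f i j) n}"
    using vanishingD[OF assms, of n] by (simp add: case_prod_unfold)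
  ultimately show "finite {i. \<not> ord_ge (fsum (f i)) n}" by (rule finite_subset[OF _ finite_imageI])
qed

lemma fsum_Pair:
  assumes "vanishing (\<lambda>(i, j). f i j)"
  shows "fsum (\<lambda>(i, j). f i j) = fsum (\<lambda>i. fsum (f i))"
proof (rule fsum_unique)
  fix n
  let ?P = "{p. \<not> ord_ge (case p of (i, j) \<Rightarrow> f i j) n}"
  \<comment> \<open>The projections span a finite rectangle. Every term outside it has degree at
    least \<open>n\<close>, so one set \<open>?J\<close> truncates the inner sums for all
    \<open>i\<close> at once.\<close>
  let ?I = "fst ` ?P" and ?J = "snd ` ?P"
  have finP: "finite ?P" using vanishingD[OF assms, of n] .
  have sub: "?P \<subseteq> ?I \<times> ?J" by (force simp: image_iff)
  have out: "ord_ge (f i j) n" if "i \<notin> ?I \<or> j \<notin> ?J" for i j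
    using that by (auto simp: image_iff)
  have 1: "ord_ge (fsum (\<lambda>(i, j). f i j) - (\<Sum>(i,j)\<in>?I \<times> ?J. f i j)) n"
    by (rule fsum_approx) (use finP sub in auto)
  have "ord_ge (\<Sum>i\<in>?I. sum (f i) ?J - fsum (f i)) n"
    by (intro ord_ge_sum ord_ge_commute[OF fsum_approx]) (use finP out in auto)
  hence 2: "ord_ge ((\<Sum>(i,j)\<in>?I \<times> ?J. f i j) - (\<Sum>i\<in>?I. fsum (f i))) n"
    by (simp add: sum_subtractf sum.cartesian_product)
  have "{i. \<not> ord_ge (fsum (f i)) n} \<subseteq> ?I"
  proof
    fix i assume "i \<in> {i. \<not> ord_ge (fsum (f i)) n}"
    then obtain j where "\<not> ord_ge (f i j) n" using ord_ge_fsum[of "f i" n] by blast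
    thus "i \<in> ?I" using out[of i j] by blast
  qed
  with ord_ge_trans[OF 1 2] finP
  show "\<exists>S. finite S \<and> {i. \<not> ord_ge (fsum (f i)) n} \<subseteq> S \<and>
     ord_ge (fsum (\<lambda>(i, j). f i j) - (\<Sum>i\<in>S. fsum (f i))) n"
    by (intro exI[of _ ?I]) auto
qed

lemma fsum_swap:
  assumes "vanishing (\<lambda>(i, j). f i j)"
  shows "fsum (\<lambda>i. fsum (f i)) = fsum (\<lambda>j. fsum (\<lambda>i. f i j))"
proof -
  have "fsum (\<lambda>(j, i). f i j) = fsum (\<lambda>(i, j). f i j)"
    using fsum_reindex[OF bij_swap, of "\<lambda>(i, j). f i j"] by (simp add: prod.swap_def case_prod_unfold)
  thus ?thesis
    using fsum_Pair[OF assms] fsum_Pair[OF vanishing_swap[OF assms]] by simp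
qed

lemma vanishing_product:
  assumes "vanishing f" "vanishing g"
  shows "vanishing (\<lambda>(i, j). f i * g j)"
  unfolding vanishing_def
proof
  fix n
  have "{p. \<not> ord_ge (case p of (i, j) \<Rightarrow> f i * g j) n} \<subseteq> {i. \<not> ord_ge (f i) n} \<times> {j. \<not> ord_ge (g j) n}"
    by (auto intro: ord_ge_mult_left ord_ge_mult_right)
  thus "finite {p. \<not> ord_ge (case p of (i, j) \<Rightarrow> f i * g j) n}"
    by (rule finite_subset) (simp add: vanishingD assms)
qed

lemma fsum_product:
  assumes "vanishing f" "vanishing g"
  shows "fsum f * fsum g = fsum (\<lambda>(i, j). f i * g j)"
  using assms by (simp add: fsum_Pair vanishing_product fsum_mult_left fsum_mult_right)

text \<open>There are only finitely many diagrams with a bounded number of boxes. The constant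
  \<open>K\<close> leaves room for the fixed diagrams at the ends of a matrix product.\<close>

lemma vanishing_dsize:
  assumes "\<And>m. ord_ge (f m) (dsize m - K)" shows "vanishing f"
  unfolding vanishing_def
proof
  fix n
  have "{m. \<not> ord_ge (f m) n} \<subseteq> {m. dsize m \<le> n + K}"
  proof safe
    fix m assume "\<not> ord_ge (f m) n"
    hence "\<not> n \<le> dsize m - K" using assms ord_ge_mono by blast
    thus "dsize m \<le> n + K" by auto
  qed
  thus "finite {m. \<not> ord_ge (f m) n}" using finite_dsize_le finite_subset by blast
qed

lemma vanishing_dsize2:
  assumes "\<And>m k. ord_ge (f m k) (dsize m - K)" "\<And>m k. ord_ge (f m k) (dsize k - K)"
  shows "vanishing (\<lambda>(m, k). f m k)"
  unfolding vanishing_def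
proof
  fix n
  have "dsize m \<le> n + K \<and> dsize k \<le> n + K" if "\<not> ord_ge (f m k) n" for m k
  proof -
    have "\<not> n \<le> dsize m - K" "\<not> n \<le> dsize k - K"
      using that assms ord_ge_mono by blast+
    thus ?thesis by auto
  qed
  hence "{p. \<not> ord_ge (case p of (m, k) \<Rightarrow> f m k) n} \<subseteq> {m. dsize m \<le> n + K} \<times> {m. dsize m \<le> n + K}"
    by auto
  thus "finite {p. \<not> ord_ge (case p of (m, k) \<Rightarrow> f m k) n}"
    by (rule finite_subset) (simp add: finite_dsize_le)
qed

section \<open>Triangular matrices and commutation relations\<close>

type_synonym 'r diagram_mat = "diagram \<Rightarrow> diagram \<Rightarrow> 'r fps fps"

definition lower :: "'r::comm_ring_1 diagram_mat \<Rightarrow> bool" where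
  "lower P \<longleftrightarrow> (\<forall>m l. P m l \<noteq> 0 \<longrightarrow> l \<le> m)"

text \<open>Each added box costs one degree. A product \<open>P Q\<close> of \<open>lower\<close>
  matrices is a finite sum over smaller diagrams, but \<open>P^T Q\<close> sums over larger ones and
  converges through this decay.\<close>

definition small :: "'r::comm_ring_1 diagram_mat \<Rightarrow> bool" where
  "small P \<longleftrightarrow> (\<forall>m l. ord_ge (P m l) (dsize m - dsize l))"

definition id_mat :: "'r::comm_ring_1 diagram_mat" where
  "id_mat m l = (if m = l then 1 else 0)"

definition mmult :: "'r::comm_ring_1 diagram_mat \<Rightarrow> 'r diagram_mat \<Rightarrow> 'r diagram_mat" where
  "mmult A B l n = fsum (\<lambda>m. A l m * B m n)"

text \<open>The relation \<open>a P\<^sup>T Q = b Q P\<^sup>T\<close>. Two scalars are kept so that no inverses are needed.\<close>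

definition commutes :: "'r::comm_ring_1 diagram_mat \<Rightarrow> 'r diagram_mat \<Rightarrow> 'r fps fps \<Rightarrow> 'r fps fps \<Rightarrow> bool" where
  "commutes P Q a b \<longleftrightarrow> (\<forall>l n. a * fsum (\<lambda>m. P m l * Q m n) = b * fsum (\<lambda>t. Q l t * P n t))"

lemma lowerD: "lower P \<Longrightarrow> P m l \<noteq> 0 \<Longrightarrow> l \<le> m"
  by (simp add: lower_def)

lemma lower_dsize: "lower P \<Longrightarrow> P m l \<noteq> 0 \<Longrightarrow> dsize l \<le> dsize m"
  by (simp add: lower_def dsize_mono)

lemma smallD: "small P \<Longrightarrow> ord_ge (P m l) (dsize m - dsize l)"
  by (simp add: small_def)

lemma commutes_sym: "commutes P Q a b \<Longrightarrow> commutes Q P a b"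
  by (simp add: commutes_def mult.commute)

lemma ord_ge_mult_if:
  assumes "A \<noteq> 0 \<Longrightarrow> B \<noteq> 0 \<Longrightarrow> ord_ge A x \<and> ord_ge B y \<and> n \<le> x + y"
  shows "ord_ge (A * B) n"
proof (cases "A = 0 \<or> B = 0")
  case False thus ?thesis using assms ord_ge_mult ord_ge_mono by blast
qed auto

lemma ord_ge_mult3_if:
  assumes "A \<noteq> 0 \<Longrightarrow> B \<noteq> 0 \<Longrightarrow> C \<noteq> 0 \<Longrightarrow> ord_ge A x \<and> ord_ge B y \<and> ord_ge C z \<and> n \<le> x + y + z"
  shows "ord_ge (A * B * C) n"
proof (cases "A = 0 \<or> B = 0 \<or> C = 0")
  case False
  hence *: "ord_ge A x" "ord_ge B y" "ord_ge C z" "n \<le> x + y + z" using assms by auto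
  thus ?thesis using ord_ge_mult[OF ord_ge_mult[OF *(1,2)] *(3)] ord_ge_mono by blast
qed auto

lemma vanishing_lower: "lower P \<Longrightarrow> vanishing (\<lambda>t. P l t * f t)"
proof (rule vanishing_finite[of "{t. t \<le> l}"])
  fix t assume "lower P" "t \<notin> {t. t \<le> l}"
  hence "P l t = 0" using lowerD[of P l t] by auto
  thus "P l t * f t = 0" by simp
qed (simp add: finite_below)

lemma fsum_lower_left: "lower P \<Longrightarrow> c * fsum (\<lambda>t. P l t * f t) = fsum (\<lambda>t. c * P l t * f t)"
  and fsum_lower_right: "lower P \<Longrightarrow> fsum (\<lambda>t. P l t * f t) * c = fsum (\<lambda>t. P l t * f t * c)"
  by (simp_all add: fsum_mult_left[OF vanishing_lower, symmetric] fsum_mult_right[OF vanishing_lower, symmetric] mult.assoc)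

lemma vanishing_prod3:
  assumes "\<And>m k. ord_ge (A m k) (x m k)" "\<And>m k. ord_ge (B m k) (y m k)" "\<And>m k. ord_ge (C m k) (z m k)"
    and "\<And>m k. A m k \<noteq> 0 \<Longrightarrow> B m k \<noteq> 0 \<Longrightarrow> C m k \<noteq> 0 \<Longrightarrow>
      max (dsize m) (dsize k) \<le> x m k + y m k + z m k + K"
  shows "vanishing (\<lambda>(m, k). A m k * B m k * C m k)"
proof (rule vanishing_dsize2[where K = K])
  fix m k
  show "ord_ge (A m k * B m k * C m k) (dsize m - K)" "ord_ge (A m k * B m k * C m k) (dsize k - K)"
    by (rule ord_ge_mult3_if[where x = "x m k" and y = "y m k" and z = "z m k"];
      use assms(1-3)[of m k] assms(4)[of m k] in auto)+
qed

text \<open>The decay where it is known and 0 elsewhere, so that one proof of summability covers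
  both alternatives of a hypothesis "\<open>P\<close> or \<open>Q\<close> is small".\<close>

definition order_bound :: "'r::comm_ring_1 diagram_mat \<Rightarrow> diagram \<Rightarrow> diagram \<Rightarrow> nat" where
  "order_bound P m l = (if small P then dsize m - dsize l else 0)"

lemma ord_ge_order_bound [simp]: "ord_ge (P m l) (order_bound P m l)"
  by (simp add: order_bound_def smallD)

lemma vanishing_up:
  assumes "lower P" "lower Q" "small P \<or> small Q"
  shows "vanishing (\<lambda>m. P m l * Q m n)"
proof (rule vanishing_dsize)
  fix m
  show "ord_ge (P m l * Q m n) (dsize m - (dsize l + dsize n))"
    using assms(3)
  proof
    assume "small P"
    thus ?thesis by (auto intro!: ord_ge_mult_right ord_ge_mono[OF smallD])
  next
    assume "small Q"
    thus ?thesis by (auto intro!: ord_ge_mult_left ord_ge_mono[OF smallD])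
  qed
qed

lemma lower_id_mat [simp]: "lower id_mat" by (simp add: lower_def id_mat_def)
lemma small_id_mat [simp]: "small id_mat" by (simp add: small_def id_mat_def)

lemma mmult_id_mat_right [simp]: "mmult A id_mat = A"
proof (intro ext)
  fix l n
  have "fsum (\<lambda>m. A l m * id_mat m n) = (\<Sum>m\<in>{n}. A l m * id_mat m n)"
    by (rule fsum_finite) (auto simp: id_mat_def)
  thus "mmult A id_mat l n = A l n" by (simp add: mmult_def id_mat_def)
qed

lemma lower_mmult: assumes "lower A" "lower B" shows "lower (mmult A B)"
  unfolding lower_def
proof (intro allI impI)
  fix m l assume "mmult A B m l \<noteq> 0"
  moreover have "mmult A B m l = 0" if "\<And>k. A m k * B k l = 0"
    unfolding mmult_def that using fsum_finite[of "{}" "\<lambda>_. 0"] by simp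
  ultimately obtain k where "A m k * B k l \<noteq> 0" by blast
  hence "A m k \<noteq> 0" "B k l \<noteq> 0" by auto
  thus "l \<le> m" using lowerD[OF assms(1), of m k] lowerD[OF assms(2), of k l] by auto
qed

lemma small_mmult: assumes "lower A" "lower B" "small A" "small B" shows "small (mmult A B)"
  unfolding small_def mmult_def
proof (intro allI ord_ge_fsum)
  fix m l k
  show "ord_ge (A m k * B k l) (dsize m - dsize l)"
    by (rule ord_ge_mult_if[where x = "dsize m - dsize k" and y = "dsize k - dsize l"])
      (auto simp: smallD assms dest!: lower_dsize[OF assms(1)] lower_dsize[OF assms(2)])
qed

text \<open>The transpose of \<open>P P'\<close> is \<open>P'^T P^T\<close>, so \<open>Q\<close> is
  moved past \<open>P\<close> and then past \<open>P'\<close>. The work lies in the three exchanges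
  of summation: \<open>J1\<close> and \<open>J2\<close> involve arbitrarily large diagrams and use
  the decay, while \<open>J3\<close> has finite support.\<close>

lemma commutes_comp:
  assumes low: "lower P" "lower P'" "lower Q"
    and sm: "small P \<and> small P' \<or> small Q"
    and 1: "commutes P Q a b" and 2: "commutes P' Q a' b'"
  shows "commutes (mmult P P') Q (a * a') (b * b')"
  unfolding commutes_def
proof (intro allI)
  fix l n
  note ld = low[THEN lower_dsize]
  have J1: "vanishing (\<lambda>(m, k). P m k * P' k l * Q m n)"
    by (rule vanishing_prod3[where x = "\<lambda>m k. order_bound P m k" and y = "\<lambda>m k. order_bound P' k l" and
          z = "\<lambda>m k. order_bound Q m n" and K = "dsize l + dsize n"])
      (use sm in \<open>auto simp: order_bound_def dest!: ld intro: smallD\<close>)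
  have J2: "vanishing (\<lambda>(k, t). P' k l * Q k t * P n t)"
    by (rule vanishing_prod3[where x = "\<lambda>k t. order_bound P' k l" and y = "\<lambda>k t. order_bound Q k t" and
          z = "\<lambda>k t. 0" and K = "dsize l + dsize n"])
      (use sm in \<open>auto simp: order_bound_def dest!: ld intro: smallD\<close>)
  have J3: "vanishing (\<lambda>(t, s). P n t * Q l s * P' t s)"
    by (rule vanishing_prod3[where x = "\<lambda>_ _. 0" and y = "\<lambda>_ _. 0" and
          z = "\<lambda>_ _. 0" and K = "dsize l + dsize n"])
      (use sm in \<open>auto simp: order_bound_def dest!: ld intro: smallD\<close>)
  have "a * a' * fsum (\<lambda>m. mmult P P' m l * Q m n) =
    a * a' * fsum (\<lambda>m. fsum (\<lambda>k. P m k * P' k l * Q m n))"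
    by (simp add: mmult_def fsum_mult_right low[THEN vanishing_lower])
  also have "\<dots> = a' * (a * fsum (\<lambda>k. P' k l * fsum (\<lambda>m. P m k * Q m n)))"
    by (subst fsum_swap[OF J1], subst fsum_mult_left[symmetric], rule vanishing_up)
      (use low sm in \<open>auto simp: mult_ac\<close>)
  also have "\<dots> = a' * fsum (\<lambda>k. P' k l * (a * fsum (\<lambda>m. P m k * Q m n)))"
  proof -
    have "vanishing (\<lambda>k. fsum (\<lambda>m. P m k * P' k l * Q m n))"
      using vanishing_fsum[OF vanishing_swap[OF J1]] .
    moreover have "fsum (\<lambda>m. P m k * P' k l * Q m n) = P' k l * fsum (\<lambda>m. P m k * Q m n)" for k
      by (subst fsum_mult_left[symmetric], rule vanishing_up) (use low sm in \<open>auto simp: mult_ac\<close>)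
    ultimately have "vanishing (\<lambda>k. P' k l * fsum (\<lambda>m. P m k * Q m n))" by simp
    from fsum_mult_left[OF this, of a] show ?thesis by (simp add: mult_ac)
  qed
  also have "\<dots> = a' * fsum (\<lambda>k. P' k l * (b * fsum (\<lambda>t. Q k t * P n t)))"
    using 1 by (simp add: commutes_def)
  also have "\<dots> = a' * fsum (\<lambda>k. b * fsum (\<lambda>t. P' k l * Q k t * P n t))"
  proof -
    have "P' k l * (b * fsum (\<lambda>t. Q k t * P n t)) = b * (P' k l * fsum (\<lambda>t. Q k t * P n t))" for k
      by (rule mult.left_commute)
    moreover have "P' k l * fsum (\<lambda>t. Q k t * P n t) = fsum (\<lambda>t. P' k l * Q k t * P n t)" for k
      by (rule fsum_lower_left[OF low(3)])
    ultimately show ?thesis by simp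
  qed
  also have "\<dots> = a' * b * fsum (\<lambda>k. fsum (\<lambda>t. P' k l * Q k t * P n t))"
    by (subst fsum_mult_left[OF vanishing_fsum[OF J2]]) (simp add: mult_ac)
  also have "\<dots> = b * (a' * fsum (\<lambda>t. P n t * fsum (\<lambda>k. P' k l * Q k t)))"
    by (subst fsum_swap[OF J2], subst fsum_mult_left[symmetric], rule vanishing_up)
      (use low sm in \<open>auto simp: mult_ac\<close>)
  also have "\<dots> = b * fsum (\<lambda>t. P n t * (a' * fsum (\<lambda>k. P' k l * Q k t)))"
    by (subst fsum_mult_left[symmetric, where c = a'], rule vanishing_lower) (use low in \<open>auto simp: mult_ac\<close>)
  also have "\<dots> = b * fsum (\<lambda>t. P n t * (b' * fsum (\<lambda>s. Q l s * P' t s)))"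
    using 2 by (simp add: commutes_def)
  also have "\<dots> = b * b' * fsum (\<lambda>t. P n t * fsum (\<lambda>s. Q l s * P' t s))"
    by (subst mult.assoc, subst fsum_mult_left[symmetric, where c = b'], rule vanishing_lower)
      (use low in \<open>auto simp: mult_ac\<close>)
  also have "\<dots> = b * b' * fsum (\<lambda>t. fsum (\<lambda>s. P n t * Q l s * P' t s))"
    by (simp add: fsum_mult_left[symmetric] low[THEN vanishing_lower] mult_ac)
  also have "\<dots> = b * b' * fsum (\<lambda>s. fsum (\<lambda>t. Q l s * (P n t * P' t s)))"
    by (subst fsum_swap[OF J3]) (simp add: mult_ac)
  also have "\<dots> = b * b' * fsum (\<lambda>s. Q l s * mmult P P' n s)"
    by (simp add: mmult_def fsum_mult_left low[THEN vanishing_lower])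
  finally show "a * a' * fsum (\<lambda>m. mmult P P' m l * Q m n) = b * b' * fsum (\<lambda>t. Q l t * mmult P P' n t)" .
qed

text \<open>Multiplying \<open>a P^T Q = b Q P^T\<close> by \<open>R\<close> from both sides
  exchanges the roles of \<open>a\<close> and \<open>b\<close>. This derives the relations for
  vertical strips from the one for horizontal strips.\<close>

lemma commutes_inverse:
  assumes low: "lower P" "lower Q" "lower R"
    and sm: "small P \<or> small Q \<and> small R"
    and inv: "mmult Q R = id_mat" "mmult R Q = id_mat"
    and 1: "commutes P Q a b"
  shows "commutes P R b a"
  unfolding commutes_def
proof (intro allI)
  fix l n
  note ld = low[THEN lower_dsize]
  have J1: "vanishing (\<lambda>(m, s). P m t * Q m s * R s n)" for t
    by (rule vanishing_prod3[where x = "\<lambda>m s. order_bound P m t" and y = "\<lambda>m s. order_bound Q m s" and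
          z = "\<lambda>m s. order_bound R s n" and K = "dsize t + dsize n"])
      (use sm in \<open>auto simp: order_bound_def dest!: ld intro: smallD\<close>)
  have J2: "vanishing (\<lambda>(s, u). P s u * Q t u * R s n)" for t
    by (rule vanishing_prod3[where x = "\<lambda>s u. order_bound P s u" and y = "\<lambda>s u. 0" and
          z = "\<lambda>s u. order_bound R s n" and K = "dsize t + dsize n"])
      (use sm in \<open>auto simp: order_bound_def dest!: ld intro: smallD\<close>)
  have J3: "vanishing (\<lambda>(t, u). R l t * Q t u * W u)" for W
    by (rule vanishing_prod3[where x = "\<lambda>_ _. 0" and y = "\<lambda>_ _. 0" and
          z = "\<lambda>_ _. 0" and K = "dsize l"])
      (use sm in \<open>auto simp: order_bound_def dest!: ld intro: smallD\<close>)
  \<comment> \<open>\<open>W\<close> is a column of \<open>P^T R\<close>. Inserting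
    \<open>Q R = 1\<close> into \<open>P^T\<close> gives \<open>a P^T = b Q (P^T R)\<close>, and
    multiplying by \<open>R\<close> from the left then isolates \<open>W\<close>.\<close>
  define W where "W u = fsum (\<lambda>s. P s u * R s n)" for u
  have vPQ: "vanishing (\<lambda>m. P m t * Q m s)" for s t using low sm by (intro vanishing_up) auto
  have vPR: "vanishing (\<lambda>m. P m t * R m s)" for s t using low sm by (intro vanishing_up) auto
  have P: "a * P n t = b * fsum (\<lambda>u. Q t u * W u)" for t
  proof -
    have "P n t = fsum (\<lambda>m. P m t * mmult Q R m n)"
    proof -
      have "fsum (\<lambda>m. P m t * id_mat m n) = (\<Sum>m\<in>{n}. P m t * id_mat m n)"
        by (rule fsum_finite) (auto simp: id_mat_def)
      thus ?thesis by (simp add: inv id_mat_def)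
    qed
    also have "\<dots> = fsum (\<lambda>m. fsum (\<lambda>s. P m t * Q m s * R s n))"
      by (simp add: mmult_def fsum_mult_left[symmetric] low[THEN vanishing_lower] mult_ac)
    also have "\<dots> = fsum (\<lambda>s. fsum (\<lambda>m. P m t * Q m s) * R s n)"
      by (subst fsum_swap[OF J1]) (simp add: fsum_mult_right vPQ)
    finally have "a * P n t = a * fsum (\<lambda>s. fsum (\<lambda>m. P m t * Q m s) * R s n)" by simp
    also have "\<dots> = fsum (\<lambda>s. (a * fsum (\<lambda>m. P m t * Q m s)) * R s n)"
    proof -
      have "vanishing (\<lambda>s. fsum (\<lambda>m. P m t * Q m s) * R s n)"
        using vanishing_fsum[OF vanishing_swap[OF J1[of t]]] by (simp add: fsum_mult_right vPQ)
      from fsum_mult_left[OF this, of a] show ?thesis by (simp add: mult_ac)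
    qed
    also have "\<dots> = fsum (\<lambda>s. b * (fsum (\<lambda>u. Q t u * P s u) * R s n))"
      using 1 by (simp add: commutes_def mult_ac)
    also have "\<dots> = fsum (\<lambda>s. b * fsum (\<lambda>u. P s u * Q t u * R s n))"
    proof -
      have "fsum (\<lambda>u. Q t u * P s u) * R s n = fsum (\<lambda>u. P s u * Q t u * R s n)" for s
        unfolding fsum_lower_right[OF low(2)] by (simp add: mult.commute)
      thus ?thesis by simp
    qed
    also have "\<dots> = b * fsum (\<lambda>s. fsum (\<lambda>u. P s u * Q t u * R s n))"
      by (rule fsum_mult_left[OF vanishing_fsum[OF J2]])
    also have "\<dots> = b * fsum (\<lambda>u. fsum (\<lambda>s. Q t u * (P s u * R s n)))"
      by (subst fsum_swap[OF J2]) (simp add: mult_ac)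
    also have "\<dots> = b * fsum (\<lambda>u. Q t u * W u)"
      by (simp add: W_def fsum_mult_left vPR)
    finally show ?thesis .
  qed
  have "a * fsum (\<lambda>t. R l t * P n t) = fsum (\<lambda>t. R l t * (a * P n t))"
    by (subst fsum_mult_left[symmetric], rule vanishing_lower) (use low in \<open>auto simp: mult_ac\<close>)
  also have "\<dots> = b * fsum (\<lambda>t. R l t * fsum (\<lambda>u. Q t u * W u))"
    unfolding P by (subst fsum_mult_left[symmetric], rule vanishing_lower) (use low in \<open>auto simp: mult_ac\<close>)
  also have "\<dots> = b * fsum (\<lambda>t. fsum (\<lambda>u. R l t * Q t u * W u))"
    by (simp only: fsum_lower_left[OF low(2)])
  also have "\<dots> = b * fsum (\<lambda>u. mmult R Q l u * W u)"
    by (subst fsum_swap[OF J3]) (simp add: mmult_def fsum_mult_right low[THEN vanishing_lower])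
  also have "fsum (\<lambda>u. mmult R Q l u * W u) = (\<Sum>u\<in>{l}. mmult R Q l u * W u)"
    unfolding inv by (rule fsum_finite) (auto simp: id_mat_def)
  also have "\<dots> = W l" by (simp add: inv id_mat_def)
  finally show "b * fsum (\<lambda>m. P m l * R m n) = a * fsum (\<lambda>t. R l t * P n t)"
    by (simp add: W_def)
qed

lemma commutes_id_mat: assumes "lower Q" shows "commutes id_mat Q 1 1"
  unfolding commutes_def
proof (intro allI)
  fix l n
  show "1 * fsum (\<lambda>m. id_mat m l * Q m n) = 1 * fsum (\<lambda>t. Q l t * id_mat n t)"
    using fsum_finite[of "{l}" "\<lambda>m. id_mat m l * Q m n"] fsum_finite[of "{n}" "\<lambda>t. Q l t * id_mat n t"]
    by (auto simp: id_mat_def)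
qed

text \<open>The newest factor stands on the left, next to the outer diagram, just as the largest
  entry of a tableau fills its outermost strip.\<close>

primrec mat_prod :: "(nat \<Rightarrow> 'r::comm_ring_1 diagram_mat) \<Rightarrow> nat \<Rightarrow> 'r diagram_mat" where
  "mat_prod p 0 = id_mat"
| "mat_prod p (Suc N) = mmult (p N) (mat_prod p N)"

lemma lower_mat_prod: "(\<And>i. lower (p i)) \<Longrightarrow> lower (mat_prod p N)"
  by (induction N) (auto intro: lower_mmult)

lemma small_mat_prod: "(\<And>i. lower (p i)) \<Longrightarrow> (\<And>i. small (p i)) \<Longrightarrow> small (mat_prod p N)"
  by (induction N) (auto intro: small_mmult lower_mat_prod)

lemma commutes_mat_prod:
  assumes "\<And>i. lower (p i)" "lower Q" "(\<forall>i. small (p i)) \<or> small Q"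
    and "\<And>i. i < N \<Longrightarrow> commutes (p i) Q (a i) (b i)"
  shows "commutes (mat_prod p N) Q (\<Prod>i<N. a i) (\<Prod>i<N. b i)"
  using assms(4)
proof (induction N)
  case 0
  then show ?case using commutes_id_mat[OF assms(2)] by simp
next
  case (Suc N)
  have "commutes (mmult (p N) (mat_prod p N)) Q (a N * (\<Prod>i<N. a i)) (b N * (\<Prod>i<N. b i))"
    by (rule commutes_comp) (use assms Suc in \<open>auto intro: lower_mat_prod small_mat_prod\<close>)
  thus ?case by (simp add: mult.commute)
qed

lemma commutes_mprod2:
  assumes "\<And>i. lower (p i)" "\<And>i. lower (p' i)" "(\<forall>i. small (p i)) \<or> (\<forall>i. small (p' i))"
    and "\<And>i j. i < N \<Longrightarrow> j < N' \<Longrightarrow> commutes (p i) (p' j) (a i j) (b i j)"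
  shows "commutes (mat_prod p N) (mat_prod p' N') (\<Prod>i<N. \<Prod>j<N'. a i j) (\<Prod>i<N. \<Prod>j<N'. b i j)"
proof (rule commutes_mat_prod)
  fix i assume "i < N"
  show "commutes (p i) (mat_prod p' N') (\<Prod>j<N'. a i j) (\<Prod>j<N'. b i j)"
  proof (rule commutes_sym, rule commutes_mat_prod)
    show "commutes (p' j) (p i) (a i j) (b i j)" if "j < N'" for j
      using assms(4)[OF \<open>i < N\<close> that] by (rule commutes_sym)
  qed (use assms(1-3) in auto)
qed (use assms(1-3) in \<open>auto intro: lower_mat_prod small_mat_prod\<close>)

text \<open>\<open>z^L P = P' z^L\<close> with \<open>L\<close> the number of boxes. For strip
  operators \<open>P'\<close> is \<open>P\<close> with all variables multiplied by \<open>z\<close>;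
  keeping \<open>z\<close> on both sides avoids negative powers.\<close>

definition scaled :: "'r::comm_ring_1 fps fps \<Rightarrow> 'r diagram_mat \<Rightarrow> 'r diagram_mat \<Rightarrow> bool" where
  "scaled z P P' \<longleftrightarrow> (\<forall>m l. z ^ dsize m * P m l = P' m l * z ^ dsize l)"

lemma scaled_mmult:
  assumes "lower A" "lower A'" "scaled z A A'" "scaled z B B'"
  shows "scaled z (mmult A B) (mmult A' B')"
  unfolding scaled_def mmult_def
proof (intro allI)
  fix m l
  have *: "z ^ dsize m * (A m k * B k l) = A' m k * B' k l * z ^ dsize l" for k
  proof -
    have "z ^ dsize m * (A m k * B k l) = (z ^ dsize m * A m k) * B k l" by (simp add: mult.assoc)
    also have "\<dots> = A' m k * (z ^ dsize k * B k l)"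
      using assms(3) by (simp add: scaled_def mult.assoc)
    also have "\<dots> = A' m k * B' k l * z ^ dsize l"
      using assms(4) by (simp add: scaled_def mult.assoc)
    finally show ?thesis .
  qed
  show "z ^ dsize m * fsum (\<lambda>k. A m k * B k l) = fsum (\<lambda>k. A' m k * B' k l) * z ^ dsize l"
    by (simp add: fsum_mult_left[symmetric] fsum_mult_right[symmetric] assms(1,2)[THEN vanishing_lower] *)
qed

lemma scaled_mat_prod:
  assumes "\<And>i. lower (p i)" "\<And>i. lower (p' i)" "\<And>i. scaled z (p i) (p' i)"
  shows "scaled z (mat_prod p N) (mat_prod p' N)"
proof (induction N)
  case 0
  show ?case by (simp add: scaled_def id_mat_def)
qed (use assms in \<open>auto intro: scaled_mmult\<close>)

lemma mat_prod_cong_mod: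
  assumes "\<And>i. lower (p i)" "\<And>i. lower (p' i)" "\<And>i m l. ord_ge (p i m l - p' i m l) n"
  shows "ord_ge (mat_prod p N m l - mat_prod p' N m l) n"
proof (induction N arbitrary: m l)
  case (Suc N)
  show ?case unfolding mat_prod.simps mmult_def
    by (intro fsum_cong_mod vanishing_lower assms ord_ge_diff_mult Suc.IH)
qed simp

section \<open>Horizontal and vertical strips\<close>

definition hstrip :: "diagram \<Rightarrow> diagram \<Rightarrow> bool" where
  "hstrip l m \<longleftrightarrow> (\<forall>i. row l i \<le> row m i \<and> row m (Suc i) \<le> row l i)"

definition vstrip :: "diagram \<Rightarrow> diagram \<Rightarrow> bool" where
  "vstrip l m \<longleftrightarrow> (\<forall>i. row l i \<le> row m i \<and> row m i \<le> Suc (row l i))"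

definition hmat :: "'r::comm_ring_1 fps fps \<Rightarrow> 'r diagram_mat" where
  "hmat x m l = (if hstrip l m then x ^ (dsize m - dsize l) else 0)"

definition vmat :: "'r::comm_ring_1 fps fps \<Rightarrow> 'r diagram_mat" where
  "vmat x m l = (if vstrip l m then x ^ (dsize m - dsize l) else 0)"

lemma hstrip_le: "hstrip l m \<Longrightarrow> l \<le> m" and vstrip_le: "vstrip l m \<Longrightarrow> l \<le> m"
  by (auto simp: hstrip_def vstrip_def less_eq_diagram_def)

lemma lower_hmat [simp]: "lower (hmat x)" and lower_vmat [simp]: "lower (vmat x)"
  by (auto simp: lower_def hmat_def vmat_def hstrip_le vstrip_le split: if_splits)

lemma small_hmat: "ord_ge x 1 \<Longrightarrow> small (hmat x)" and small_vmat: "ord_ge x 1 \<Longrightarrow> small (vmat x)"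
  by (auto simp: small_def hmat_def vmat_def intro: ord_ge_power)

lemma hstrip_cells: "hstrip l m \<longleftrightarrow> l \<le> m \<and> (\<forall>i j. j < row m (Suc i) \<longrightarrow> j < row l i)"
proof -
  have "b \<le> a \<longleftrightarrow> (\<forall>j<b. j < a)" for a b :: nat
    by (meson less_irrefl less_le_trans not_le)
  thus ?thesis by (auto simp: hstrip_def less_eq_diagram_def)
qed

lemma vstrip_cells: "vstrip l m \<longleftrightarrow> l \<le> m \<and> (\<forall>i j. Suc j < row m i \<longrightarrow> j < row l i)"
proof -
  have "b \<le> Suc a \<longleftrightarrow> (\<forall>j. Suc j < b \<longrightarrow> j < a)" for a b :: nat
  proof
    assume *: "\<forall>j. Suc j < b \<longrightarrow> j < a"
    show "b \<le> Suc a" using *[rule_format, of a] by (cases "Suc a < b") auto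
  qed auto
  thus ?thesis by (auto simp: vstrip_def less_eq_diagram_def)
qed

lemma vstrip_mirror: "vstrip (mirror l) (mirror m) \<longleftrightarrow> hstrip l m"
  unfolding hstrip_cells vstrip_cells by (auto simp: less_row_mirror_iff)

lemma hstrip_mirror: "hstrip (mirror l) (mirror m) \<longleftrightarrow> vstrip l m"
  using vstrip_mirror[of "mirror l" "mirror m"] by simp

lemma vmat_eq_hmat_mirror: "vmat x m l = hmat x (mirror m) (mirror l)"
  by (simp add: vmat_def hmat_def hstrip_mirror)

lemma hmat_eq_vmat_mirror: "hmat x m l = vmat x (mirror m) (mirror l)"
  by (simp add: vmat_def hmat_def vstrip_mirror)

definition set_row :: "diagram \<Rightarrow> nat \<Rightarrow> nat \<Rightarrow> diagram" where
  "set_row d i v = Diagram ((row d)(i := v))"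

lemma row_set_row:
  assumes "row d (Suc i) \<le> v" "\<And>k. i = Suc k \<Longrightarrow> v \<le> row d k"
  shows "row (set_row d i v) = (row d)(i := v)"
proof -
  have "antimono ((row d)(i := v))"
    using assms by (auto simp: antimono_iff_le_Suc row_antimono)
  moreover have "((row d)(i := v)) (nrows d + Suc i) = 0"
    by (simp add: row_eq_0_iff)
  ultimately show ?thesis unfolding set_row_def by (rule row_Diagram)
qed

lemma dsize_fun_upd:
  assumes "row c = (row d)(i := v)"
  shows "dsize c + row d i = dsize d + v"
proof -
  define N where "N = nrows c + nrows d + Suc i"
  have "(\<Sum>k<N. row c k) = v + (\<Sum>k\<in>{..<N} - {i}. row c k)"
    using assms by (subst sum.remove[of _ i]) (auto simp: N_def)
  also have "(\<Sum>k\<in>{..<N} - {i}. row c k) = (\<Sum>k\<in>{..<N} - {i}. row d k)"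
    using assms by (intro sum.cong) auto
  finally have "(\<Sum>k<N. row c k) + row d i = v + (row d i + (\<Sum>k\<in>{..<N} - {i}. row d k))" by simp
  also have "row d i + (\<Sum>k\<in>{..<N} - {i}. row d k) = (\<Sum>k<N. row d k)"
    by (subst sum.remove[of _ i]) (auto simp: N_def)
  finally show ?thesis by (simp add: dsize_eq_sum[of _ N] N_def)
qed

lemma fsum_inj_image:
  assumes "inj g" "\<And>j. j \<notin> range g \<Longrightarrow> f j = 0"
  shows "fsum (\<lambda>i. f (g i)) = fsum f"
proof (intro fps_ext)
  fix b c
  have "{j. f j $ b $ c \<noteq> 0} \<subseteq> range g"
    using assms(2) by (metis (mono_tags) fps_zero_nth mem_Collect_eq subsetI)
  hence "{j. f j $ b $ c \<noteq> 0} = g ` {i. f (g i) $ b $ c \<noteq> 0}" by auto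
  hence "bij_betw g {i. f (g i) $ b $ c \<noteq> 0} {j. f j $ b $ c \<noteq> 0}"
    using assms(1) by (simp add: bij_betw_def inj_on_def)
  thus "fsum (\<lambda>i. f (g i)) $ b $ c = fsum f $ b $ c"
    unfolding fsum_nth by (rule sum.reindex_bij_betw)
qed

text \<open>A sign-reversing involution: at the first row where \<open>n\<close> and \<open>l\<close> differ, the box at the end of
  the row is moved between the two strips.\<close>

lemma mmult_vmat_hmat: "mmult (vmat (- x)) (hmat x) = id_mat"
proof (intro ext)
  fix n l
  let ?f = "\<lambda>t. vmat (- x) n t * hmat x t l"
  define A where "A = {t. vstrip t n \<and> hstrip l t}"
  have fin: "finite A"
    unfolding A_def by (rule finite_subset[OF _ finite_below[of n]]) (auto dest: vstrip_le)
  have fs: "mmult (vmat (- x)) (hmat x) n l = sum ?f A"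
    unfolding mmult_def by (rule fsum_finite[OF fin]) (auto simp: A_def vmat_def hmat_def)
  show "mmult (vmat (- x)) (hmat x) n l = id_mat n l"
  proof (cases "n = l")
    case True
    have "A = {l}" unfolding A_def True
      using vstrip_le hstrip_le by (auto simp: order_antisym) (auto simp: hstrip_def vstrip_def row_antimono)
    thus ?thesis using True fs by (simp add: id_mat_def vmat_def hmat_def hstrip_def vstrip_def row_antimono)
  next
    case False
    have "sum ?f A = 0"
    proof (cases "A = {}")
      case ne: False
      then obtain t0 where "t0 \<in> A" by blast
      hence ln: "row l i \<le> row n i" for i
        unfolding A_def using vstrip_def hstrip_def by (auto intro: order_trans)
      have "\<exists>i. row l i \<noteq> row n i" using False diagram_eqI by metis
      define i where "i = (LEAST i. row l i \<noteq> row n i)"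
      have i: "row l i \<noteq> row n i" unfolding i_def using \<open>\<exists>i. _\<close> by (rule LeastI_ex)
      have less: "row l k = row n k" if "k < i" for k
        using that unfolding i_def by (metis (mono_tags, lifting) not_less_Least)
      have lt: "row l i < row n i" using ln[of i] i by simp
      define w where "w = row n i - 1"
      have wS: "row n i = Suc w" using lt by (simp add: w_def)
      have lw: "row l i \<le> w" using lt by (simp add: wS)
      \<comment> \<open>The strip between \<open>t\<close> and \<open>n\<close> is vertical, so in
        row \<open>i\<close> the diagram \<open>t\<close> has either all boxes of \<open>n\<close>
        or one less.\<close>
      define B C where "B = {t \<in> A. row t i = row n i}" and "C = {t \<in> A. row t i = w}"
      have "A = B \<union> C"
      proof -
        have "row t i = row n i \<or> row t i = w" if "t \<in> A" for t
        proof -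
          have "row t i \<le> row n i" "row n i \<le> Suc (row t i)"
            using that unfolding A_def vstrip_def by auto
          thus ?thesis using wS by auto
        qed
        thus ?thesis unfolding B_def C_def by auto
      qed
      moreover have "B \<inter> C = {}" using wS by (auto simp: B_def C_def)
      moreover have "finite B" "finite C" using fin by (auto simp: B_def C_def)
      ultimately have "sum ?f A = sum ?f B + sum ?f C" by (simp add: sum.union_disjoint)
      also have "sum ?f B = (\<Sum>t\<in>C. - ?f t)"
      proof (rule sum.reindex_bij_witness[where i = "\<lambda>t. set_row t i (row n i)" and j = "\<lambda>t. set_row t i w"])
        fix t assume t: "t \<in> B"
        hence v: "\<And>k. row t k \<le> row n k \<and> row n k \<le> Suc (row t k)"
          and h: "\<And>k. row l k \<le> row t k \<and> row t (Suc k) \<le> row l k" and ti: "row t i = row n i"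
          by (auto simp: B_def A_def vstrip_def hstrip_def)
        have r: "row (set_row t i w) = (row t)(i := w)"
        proof (rule row_set_row)
          show "row t (Suc i) \<le> w" using h[of i] lw by linarith
          show "w \<le> row t k" if "i = Suc k" for k
            using row_antimono[of k i t] that ti wS by simp
        qed
        have "vstrip (set_row t i w) n"
          unfolding vstrip_def r using v wS by (auto simp: le_Suc_eq)
        moreover have "hstrip l (set_row t i w)"
          unfolding hstrip_def r
        proof
          fix k
          show "row l k \<le> ((row t)(i := w)) k \<and> ((row t)(i := w)) (Suc k) \<le> row l k"
            using h[of k] lw ti wS by auto
        qed
        ultimately show "set_row t i w \<in> C" by (simp add: C_def A_def r)
        have "row (set_row (set_row t i w) i (row n i)) = (row (set_row t i w))(i := row n i)"
        proof (rule row_set_row)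
          show "row (set_row t i w) (Suc i) \<le> row n i" using row_antimono[of i "Suc i" t] ti by (simp add: r)
          show "row n i \<le> row (set_row t i w) k" if "i = Suc k" for k
            unfolding r using row_antimono[of k i t] that ti by simp
        qed
        thus "set_row (set_row t i w) i (row n i) = t"
          by (intro diagram_eqI) (auto simp: r ti)
        have sz: "Suc (dsize (set_row t i w)) = dsize t"
          using dsize_fun_upd[OF r] ti wS by simp
        have le: "l \<le> set_row t i w" "t \<le> n"
          using \<open>hstrip l (set_row t i w)\<close> t by (auto simp: B_def A_def hstrip_le vstrip_le)
        \<comment> \<open>The moved box trades a factor \<open>x\<close> of \<open>hmat\<close> for
          a factor \<open>- x\<close> of \<open>vmat\<close>, which is the change of sign.\<close>
        have e1: "dsize n - dsize (set_row t i w) = Suc (dsize n - dsize t)"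
          using dsize_mono[OF le(2)] sz by simp
        have e2: "dsize t - dsize l = Suc (dsize (set_row t i w) - dsize l)"
          using dsize_mono[OF le(1)] sz by simp
        show "- ?f (set_row t i w) = ?f t"
          using t \<open>vstrip (set_row t i w) n\<close> \<open>hstrip l (set_row t i w)\<close>
          by (simp add: B_def A_def vmat_def hmat_def e1 e2 mult_ac)
      next
        fix t assume t: "t \<in> C"
        hence v: "\<And>k. row t k \<le> row n k \<and> row n k \<le> Suc (row t k)"
          and h: "\<And>k. row l k \<le> row t k \<and> row t (Suc k) \<le> row l k" and ti: "row t i = w"
          by (auto simp: C_def A_def vstrip_def hstrip_def)
        \<comment> \<open>Above row \<open>i\<close> the diagrams \<open>l\<close> and
          \<open>n\<close> agree and squeeze \<open>t\<close> between them; this leaves room for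
          lengthening row \<open>i\<close>.\<close>
        have eq: "row t k = row n k" if "k < i" for k
          using less[OF that] v[of k] h[of k] by simp
        have r: "row (set_row t i (row n i)) = (row t)(i := row n i)"
        proof (rule row_set_row)
          show "row t (Suc i) \<le> row n i" using h[of i] lw wS by linarith
          show "row n i \<le> row t k" if "i = Suc k" for k
            using row_antimono[of k i n] that eq[of k] by simp
        qed
        have "vstrip (set_row t i (row n i)) n"
          unfolding vstrip_def r using v wS by (auto simp: le_Suc_eq)
        moreover have "hstrip l (set_row t i (row n i))"
          unfolding hstrip_def r
        proof
          fix k
          show "row l k \<le> ((row t)(i := row n i)) k \<and> ((row t)(i := row n i)) (Suc k) \<le> row l k"
            using h[of k] lt row_antimono[of k "Suc k" n] less[of k] by auto
        qed
        ultimately show "set_row t i (row n i) \<in> B" by (simp add: B_def A_def r)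
        have "row (set_row (set_row t i (row n i)) i w) = (row (set_row t i (row n i)))(i := w)"
        proof (rule row_set_row)
          show "row (set_row t i (row n i)) (Suc i) \<le> w" using h[of i] lw by (simp add: r)
          show "w \<le> row (set_row t i (row n i)) k" if "i = Suc k" for k
            unfolding r using row_antimono[of k i n] that eq[of k] wS by simp
        qed
        thus "set_row (set_row t i (row n i)) i w = t"
          by (intro diagram_eqI) (auto simp: r ti)
      qed
      finally show ?thesis by (simp add: sum_negf)
    qed simp
    thus ?thesis using False by (simp add: fs id_mat_def)
  qed
qed

text \<open>Transposition exchanges the two kinds of strips, so this is the opposite composition
  read with \<open>- x\<close>.\<close>

lemma mmult_hmat_vmat: "mmult (hmat x) (vmat (- x)) = id_mat"
proof (intro ext)
  fix n l
  have "mmult (hmat x) (vmat (- x)) n l = fsum (\<lambda>m. vmat x (mirror n) (mirror m) * hmat (- x) (mirror m) (mirror l))"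
    unfolding mmult_def by (simp add: hmat_eq_vmat_mirror[of x] vmat_eq_hmat_mirror[of "- x"])
  also have "\<dots> = mmult (vmat (- (- x))) (hmat (- x)) (mirror n) (mirror l)"
    unfolding mmult_def by (simp add: fsum_reindex[OF bij_mirror, of "\<lambda>m. vmat x (mirror n) m * hmat (- x) m (mirror l)"])
  also have "\<dots> = id_mat n l" unfolding mmult_vmat_hmat by (auto simp: id_mat_def) (metis mirror_mirror)
  finally show "mmult (hmat x) (vmat (- x)) n l = id_mat n l" .
qed

text \<open>For \<open>i > 0\<close> the row lengths of \<open>m\<close> and of \<open>t\<close> range independently over the same intervals
  \<open>[mx (i + 1), mn i]\<close>, and are matched by reflection; the free first row of \<open>m\<close> gives the geometric
  series \<open>1 / (1 - x y)\<close>.\<close>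

lemma commutes_hh:
  assumes xy: "ord_ge x 1 \<or> ord_ge y 1"
  shows "commutes (hmat x) (hmat y) (1 - x * y) 1"
  unfolding commutes_def
proof (intro allI)
  fix l n
  define f where "f m = hmat x m l * hmat y m n" for m
  define mx where "mx i = max (row l i) (row n i)" for i
  define mn where "mn i = min (row l i) (row n i)" for i
  have mx: "mx (Suc i) \<le> mx i" and mn: "mn (Suc i) \<le> mn i" for i
    unfolding mx_def mn_def using row_antimono[of i "Suc i" l] row_antimono[of i "Suc i" n] by auto
  have mx0: "mx i = 0" and mn0: "mn i = 0" if "nrows l + nrows n \<le> i" for i
  proof -
    have "row l i = 0" "row n i = 0" using that by (simp_all add: row_eq_0_iff)
    thus "mx i = 0" "mn i = 0" by (simp_all add: mx_def mn_def)
  qed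
  define M where "M = {m. hstrip l m \<and> hstrip n m}"
  define M0 where "M0 = {m \<in> M. row m 0 = mx 0}"
  define T where "T = {t. hstrip t l \<and> hstrip t n}"
  define g where "g m = (if m \<in> M0 then f m else 0)" for m
  \<comment> \<open>Lengthening the first row by one box multiplies the summand by
    \<open>x * y\<close> and maps \<open>M\<close> injectively onto \<open>M\<close> without
    \<open>M0\<close>. The geometric series thus takes the form
    \<open>fsum f - sum f M0 = x * y * fsum f\<close>.\<close>
  define bump where "bump m = set_row m 0 (Suc (row m 0))" for m
  have f0: "f m = 0" if "m \<notin> M" for m
    using that by (auto simp: f_def M_def hmat_def)
  have M_iff: "m \<in> M \<longleftrightarrow> (\<forall>i. mx i \<le> row m i \<and> row m (Suc i) \<le> mn i)" for m
    unfolding M_def hstrip_def mx_def mn_def by auto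
  have T_iff: "t \<in> T \<longleftrightarrow> (\<forall>i. row t i \<le> mn i \<and> mx (Suc i) \<le> row t i)" for t
    unfolding T_def hstrip_def mx_def mn_def by auto
  have vf: "vanishing f" unfolding f_def
    by (rule vanishing_up) (use xy in \<open>auto intro: small_hmat\<close>)

  have row_bump: "row (bump m) = (row m)(0 := Suc (row m 0))" for m
    unfolding bump_def by (rule row_set_row) (use row_antimono[of 0 "Suc 0" m] in auto)
  have inj: "inj bump"
  proof (rule injI, rule diagram_eqI)
    fix m m' i assume "bump m = bump m'"
    hence "row (bump m) i = row (bump m') i" by simp
    thus "row m i = row m' i" by (auto simp: row_bump split: if_splits)
  qed
  have bump_sub: "f (bump m) - g (bump m) = x * y * f m" for m
  proof (cases "m \<in> M")
    case True
    hence mb: "bump m \<in> M" unfolding M_iff row_bump using le_Suc_eq by auto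
    have "mx 0 \<le> row m 0" using True M_iff by blast
    hence "bump m \<notin> M0" by (auto simp: M0_def row_bump)
    moreover have s: "dsize (bump m) = Suc (dsize m)"
      using dsize_fun_upd[OF row_bump[of m]] by simp
    moreover have "dsize l \<le> dsize m" "dsize n \<le> dsize m"
      using True by (auto simp: M_def intro!: dsize_mono hstrip_le)
    ultimately show ?thesis using True mb
      by (simp add: g_def f_def hmat_def M_def Suc_diff_le mult_ac)
  next
    case False
    \<comment> \<open>\<open>bump m\<close> can be admissible although \<open>m\<close> is not, but
      then its first row has the minimal length \<open>mx 0\<close>. These are the terms that
      \<open>g\<close> removes.\<close>
    have "f (bump m) = g (bump m)"
    proof (cases "bump m \<in> M")
      case True
      have "mx i \<le> row m i \<or> i = 0" for i
        using True[unfolded M_iff row_bump, rule_format, of i] by auto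
      moreover have "row m (Suc i) \<le> mn i" for i
        using True[unfolded M_iff row_bump, rule_format, of i] by auto
      ultimately have "\<not> mx 0 \<le> row m 0" using False M_iff by metis
      moreover have "mx 0 \<le> Suc (row m 0)"
        using True[unfolded M_iff row_bump, rule_format, of 0] by auto
      ultimately have "bump m \<in> M0" using True by (simp add: M0_def row_bump)
      thus ?thesis by (simp add: g_def)
    qed (simp add: f0 g_def M0_def)
    thus ?thesis using False by (simp add: f0)
  qed
  have fin: "finite M0"
  proof (rule finite_subset[OF _ finite_diagrams_bounded[of "Suc (nrows l)" "mx 0"]], safe)
    fix m assume m: "m \<in> M0"
    have "row m (Suc (nrows l)) \<le> mn (nrows l)" using m M_iff by (simp add: M0_def)
    also have "\<dots> = 0" using row_eq_0_iff[of l "nrows l"] by (simp add: mn_def)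
    finally show "nrows m \<le> Suc (nrows l)" by (simp add: row_eq_0_iff)
    show "row m i \<le> mx 0" for i using row_antimono[of 0 i m] m by (simp add: M0_def)
  qed
  have fg: "fsum g = sum f M0"
  proof -
    have "fsum g = sum g M0" by (rule fsum_finite[OF fin]) (simp add: g_def)
    thus ?thesis by (simp add: g_def)
  qed
  have vg: "vanishing g" by (rule vanishing_finite[OF fin]) (simp add: g_def)
  have "fsum f - fsum g = fsum (\<lambda>m. f m - g m)" by (rule fsum_diff[OF vf vg, symmetric])
  also have "\<dots> = fsum (\<lambda>m. f (bump m) - g (bump m))"
  proof (rule fsum_inj_image[OF inj, symmetric])
    fix m assume m: "m \<notin> range bump"
    show "f m - g m = 0"
    proof (cases "m \<in> M \<and> m \<notin> M0")
      case True
      hence gt: "mx 0 < row m 0" using M_iff by (auto simp: M0_def le_less)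
      have le: "row m (Suc 0) \<le> row m 0 - 1"
        using True gt M_iff[of m] unfolding mn_def mx_def by (auto dest!: spec[of _ 0])
      have r: "row (set_row m 0 (row m 0 - 1)) = (row m)(0 := row m 0 - 1)"
        by (rule row_set_row) (use le in auto)
      have "bump (set_row m 0 (row m 0 - 1)) = m"
        by (rule diagram_eqI, unfold row_bump r) (use gt in auto)
      thus ?thesis using m by (metis rangeI)
    qed (auto simp: g_def f0)
  qed
  also have "\<dots> = x * y * fsum f" by (simp add: bump_sub fsum_mult_left vf)
  finally have 1: "(1 - x * y) * fsum f = sum f M0"
    by (simp add: fg algebra_simps)

  \<comment> \<open>The shift by one pairs row \<open>i + 1\<close> of \<open>m\<close> with row
    \<open>i\<close> of \<open>t\<close>; the first row of \<open>m\<close> has no partner and is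
    fixed to \<open>mx 0\<close> in \<open>M0\<close>.\<close>
  define \<phi> where "\<phi> m = Diagram (\<lambda>i. mx (Suc i) + mn i - row m (Suc i))" for m
  define \<psi> where "\<psi> t = Diagram (\<lambda>i. case i of 0 \<Rightarrow> mx 0 | Suc k \<Rightarrow> mx (Suc k) + mn k - row t k)" for t
  have "sum f M0 = (\<Sum>t\<in>T. hmat y l t * hmat x n t)"
  proof (rule sum.reindex_bij_witness[where
        i = \<psi> and
        j = \<phi>])
    fix m assume m: "m \<in> M0"
    hence mM: "mx i \<le> row m i" "row m (Suc i) \<le> mn i" for i using M_iff by (auto simp: M0_def)
    have m0: "row m 0 = mx 0" using m by (simp add: M0_def)
    define t where "t = \<phi> m"
    have rt: "row t = (\<lambda>i. mx (Suc i) + mn i - row m (Suc i))"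
      unfolding t_def \<phi>_def
    proof (rule row_Diagram)
      show "antimono (\<lambda>i. mx (Suc i) + mn i - row m (Suc i))"
        unfolding antimono_iff_le_Suc
      proof
        fix i
        have "mx (Suc (Suc i)) + mn (Suc i) - row m (Suc (Suc i)) \<le> mn (Suc i)"
          using mM(1)[of "Suc (Suc i)"] by simp
        also have "\<dots> \<le> mx (Suc i)" by (simp add: mn_def mx_def)
        also have "\<dots> \<le> mx (Suc i) + mn i - row m (Suc i)" using mM(2)[of i] by simp
        finally show "mx (Suc (Suc i)) + mn (Suc i) - row m (Suc (Suc i)) \<le> \<dots>" .
      qed
      show "mx (Suc (nrows l + nrows n)) + mn (nrows l + nrows n) - row m (Suc (nrows l + nrows n)) = 0"
        by (simp add: mx0 mn0)
    qed
    have le: "row m (Suc i) \<le> mx (Suc i) + mn i" for i using mM(2)[of i] by simp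
    have "row t i \<le> mn i \<and> mx (Suc i) \<le> row t i" for i
      unfolding rt using mM(1)[of "Suc i"] mM(2)[of i] by (intro conjI; linarith)
    hence tT: "t \<in> T" unfolding T_iff by blast
    show "\<phi> m \<in> T" using tT by (simp add: t_def)
    have eq: "(case i of 0 \<Rightarrow> mx 0 | Suc k \<Rightarrow> mx (Suc k) + mn k - row t k) = row m i" for i
      using le m0 by (auto simp: rt split: nat.split)
    show "\<psi> (\<phi> m) = m"
      unfolding t_def[symmetric] \<psi>_def eq by (rule row_inverse)
    define N where "N = nrows l + nrows n + nrows m + nrows t"
    \<comment> \<open>Maximum and minimum of two numbers add up to their sum, so \<open>m\<close>
      and \<open>t\<close> together have as many boxes as \<open>l\<close> and \<open>n\<close>.
      Hence \<open>m\<close> exceeds \<open>l\<close> by as much as \<open>n\<close> exceeds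
      \<open>t\<close>, and the exponents of \<open>x\<close> and \<open>y\<close> match.\<close>
    have "dsize m + dsize t = (\<Sum>i<Suc N. row m i) + (\<Sum>i<N. row t i)"
      by (subst dsize_eq_sum[of m "Suc N"], simp add: N_def, subst dsize_eq_sum[of t N]) (simp_all add: N_def)
    also have "\<dots> = mx 0 + (\<Sum>i<N. row m (Suc i) + row t i)"
      by (simp add: sum.lessThan_Suc_shift m0 sum.distrib del: sum.lessThan_Suc)
    also have "\<dots> = mx 0 + (\<Sum>i<N. mx (Suc i) + mn i)"
      using le by (simp add: rt)
    also have "\<dots> = (\<Sum>i<Suc N. mx i) + (\<Sum>i<N. mn i)"
      by (simp add: sum.lessThan_Suc_shift sum.distrib del: sum.lessThan_Suc)
    also have "\<dots> = (\<Sum>i<N. mx i + mn i)"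
      by (simp add: sum.distrib mx0 N_def)
    also have "\<dots> = (\<Sum>i<N. row l i + row n i)"
      by (intro sum.cong refl) (simp add: mx_def mn_def min_def max_def)
    also have "\<dots> = dsize l + dsize n"
      by (subst dsize_eq_sum[of l N], simp add: N_def, subst dsize_eq_sum[of n N]) (simp_all add: N_def sum.distrib)
    finally have sz: "dsize m + dsize t = dsize l + dsize n" .
    have mmult: "hstrip l m" "hstrip n m" and tt: "hstrip t l" "hstrip t n"
      using m tT by (auto simp: M0_def M_def T_def)
    have "dsize l \<le> dsize m" "dsize n \<le> dsize m" "dsize t \<le> dsize l" "dsize t \<le> dsize n"
      using mmult tt by (auto intro!: dsize_mono hstrip_le)
    hence "dsize m - dsize l = dsize n - dsize t" "dsize m - dsize n = dsize l - dsize t"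
      using sz by auto
    thus "hmat y l (\<phi> m) * hmat x n (\<phi> m) = f m"
      using mmult tt by (simp add: f_def hmat_def mult.commute flip: t_def)
  next
    fix t assume t: "t \<in> T"
    hence tT: "row t i \<le> mn i" "mx (Suc i) \<le> row t i" for i using T_iff by auto
    define m where "m = \<psi> t"
    have rm: "row m = (\<lambda>i. case i of 0 \<Rightarrow> mx 0 | Suc k \<Rightarrow> mx (Suc k) + mn k - row t k)"
      unfolding m_def \<psi>_def
    proof (rule row_Diagram)
      show "antimono (\<lambda>i. case i of 0 \<Rightarrow> mx 0 | Suc k \<Rightarrow> mx (Suc k) + mn k - row t k)"
        unfolding antimono_iff_le_Suc
      proof
        fix i
        have *: "mx (Suc i) + mn i - row t i \<le> mn i" using tT(2)[of i] by simp
        show "(case Suc i of 0 \<Rightarrow> mx 0 | Suc k \<Rightarrow> mx (Suc k) + mn k - row t k)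
          \<le> (case i of 0 \<Rightarrow> mx 0 | Suc k \<Rightarrow> mx (Suc k) + mn k - row t k)"
        proof (cases i)
          case 0
          have "mn 0 \<le> mx 0" by (simp add: mn_def mx_def)
          thus ?thesis using * 0 by simp
        next
          case (Suc k)
          have "mn i \<le> mx i" by (simp add: mn_def mx_def)
          also have "mx i \<le> mx i + mn k - row t k" using tT(1)[of k] by simp
          finally show ?thesis using * Suc by simp
        qed
      qed
      show "(case Suc (nrows l + nrows n) of 0 \<Rightarrow> mx 0 | Suc k \<Rightarrow> mx (Suc k) + mn k - row t k) = 0"
        by (simp add: mx0 mn0)
    qed
    have "mx i \<le> row m i" for i
    proof (cases i)
      case (Suc k)
      thus ?thesis using tT(1)[of k] by (simp add: rm)
    qed (simp add: rm)
    moreover have "row m (Suc i) \<le> mn i" for i using tT(2)[of i] by (simp add: rm)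
    ultimately have "m \<in> M0" by (simp add: M0_def M_iff) (simp add: rm)
    thus "\<psi> t \<in> M0"
      by (simp add: m_def)
    have eq: "mx (Suc i) + mn i - row m (Suc i) = row t i" for i
      using tT(1)[of i] by (simp add: rm)
    show "\<phi> (\<psi> t) = t"
      unfolding m_def[symmetric] \<phi>_def eq by (rule row_inverse)
  qed
  also have "\<dots> = fsum (\<lambda>t. hmat y l t * hmat x n t)"
    by (rule fsum_finite[symmetric], rule finite_subset[OF _ finite_below[of l]])
      (auto simp: T_def hmat_def intro: hstrip_le)
  finally show "(1 - x * y) * fsum (\<lambda>m. hmat x m l * hmat y m n) = 1 * fsum (\<lambda>t. hmat y l t * hmat x n t)"
    using 1 unfolding f_def by (simp only: mult_1_left)
qed

text \<open>\<open>vmat y\<close> is the inverse of \<open>hmat (- y)\<close>, so the kernel of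
  \<open>commutes_hh\<close> at \<open>- y\<close> changes sides.\<close>

lemma commutes_hv:
  assumes "ord_ge x 1 \<or> ord_ge y 1"
  shows "commutes (hmat x) (vmat y) 1 (1 + x * y)"
proof -
  have y: "ord_ge (- y) 1 \<longleftrightarrow> ord_ge y 1" using ord_ge_uminus[of y 1] ord_ge_uminus[of "- y" 1] by auto
  have 1: "commutes (hmat x) (hmat (- y)) (1 - x * (- y)) 1" by (rule commutes_hh) (use assms y in auto)
  have 2: "mmult (hmat (- y)) (vmat y) = id_mat" "mmult (vmat y) (hmat (- y)) = id_mat"
    using mmult_hmat_vmat[of "- y"] mmult_vmat_hmat[of "- y"] by simp_all
  have "commutes (hmat x) (vmat y) 1 (1 - x * (- y))"
    by (rule commutes_inverse[OF _ _ _ _ 2 1]) (use assms y small_hmat small_vmat in auto)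
  thus ?thesis by simp
qed

lemma commutes_vv:
  assumes "ord_ge x 1 \<or> ord_ge y 1"
  shows "commutes (vmat x) (vmat y) (1 - x * y) 1"
proof -
  have y: "ord_ge (- y) 1 \<longleftrightarrow> ord_ge y 1" using ord_ge_uminus[of y 1] ord_ge_uminus[of "- y" 1] by auto
  have 1: "commutes (vmat x) (hmat (- y)) 1 (1 + (- y) * x)"
    by (rule commutes_sym, rule commutes_hv) (use assms y in auto)
  have 2: "mmult (hmat (- y)) (vmat y) = id_mat" "mmult (vmat y) (hmat (- y)) = id_mat"
    using mmult_hmat_vmat[of "- y"] mmult_vmat_hmat[of "- y"] by simp_all
  have "commutes (vmat x) (vmat y) (1 + (- y) * x) 1"
    by (rule commutes_inverse[OF _ _ _ _ 2 1]) (use assms y small_hmat small_vmat in auto)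
  thus ?thesis by (simp add: mult.commute)
qed

section \<open>Strip operators with finite alphabets\<close>

definition Hmat :: "(nat \<Rightarrow> 'r::comm_ring_1 fps fps) \<Rightarrow> nat \<Rightarrow> 'r diagram_mat" where
  "Hmat x N = mat_prod (\<lambda>i. hmat (x i)) N"

definition Vmat :: "(nat \<Rightarrow> 'r::comm_ring_1 fps fps) \<Rightarrow> nat \<Rightarrow> 'r diagram_mat" where
  "Vmat x N = mat_prod (\<lambda>i. vmat (x i)) N"

lemma lower_Hmat [simp]: "lower (Hmat x N)" and lower_Vmat [simp]: "lower (Vmat x N)"
  by (auto simp: Hmat_def Vmat_def intro: lower_mat_prod)

lemma Vmat_eq_Hmat_mirror: "Vmat x N m l = Hmat x N (mirror m) (mirror l)"
proof (induction N arbitrary: m l)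
  case 0
  show ?case by (auto simp: Hmat_def Vmat_def id_mat_def) (metis mirror_mirror)
next
  case (Suc N)
  have "Vmat x (Suc N) m l = fsum (\<lambda>k. hmat (x N) (mirror m) (mirror k) * Hmat x N (mirror k) (mirror l))"
    using Suc by (simp add: Vmat_def mmult_def vmat_eq_hmat_mirror)
  also have "\<dots> = Hmat x (Suc N) (mirror m) (mirror l)"
    by (simp add: Hmat_def mmult_def fsum_reindex[OF bij_mirror, of "\<lambda>k. hmat (x N) (mirror m) k * mat_prod (\<lambda>i. hmat (x i)) N k (mirror l)"])
  finally show ?case .
qed

lemma scaled_hmat: "scaled z (hmat x) (hmat (z * x))" and scaled_vmat: "scaled z (vmat x) (vmat (z * x))"
proof -
  have *: "z ^ dsize m * x ^ (dsize m - dsize l) = (z * x) ^ (dsize m - dsize l) * z ^ dsize l"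
    if "l \<le> m" for l m
  proof -
    have "z ^ dsize m = z ^ (dsize m - dsize l) * z ^ dsize l"
      using dsize_mono[OF that] by (simp flip: power_add)
    thus ?thesis by (simp add: power_mult_distrib mult_ac)
  qed
  thus "scaled z (hmat x) (hmat (z * x))" "scaled z (vmat x) (vmat (z * x))"
    by (auto simp: scaled_def hmat_def vmat_def hstrip_le vstrip_le)
qed

lemma scaled_Hmat: "scaled z (Hmat x N) (Hmat (\<lambda>i. z * x i) N)"
  and scaled_Vmat: "scaled z (Vmat x N) (Vmat (\<lambda>i. z * x i) N)"
  unfolding Hmat_def Vmat_def by (intro scaled_mat_prod lower_hmat lower_vmat scaled_hmat scaled_vmat)+

lemma commutes_Hmat_Hmat:
  assumes "(\<forall>i. ord_ge (x i) 1) \<or> (\<forall>i. ord_ge (y i) 1)"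
  shows "commutes (Hmat x N) (Hmat y N') (\<Prod>i<N. \<Prod>j<N'. 1 - x i * y j) 1"
proof -
  have "commutes (Hmat x N) (Hmat y N') (\<Prod>i<N. \<Prod>j<N'. 1 - x i * y j) (\<Prod>i<N. \<Prod>j<N'. 1)"
    unfolding Hmat_def by (rule commutes_mprod2[where p = "\<lambda>i. hmat (x i)" and p' = "\<lambda>i. hmat (y i)" and
        a = "\<lambda>i j. 1 - x i * y j" and b = "\<lambda>i j. 1"], goal_cases)
      (use assms small_hmat small_vmat in \<open>auto intro: commutes_hh\<close>)
  thus ?thesis by simp
qed

lemma commutes_Vmat_Vmat:
  assumes "(\<forall>i. ord_ge (x i) 1) \<or> (\<forall>i. ord_ge (y i) 1)"
  shows "commutes (Vmat x N) (Vmat y N') (\<Prod>i<N. \<Prod>j<N'. 1 - x i * y j) 1"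
proof -
  have "commutes (Vmat x N) (Vmat y N') (\<Prod>i<N. \<Prod>j<N'. 1 - x i * y j) (\<Prod>i<N. \<Prod>j<N'. 1)"
    unfolding Vmat_def by (rule commutes_mprod2[where p = "\<lambda>i. vmat (x i)" and p' = "\<lambda>i. vmat (y i)" and
        a = "\<lambda>i j. 1 - x i * y j" and b = "\<lambda>i j. 1"], goal_cases)
      (use assms small_hmat small_vmat in \<open>auto intro: commutes_vv\<close>)
  thus ?thesis by simp
qed

lemma commutes_Hmat_Vmat:
  assumes "(\<forall>i. ord_ge (x i) 1) \<or> (\<forall>i. ord_ge (y i) 1)"
  shows "commutes (Hmat x N) (Vmat y N') 1 (\<Prod>i<N. \<Prod>j<N'. 1 + x i * y j)"
proof -
  have "commutes (Hmat x N) (Vmat y N') (\<Prod>i<N. \<Prod>j<N'. 1) (\<Prod>i<N. \<Prod>j<N'. 1 + x i * y j)"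
    unfolding Hmat_def Vmat_def by (rule commutes_mprod2[where p = "\<lambda>i. hmat (x i)" and p' = "\<lambda>i. vmat (y i)" and
        a = "\<lambda>i j. 1" and b = "\<lambda>i j. 1 + x i * y j"], goal_cases)
      (use assms small_hmat small_vmat in \<open>auto intro: commutes_hv\<close>)
  thus ?thesis by simp
qed

lemma power_cong_mod: "ord_ge (x - y) n \<Longrightarrow> ord_ge (x ^ k - y ^ k) n"
  by (induction k) (auto intro: ord_ge_diff_mult)

lemma Hmat_cong_mod: "(\<And>i. ord_ge (x i - y i) n) \<Longrightarrow> ord_ge (Hmat x N m l - Hmat y N m l) n"
  unfolding Hmat_def by (rule mat_prod_cong_mod) (auto simp: hmat_def intro: power_cong_mod)

lemma Vmat_cong_mod: "(\<And>i. ord_ge (x i - y i) n) \<Longrightarrow> ord_ge (Vmat x N m l - Vmat y N m l) n"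
  unfolding Vmat_def by (rule mat_prod_cong_mod) (auto simp: vmat_def intro: power_cong_mod)

section \<open>Cyclic sums\<close>

text \<open>The four indices of a cyclic sum form a square. Once two opposite corners
  \<open>p\<close> are fixed, the other two are independent and their sums factor.\<close>

lemma fsum_quad:
  assumes V: "vanishing (\<lambda>(p, c, d). u p * (f p c * g p d))"
    and f: "\<And>p. vanishing (f p)" and g: "\<And>p. vanishing (g p)"
  shows "fsum (\<lambda>(p, c, d). u p * (f p c * g p d)) = fsum (\<lambda>p. u p * (fsum (f p) * fsum (g p)))"
    and "vanishing (\<lambda>p. u p * (fsum (f p) * fsum (g p)))"
proof -
  have *: "fsum (\<lambda>(c, d). u p * (f p c * g p d)) = u p * (fsum (f p) * fsum (g p))" for p
    using fsum_mult_left[OF vanishing_product[OF f g], of "u p" p p]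
    by (simp add: fsum_product f g case_prod_unfold)
  show "fsum (\<lambda>(p, c, d). u p * (f p c * g p d)) = fsum (\<lambda>p. u p * (fsum (f p) * fsum (g p)))"
    by (subst fsum_Pair[OF V]) (simp only: *)
  show "vanishing (\<lambda>p. u p * (fsum (f p) * fsum (g p)))"
    using vanishing_fsum[OF V] by (simp only: *)
qed

lemma vanishing_quad:
  assumes "\<And>s t e v. F ((s, t), e, v) \<noteq> 0 \<Longrightarrow>
    \<exists>k. ord_ge (F ((s, t), e, v)) k \<and> dsize s \<le> k \<and> dsize t \<le> k \<and> dsize e \<le> k \<and> dsize v \<le> k"
  shows "vanishing F"
  unfolding vanishing_def
proof
  fix n
  let ?D = "{d. dsize d \<le> n}"
  have "{p. \<not> ord_ge (F p) n} \<subseteq> (?D \<times> ?D) \<times> ?D \<times> ?D"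
  proof
    fix p assume p: "p \<in> {p. \<not> ord_ge (F p) n}"
    obtain s t e v where q: "p = ((s, t), e, v)" by (metis prod.collapse)
    have "F ((s, t), e, v) \<noteq> 0" using p q by auto
    then obtain k where k: "ord_ge (F ((s, t), e, v)) k" "dsize s \<le> k" "dsize t \<le> k" "dsize e \<le> k" "dsize v \<le> k"
      using assms by blast
    have "\<not> n \<le> k" using p q ord_ge_mono[OF k(1), of n] by auto
    thus "p \<in> (?D \<times> ?D) \<times> ?D \<times> ?D" using k q by auto
  qed
  thus "finite {p. \<not> ord_ge (F p) n}"
    by (rule finite_subset) (simp add: finite_dsize_le)
qed

text \<open>The summands of the trace of \<open>z\<^sup>L P1 P2\<^sup>T w\<^sup>L P3 P4\<^sup>T\<close>, where \<open>L\<close> is the number of boxes.\<close>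

definition cyc :: "'r::comm_ring_1 fps fps \<Rightarrow> 'r fps fps \<Rightarrow> 'r diagram_mat \<Rightarrow> 'r diagram_mat \<Rightarrow> 'r diagram_mat \<Rightarrow> 'r diagram_mat \<Rightarrow>
    (diagram \<times> diagram) \<times> diagram \<times> diagram \<Rightarrow> 'r fps fps" where
  "cyc z w P1 P2 P3 P4 = (\<lambda>((s, t), e, v).
     z ^ dsize e * w ^ dsize v * (P1 e s * P2 v s) * (P3 v t * P4 e t))"

lemma vanishing_cyc:
  assumes "ord_ge z 1" "ord_ge w 1" and low: "lower P1" "lower P2" "lower P3" "lower P4"
  shows "vanishing (cyc z w P1 P2 P3 P4)"
proof (rule vanishing_quad)
  fix s t e v
  assume "cyc z w P1 P2 P3 P4 ((s, t), e, v) \<noteq> 0"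
  hence "P1 e s \<noteq> 0" "P4 e t \<noteq> 0" by (auto simp: cyc_def)
  hence "dsize s \<le> dsize e" "dsize t \<le> dsize e"
    using lower_dsize[OF low(1)] lower_dsize[OF low(4)] by auto
  moreover have "ord_ge (cyc z w P1 P2 P3 P4 ((s, t), e, v)) (dsize e + dsize v)"
    unfolding cyc_def prod.case by (intro ord_ge_mult_right ord_ge_mult ord_ge_power assms)
  ultimately show "\<exists>k. ord_ge (cyc z w P1 P2 P3 P4 ((s, t), e, v)) k \<and>
      dsize s \<le> k \<and> dsize t \<le> k \<and> dsize e \<le> k \<and> dsize v \<le> k"
    by (intro exI[of _ "dsize e + dsize v"]) auto
qed

text \<open>With \<open>s\<close> and \<open>t\<close> fixed, the sums over \<open>e\<close> and
  \<open>v\<close> separate, and after the weights have been pulled through \<open>P1\<close> and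
  \<open>P2\<close> both can be commuted. The new inner diagrams \<open>k\<close> and
  \<open>k'\<close> are then fixed instead, and the same is done with the sums over \<open>s\<close>
  and \<open>t\<close>. In the result \<open>z\<close> and \<open>w\<close> have exchanged places,
  so two rotations return to the initial pattern.\<close>

lemma cyc_rotate:
  assumes z: "ord_ge z 1" and w: "ord_ge w 1"
    and low: "lower P1" "lower P2" "lower P3" "lower P4"
    and low': "lower P1'" "lower P2'" "lower P3'" "lower P4'"
    and sm: "small P1'" "small P2'" "small P3'" "small P4'"
    and sc: "scaled z P1 P1'" "scaled w P2 P2'" "scaled w P3 P3'" "scaled z P4 P4'"
    and cr: "commutes P4 P1' 1 b1" "commutes P2' P3 1 b2" "commutes P2' P1' a1 1" "commutes P4' P3' a2 1"
  shows "a1 * a2 * fsum (cyc z w P1 P2 P3 P4) = b1 * b2 * fsum (cyc w z P1' P2' P3' P4')"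
proof -
  let ?u = "\<lambda>p. (z * w) ^ dsize (fst p)" and ?v = "\<lambda>p. z ^ dsize (fst p) * w ^ dsize (snd p)"
  let ?fa = "\<lambda>p e. P4 e (snd p) * P1' e (fst p)" and ?ga = "\<lambda>p v. P2' v (fst p) * P3 v (snd p)"
  let ?fb = "\<lambda>p k. P1' (snd p) k * P4 (fst p) k" and ?gb = "\<lambda>p k. P3 (fst p) k * P2' (snd p) k"
  let ?fc = "\<lambda>p t. P2' t (snd p) * P1' t (fst p)" and ?gc = "\<lambda>p s. P4' s (fst p) * P3' s (snd p)"
  let ?fd = "\<lambda>p q. P1' (snd p) q * P2' (fst p) q" and ?gd = "\<lambda>p r. P3' (fst p) r * P4' (snd p) r"
  \<comment> \<open>The halfway point: both upper sums have become sums over smaller diagrams, and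
    the whole weight sits at \<open>s\<close>.\<close>
  define G where "G = (\<lambda>(p, k, k'). ?u p * (?fb p k * ?gb p k'))"
  have 1: "cyc z w P1 P2 P3 P4 = (\<lambda>(p, e, v). ?u p * (?fa p e * ?ga p v))"
  proof (intro ext, clarify, unfold cyc_def prod.case fst_conv snd_conv)
    fix s t e v
    have "z ^ dsize e * w ^ dsize v * (P1 e s * P2 v s) * (P3 v t * P4 e t) =
      (z ^ dsize e * P1 e s) * (w ^ dsize v * P2 v s) * (P3 v t * P4 e t)" by (simp add: mult_ac)
    also have "\<dots> = (P1' e s * z ^ dsize s) * (P2' v s * w ^ dsize s) * (P3 v t * P4 e t)"
      using sc(1,2) by (simp add: scaled_def)
    finally show "z ^ dsize e * w ^ dsize v * (P1 e s * P2 v s) * (P3 v t * P4 e t) =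
      (z * w) ^ dsize s * (P4 e t * P1' e s * (P2' v s * P3 v t))"
      by (simp add: mult_ac power_mult_distrib)
  qed
  have vG: "vanishing G"
  proof (rule vanishing_quad)
    fix s t k k'
    assume nz: "G ((s, t), k, k') \<noteq> 0"
    hence "P4 s k \<noteq> 0" "P3 s k' \<noteq> 0" "P1' t k \<noteq> 0" by (auto simp: G_def)
    hence le: "dsize k \<le> dsize s" "dsize k' \<le> dsize s" "dsize k \<le> dsize t"
      using lower_dsize[OF low(4)] lower_dsize[OF low(3)] lower_dsize[OF low'(1)] by auto
    \<comment> \<open>The weight at \<open>s\<close> pays for \<open>s\<close>, \<open>k\<close> and
      \<open>k'\<close>. The diagram \<open>t\<close> carries no weight; its growth beyond
      \<open>k\<close> is paid for by the smallness of \<open>P1'\<close>.\<close>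
    have "ord_ge ((z * w) ^ dsize s) (dsize s + dsize s)"
      unfolding power_mult_distrib by (intro ord_ge_mult ord_ge_power z w)
    hence "ord_ge (G ((s, t), k, k')) (dsize s + dsize s + (dsize t - dsize k))"
      unfolding G_def prod.case fst_conv snd_conv by (intro ord_ge_mult ord_ge_mult_right smallD sm)
    thus "\<exists>n. ord_ge (G ((s, t), k, k')) n \<and> dsize s \<le> n \<and> dsize t \<le> n \<and> dsize k \<le> n \<and> dsize k' \<le> n"
      using le by (intro exI[of _ "dsize s + dsize s + (dsize t - dsize k)"]) auto
  qed
  have "fsum (cyc z w P1 P2 P3 P4) = fsum (\<lambda>p. ?u p * (fsum (?fa p) * fsum (?ga p)))"
    unfolding 1 by (rule fsum_quad(1); (fold 1)?; rule vanishing_cyc vanishing_up; use assms in blast)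
  also have "\<dots> = fsum (\<lambda>p. ?u p * ((b1 * fsum (?fb p)) * (b2 * fsum (?gb p))))"
    using cr(1,2) unfolding commutes_def by simp
  also have "\<dots> = fsum (\<lambda>p. (b1 * b2) * (?u p * (fsum (?fb p) * fsum (?gb p))))"
    by (simp add: mult_ac)
  also have "\<dots> = b1 * b2 * fsum G"
  proof -
    have v: "vanishing (?fb p)" "vanishing (?gb p)" for p
      by (rule vanishing_lower[OF low'(1)] vanishing_lower[OF low(3)])+
    note q = fsum_quad[OF vG[unfolded G_def] v, folded G_def]
    show ?thesis unfolding q(1) by (rule fsum_mult_left[OF q(2)])
  qed
  also have "a1 * a2 * (b1 * b2 * fsum G) = b1 * b2 * (a1 * a2 * fsum G)" by (simp add: mult_ac)
  also have "a1 * a2 * fsum G = fsum (cyc w z P1' P2' P3' P4')"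
  proof -
    \<comment> \<open>The same summands as in \<open>G\<close>, grouped by \<open>k\<close> and
      \<open>k'\<close>, with the weights pulled through \<open>P4\<close> and
      \<open>P3\<close>.\<close>
    define H where "H = (\<lambda>(p, t, s). ?v p * (?fc p t * ?gc p s))"
    have HG: "H ((k, k'), t, s) = G ((s, t), k, k')" for k k' s t
    proof -
      have "G ((s, t), k, k') = (z ^ dsize s * P4 s k) * (w ^ dsize s * P3 s k') * (P1' t k * P2' t k')"
        by (simp add: G_def power_mult_distrib mult_ac)
      also have "\<dots> = (P4' s k * z ^ dsize k) * (P3' s k' * w ^ dsize k') * (P1' t k * P2' t k')"
        using sc(3,4) by (simp add: scaled_def)
      finally show ?thesis by (simp add: H_def mult_ac)
    qed
    define r :: "(diagram \<times> diagram) \<times> diagram \<times> diagram \<Rightarrow> (diagram \<times> diagram) \<times> diagram \<times> diagram"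
      where "r = (\<lambda>((k, k'), t, s). ((s, t), k, k'))"
    have bij_r: "bij r"
      by (rule o_bij[of "\<lambda>((s, t), k, k'). ((k, k'), t, s)"]) (auto simp: r_def)
    have Hr: "H = (\<lambda>i. G (r i))" by (auto simp: r_def HG)
    have vH: "vanishing H" unfolding Hr by (rule vanishing_reindex[OF bij_is_inj[OF bij_r] vG])
    have v: "vanishing (?fc p)" "vanishing (?gc p)" for p
      using vanishing_up[OF low'(2,1)] vanishing_up[OF low'(4,3)] sm by auto
    note q = fsum_quad[OF vH[unfolded H_def] v, folded H_def]
    have "fsum G = fsum H" unfolding Hr by (rule fsum_reindex[OF bij_r, symmetric])
    hence "a1 * a2 * fsum G = fsum (\<lambda>p. a1 * a2 * (?v p * (fsum (?fc p) * fsum (?gc p))))"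
      by (simp only: q(1) fsum_mult_left[OF q(2)])
    also have "\<dots> = fsum (\<lambda>p. ?v p * ((a1 * fsum (?fc p)) * (a2 * fsum (?gc p))))"
      by (simp add: mult_ac)
    also have "\<dots> = fsum (\<lambda>p. ?v p * (fsum (?fd p) * fsum (?gd p)))"
      using cr(3,4) unfolding commutes_def by simp
    finally have *: "a1 * a2 * fsum G = fsum (\<lambda>p. ?v p * (fsum (?fd p) * fsum (?gd p)))" .
    \<comment> \<open>The relabelling puts \<open>k'\<close> in the place of \<open>e\<close>: the
      first diagram now carries the weight \<open>w\<close>.\<close>
    define c :: "(diagram \<times> diagram) \<times> diagram \<times> diagram \<Rightarrow> (diagram \<times> diagram) \<times> diagram \<times> diagram"
      where "c = (\<lambda>((k, k'), q, r). ((q, r), k', k))"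
    have bij_c: "bij c"
      by (rule o_bij[of "\<lambda>((q, r), k', k). ((k, k'), q, r)"]) (auto simp: c_def)
    have cyc_c: "(\<lambda>(p, q, r). ?v p * (?fd p q * ?gd p r)) = (\<lambda>i. cyc w z P1' P2' P3' P4' (c i))"
      by (auto simp: c_def cyc_def mult_ac)
    have "vanishing (\<lambda>i. cyc w z P1' P2' P3' P4' (c i))"
      by (rule vanishing_reindex[OF bij_is_inj[OF bij_c] vanishing_cyc]) (use assms in blast)+
    hence "vanishing (\<lambda>(p, q, r). ?v p * (?fd p q * ?gd p r))" unfolding cyc_c .
    hence "fsum (\<lambda>p. ?v p * (fsum (?fd p) * fsum (?gd p))) = fsum (\<lambda>i. cyc w z P1' P2' P3' P4' (c i))"
      unfolding cyc_c[symmetric] by (intro fsum_quad(1)[symmetric] vanishing_lower low')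
    thus ?thesis unfolding * by (simp only: fsum_reindex[OF bij_c])
  qed
  finally show ?thesis .
qed

definition kern :: "(nat \<Rightarrow> 'r::comm_ring_1 fps fps) \<Rightarrow> (nat \<Rightarrow> 'r fps fps) \<Rightarrow> nat \<Rightarrow> 'r fps fps \<Rightarrow> 'r fps fps" where
  "kern x y N M = (\<Prod>i<N. \<Prod>j<N. 1 - M * (x i * y j))"

text \<open>\<open>a\<close>, \<open>b\<close>, \<open>c\<close>, \<open>d\<close> record by which
  factors the rotations have multiplied the variables of the four operators so far.\<close>

definition schur_cyc :: "(nat \<Rightarrow> 'r::comm_ring_1 fps fps) \<Rightarrow> (nat \<Rightarrow> 'r fps fps) \<Rightarrow> nat \<Rightarrow>
    'r fps fps \<Rightarrow> 'r fps fps \<Rightarrow> 'r fps fps \<Rightarrow> 'r fps fps \<Rightarrow> 'r fps fps \<Rightarrow> 'r fps fps \<Rightarrow> 'r fps fps" where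
  "schur_cyc x y N z w a b c d = fsum (cyc z w (Hmat (\<lambda>i. a * y i) N) (Hmat (\<lambda>i. b * x i) N)
     (Vmat (\<lambda>i. c * y i) N) (Vmat (\<lambda>i. d * x i) N))"

text \<open>Of two operators that meet, one always has the alphabet \<open>x\<close> and the other
  \<open>y\<close>, so only products \<open>x i * y j\<close> arise; for the alphabets used later
  these are the powers of \<open>q\<close> with hook lengths as exponents. The mixed pairs bring
  \<open>1 + x y\<close>, hence the minus signs in the arguments of \<open>kern\<close>.\<close>

lemma schur_cyc_rotate:
  assumes z: "ord_ge z 1" and w: "ord_ge w 1"
  shows "kern x y N (z * w * a * b) * kern x y N (z * w * c * d) * schur_cyc x y N z w a b c d =
    kern x y N (- (z * a * d)) * kern x y N (- (w * b * c)) *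
    schur_cyc x y N w z (z * a) (w * b) (w * c) (z * d)"
  unfolding schur_cyc_def
proof (rule cyc_rotate[OF z w])
  have z': "ord_ge (z * F) 1" and w': "ord_ge (w * F) 1" for F using z w by (auto intro: ord_ge_mult_right)
  have sw: "(\<Prod>i<N. \<Prod>j<N. f j i) = (\<Prod>i<N. \<Prod>j<N. f i j)" for f :: "nat \<Rightarrow> nat \<Rightarrow> 'a fps fps"
    by (rule prod.swap)
  show "small (Hmat (\<lambda>i. z * a * y i) N)" "small (Hmat (\<lambda>i. w * b * x i) N)"
    "small (Vmat (\<lambda>i. w * c * y i) N)" "small (Vmat (\<lambda>i. z * d * x i) N)"
    unfolding Hmat_def Vmat_def using z' w' by (auto intro!: small_mat_prod small_hmat small_vmat simp: mult.assoc)
  show "scaled z (Hmat (\<lambda>i. a * y i) N) (Hmat (\<lambda>i. z * a * y i) N)"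
    "scaled w (Hmat (\<lambda>i. b * x i) N) (Hmat (\<lambda>i. w * b * x i) N)"
    "scaled w (Vmat (\<lambda>i. c * y i) N) (Vmat (\<lambda>i. w * c * y i) N)"
    "scaled z (Vmat (\<lambda>i. d * x i) N) (Vmat (\<lambda>i. z * d * x i) N)"
    unfolding mult.assoc by (rule scaled_Hmat scaled_Vmat)+
  have "commutes (Hmat (\<lambda>i. z * a * y i) N) (Vmat (\<lambda>i. d * x i) N) 1
      (\<Prod>i<N. \<Prod>j<N. 1 + (z * a * y i) * (d * x j))"
    by (rule commutes_Hmat_Vmat) (use z' in \<open>simp add: mult.assoc\<close>)
  also have "(\<Prod>i<N. \<Prod>j<N. 1 + (z * a * y i) * (d * x j)) = kern x y N (- (z * a * d))"
    unfolding kern_def by (subst sw) (simp add: mult_ac)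
  finally show "commutes (Vmat (\<lambda>i. d * x i) N) (Hmat (\<lambda>i. z * a * y i) N) 1 (kern x y N (- (z * a * d)))"
    by (rule commutes_sym)
  have "commutes (Hmat (\<lambda>i. w * b * x i) N) (Vmat (\<lambda>i. c * y i) N) 1
      (\<Prod>i<N. \<Prod>j<N. 1 + (w * b * x i) * (c * y j))"
    by (rule commutes_Hmat_Vmat) (use w' in \<open>simp add: mult.assoc\<close>)
  also have "(\<Prod>i<N. \<Prod>j<N. 1 + (w * b * x i) * (c * y j)) = kern x y N (- (w * b * c))"
    unfolding kern_def by (simp add: mult_ac)
  finally show "commutes (Hmat (\<lambda>i. w * b * x i) N) (Vmat (\<lambda>i. c * y i) N) 1 (kern x y N (- (w * b * c)))" .
  have "commutes (Hmat (\<lambda>i. w * b * x i) N) (Hmat (\<lambda>i. z * a * y i) N)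
      (\<Prod>i<N. \<Prod>j<N. 1 - (w * b * x i) * (z * a * y j)) 1"
    by (rule commutes_Hmat_Hmat) (use w' in \<open>simp add: mult.assoc\<close>)
  also have "(\<Prod>i<N. \<Prod>j<N. 1 - (w * b * x i) * (z * a * y j)) = kern x y N (z * w * a * b)"
    unfolding kern_def by (simp add: mult_ac)
  finally show "commutes (Hmat (\<lambda>i. w * b * x i) N) (Hmat (\<lambda>i. z * a * y i) N) (kern x y N (z * w * a * b)) 1" .
  have "commutes (Vmat (\<lambda>i. z * d * x i) N) (Vmat (\<lambda>i. w * c * y i) N)
      (\<Prod>i<N. \<Prod>j<N. 1 - (z * d * x i) * (w * c * y j)) 1"
    by (rule commutes_Vmat_Vmat) (use w' in \<open>simp add: mult.assoc\<close>)
  also have "(\<Prod>i<N. \<Prod>j<N. 1 - (z * d * x i) * (w * c * y j)) = kern x y N (z * w * c * d)"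
    unfolding kern_def by (simp add: mult_ac)
  finally show "commutes (Vmat (\<lambda>i. z * d * x i) N) (Vmat (\<lambda>i. w * c * y i) N) (kern x y N (z * w * c * d)) 1" .
qed simp_all

text \<open>Two rotations per induction step, because a single one leaves \<open>z\<close> and
  \<open>w\<close> exchanged. Rotation number \<open>j\<close> contributes \<rho>^(j+1) for like
  operators and \<open>z\<close>, \<open>w\<close> times \<rho>^j for mixed ones.\<close>

lemma schur_cyc_iterate:
  fixes x y :: "nat \<Rightarrow> 'r::comm_ring_1 fps fps"
  assumes z: "ord_ge z 1" and w: "ord_ge w 1"
  defines "\<rho> \<equiv> z * w"
  shows "(\<Prod>j<2*m. (kern x y N (\<rho> ^ Suc j))\<^sup>2) * schur_cyc x y N z w 1 1 1 1 =
    (\<Prod>j<2*m. kern x y N (- z * \<rho> ^ j) * kern x y N (- w * \<rho> ^ j)) *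
    schur_cyc x y N z w (\<rho> ^ m) (\<rho> ^ m) (\<rho> ^ m) (\<rho> ^ m)"
proof (induction m)
  case 0
  show ?case by simp
next
  case (Suc m)
  let ?k = "kern x y N" and ?r = "\<rho> ^ m"
  define T where "T = schur_cyc x y N z w ?r ?r ?r ?r"
  define T1 where "T1 = schur_cyc x y N w z (z * ?r) (w * ?r) (w * ?r) (z * ?r)"
  define T2 where "T2 = schur_cyc x y N z w (\<rho> ^ Suc m) (\<rho> ^ Suc m) (\<rho> ^ Suc m) (\<rho> ^ Suc m)"
  have e2: "\<rho> ^ (2 * m) = ?r * ?r" by (simp add: power_add mult_2)
  have s1: "(?k (\<rho> ^ Suc (2*m)))\<^sup>2 * T = ?k (- z * \<rho> ^ (2*m)) * ?k (- w * \<rho> ^ (2*m)) * T1"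
    using schur_cyc_rotate[OF z w, of x y N ?r ?r ?r ?r]
    by (simp add: T_def T1_def power2_eq_square \<rho>_def[symmetric] e2 mult.assoc)
  have a1: "w * z * (z * ?r) * (w * ?r) = \<rho> ^ Suc (Suc (2*m))"
    "w * z * (w * ?r) * (z * ?r) = \<rho> ^ Suc (Suc (2*m))"
    "w * (z * ?r) = \<rho> ^ Suc m" "z * (w * ?r) = \<rho> ^ Suc m"
    unfolding power_Suc e2 by (simp_all add: \<rho>_def mult_ac)
  have a2: "\<rho> ^ Suc m * (z * ?r) = z * \<rho> ^ Suc (2 * m)" "\<rho> ^ Suc m * (w * ?r) = w * \<rho> ^ Suc (2 * m)"
    unfolding power_Suc e2 by (simp_all add: mult_ac)
  have s2: "(?k (\<rho> ^ Suc (Suc (2*m))))\<^sup>2 * T1 = ?k (- z * \<rho> ^ Suc (2*m)) * ?k (- w * \<rho> ^ Suc (2*m)) * T2"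
    using schur_cyc_rotate[OF w z, of x y N "z * ?r" "w * ?r" "w * ?r" "z * ?r", folded T1_def, unfolded a1 a2, folded T2_def]
    by (simp add: power2_eq_square del: power_Suc)
  define A B where "A = (\<Prod>j<2*m. (?k (\<rho> ^ Suc j))\<^sup>2)"
    and "B = (\<Prod>j<2*m. ?k (- z * \<rho> ^ j) * ?k (- w * \<rho> ^ j))"
  have IH: "A * schur_cyc x y N z w 1 1 1 1 = B * T"
    using Suc unfolding A_def B_def T_def .
  have "A * (?k (\<rho> ^ Suc (2*m)))\<^sup>2 * (?k (\<rho> ^ Suc (Suc (2*m))))\<^sup>2 * schur_cyc x y N z w 1 1 1 1 =
    (?k (\<rho> ^ Suc (2*m)))\<^sup>2 * (?k (\<rho> ^ Suc (Suc (2*m))))\<^sup>2 * (A * schur_cyc x y N z w 1 1 1 1)"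
    by (simp only: mult_ac)
  also have "\<dots> = B * ((?k (\<rho> ^ Suc (Suc (2*m))))\<^sup>2 * ((?k (\<rho> ^ Suc (2*m)))\<^sup>2 * T))"
    unfolding IH by (simp only: mult_ac)
  also have "\<dots> = B * (?k (- z * \<rho> ^ (2*m)) * ?k (- w * \<rho> ^ (2*m))) * ((?k (\<rho> ^ Suc (Suc (2*m))))\<^sup>2 * T1)"
    unfolding s1 by (simp only: mult_ac)
  also have "\<dots> = B * (?k (- z * \<rho> ^ (2*m)) * ?k (- w * \<rho> ^ (2*m))) *
     (?k (- z * \<rho> ^ Suc (2*m)) * ?k (- w * \<rho> ^ Suc (2*m))) * T2"
    unfolding s2 by (simp only: mult_ac)
  finally show ?case
    unfolding A_def B_def T2_def by (simp add: lessThan_Suc del: power_Suc) (simp add: mult_ac)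
qed

lemma schur_cyc_cong_mod:
  assumes z: "ord_ge z 1" and w: "ord_ge w 1"
    and "ord_ge (a - a') n" "ord_ge (b - b') n" "ord_ge (c - c') n" "ord_ge (d - d') n"
  shows "ord_ge (schur_cyc x y N z w a b c d - schur_cyc x y N z w a' b' c' d') n"
  unfolding schur_cyc_def
proof (intro fsum_cong_mod vanishing_cyc z w lower_Hmat lower_Vmat)
  have *: "ord_ge (f * u - f' * u) n" if "ord_ge (f - f') n" for f f' u :: "'a fps fps"
    using ord_ge_mult_right[OF that, of u] by (simp add: left_diff_distrib)
  fix p show "ord_ge (cyc z w (Hmat (\<lambda>i. a * y i) N) (Hmat (\<lambda>i. b * x i) N)
     (Vmat (\<lambda>i. c * y i) N) (Vmat (\<lambda>i. d * x i) N) p -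
    cyc z w (Hmat (\<lambda>i. a' * y i) N) (Hmat (\<lambda>i. b' * x i) N)
     (Vmat (\<lambda>i. c' * y i) N) (Vmat (\<lambda>i. d' * x i) N) p) n"
    unfolding cyc_def case_prod_unfold
    by (intro ord_ge_diff_mult Hmat_cong_mod Vmat_cong_mod * assms) simp_all
qed

text \<open>After \<open>2*m\<close> rotations every variable carries a factor \<rho>^m, which
  vanishes modulo degree \<open>m\<close>. Setting it to 0 turns the operators into identities, so
  the remaining sum no longer involves \<open>x\<close> and \<open>y\<close>.\<close>

lemma schur_cyc_limit:
  fixes x y :: "nat \<Rightarrow> 'r::comm_ring_1 fps fps"
  assumes z: "ord_ge z 1" and w: "ord_ge w 1"
  shows "ord_ge ((\<Prod>j<2*m. (kern x y N ((z * w) ^ Suc j))\<^sup>2) * schur_cyc x y N z w 1 1 1 1 -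
    (\<Prod>j<2*m. kern x y N (- z * (z * w) ^ j) * kern x y N (- w * (z * w) ^ j)) *
    fsum (cyc z w id_mat id_mat id_mat id_mat)) m"
proof -
  \<comment> \<open>At variable 0 only the empty strip survives, as
    \<open>0 ^ 0 = 1\<close>.\<close>
  have 0: "mat_prod (\<lambda>i. hmat 0) N = (id_mat :: 'r diagram_mat)" "mat_prod (\<lambda>i. vmat 0) N = (id_mat :: 'r diagram_mat)" for N :: nat
  proof -
    have "hmat 0 m l = (id_mat m l :: 'r fps fps)" for m l
    proof (cases "m = l")
      case True
      thus ?thesis by (simp add: hmat_def id_mat_def hstrip_def row_antimono)
    next
      case False
      have "dsize l < dsize m" if "hstrip l m"
        using False dsize_mono[OF hstrip_le[OF that]] dsize_eq_imp_eq[OF hstrip_le[OF that]] by (auto simp: le_less)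
      thus ?thesis using False by (auto simp: hmat_def id_mat_def zero_power)
    qed
    hence h: "hmat 0 = (id_mat :: 'r diagram_mat)" by blast
    have "vmat 0 m l = (id_mat m l :: 'r fps fps)" for m l
      unfolding vmat_eq_hmat_mirror h by (auto simp: id_mat_def) (metis mirror_mirror)
    hence v: "vmat 0 = (id_mat :: 'r diagram_mat)" by blast
    have "mat_prod (\<lambda>i. id_mat :: 'r diagram_mat) N = id_mat" by (induction N) simp_all
    thus "mat_prod (\<lambda>i. hmat 0 :: 'r diagram_mat) N = id_mat" "mat_prod (\<lambda>i. vmat 0 :: 'r diagram_mat) N = id_mat"
      by (simp_all add: h v)
  qed
  have "ord_ge (z * w) 1" using z by (rule ord_ge_mult_right)
  hence r: "ord_ge ((z * w) ^ m - 0) m" using ord_ge_power by simp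
  have "ord_ge (schur_cyc x y N z w ((z * w) ^ m) ((z * w) ^ m) ((z * w) ^ m) ((z * w) ^ m) -
    schur_cyc x y N z w 0 0 0 0) m"
    by (intro schur_cyc_cong_mod z w r)
  moreover have "schur_cyc x y N z w 0 0 0 0 = fsum (cyc z w id_mat id_mat id_mat id_mat)"
    unfolding schur_cyc_def Hmat_def Vmat_def mult_zero_left 0 ..
  ultimately show ?thesis
    unfolding schur_cyc_iterate[OF z w] by (simp add: ord_ge_mult_left flip: right_diff_distrib)
qed

section \<open>Specialized skew Schur functions\<close>

definition mon_eval :: "(nat \<Rightarrow> 'b::comm_ring_1) \<Rightarrow> (nat \<Rightarrow>\<^sub>0 nat) \<Rightarrow> 'b" where
  "mon_eval v m = (\<Prod>i\<in>Poly_Mapping.keys m. v i ^ Poly_Mapping.lookup m i)"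

lemma mon_eval_superset:
  "finite A \<Longrightarrow> Poly_Mapping.keys m \<subseteq> A \<Longrightarrow> mon_eval v m = (\<Prod>i\<in>A. v i ^ Poly_Mapping.lookup m i)"
  unfolding mon_eval_def by (rule prod.mono_neutral_left) (auto simp: in_keys_iff)

lemma mon_eval_add: "mon_eval v (m + n) = mon_eval v m * mon_eval v n"
proof -
  let ?A = "Poly_Mapping.keys m \<union> Poly_Mapping.keys n"
  have "mon_eval v (m + n) = (\<Prod>i\<in>?A. v i ^ Poly_Mapping.lookup (m + n) i)"
    by (rule mon_eval_superset) (auto dest: subsetD[OF Poly_Mapping.keys_add])
  also have "\<dots> = mon_eval v m * mon_eval v n"
    by (simp add: mon_eval_superset[of ?A m] mon_eval_superset[of ?A n] lookup_add power_add prod.distrib)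
  finally show ?thesis .
qed

lemma mon_eval_0 [simp]: "mon_eval v 0 = 1"
  by (simp add: mon_eval_def)

lemma mpoly_eval_superset:
  "finite A \<Longrightarrow> Poly_Mapping.keys p \<subseteq> A \<Longrightarrow>
    mpoly_eval p v = (\<Sum>m\<in>A. of_int (Poly_Mapping.lookup p m) * mon_eval v m)"
  unfolding mpoly_eval_def mon_eval_def[symmetric]
  by (rule sum.mono_neutral_left) (auto simp: in_keys_iff)

lemma mpoly_eval_add: "mpoly_eval (p + q) v = mpoly_eval p v + mpoly_eval q v"
proof -
  let ?A = "Poly_Mapping.keys p \<union> Poly_Mapping.keys q"
  have "mpoly_eval (p + q) v = (\<Sum>m\<in>?A. of_int (Poly_Mapping.lookup (p + q) m) * mon_eval v m)"
    by (rule mpoly_eval_superset) (auto dest: subsetD[OF Poly_Mapping.keys_add])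
  also have "\<dots> = mpoly_eval p v + mpoly_eval q v"
    by (simp add: mpoly_eval_superset[of ?A p] mpoly_eval_superset[of ?A q] lookup_add
        distrib_right sum.distrib)
  finally show ?thesis .
qed

lemma mpoly_eval_0 [simp]: "mpoly_eval 0 v = 0"
  by (simp add: mpoly_eval_def)

lemma mpoly_eval_uminus: "mpoly_eval (- p) v = - mpoly_eval p v"
  using mpoly_eval_add[of p "- p" v] by (simp add: eq_neg_iff_add_eq_0 add.commute)

lemma mpoly_eval_diff: "mpoly_eval (p - q) v = mpoly_eval p v - mpoly_eval q v"
  using mpoly_eval_add[of p "- q" v] by (simp add: mpoly_eval_uminus)

lemma mpoly_eval_sum: "mpoly_eval (sum f A) v = (\<Sum>i\<in>A. mpoly_eval (f i) v)"
  by (induction A rule: infinite_finite_induct) (auto simp: mpoly_eval_add)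

lemma mpoly_eval_single: "mpoly_eval (Poly_Mapping.single m c) v = of_int c * mon_eval v m"
  by (subst mpoly_eval_superset[of "{m}"]) (auto split: if_splits)

lemma mpoly_expand: "p = (\<Sum>m\<in>Poly_Mapping.keys p. Poly_Mapping.single m (Poly_Mapping.lookup p m))"
proof (rule poly_mapping_eqI)
  fix k
  have "(\<Sum>m\<in>Poly_Mapping.keys p. Poly_Mapping.lookup p m when m = k) =
    (\<Sum>m\<in>Poly_Mapping.keys p. if m = k then Poly_Mapping.lookup p k else 0)"
    by (intro sum.cong) (auto simp: when_def)
  thus "Poly_Mapping.lookup p k = Poly_Mapping.lookup
      (\<Sum>m\<in>Poly_Mapping.keys p. Poly_Mapping.single m (Poly_Mapping.lookup p m)) k"
    by (simp add: lookup_sum lookup_single sum.delta in_keys_iff)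
qed

lemma mpoly_eval_mult: "mpoly_eval (p * q) v = mpoly_eval p v * mpoly_eval q v"
proof -
  let ?P = "Poly_Mapping.keys p" and ?Q = "Poly_Mapping.keys q"
  have "p * q = (\<Sum>m\<in>?P. \<Sum>n\<in>?Q. Poly_Mapping.single (m + n) (Poly_Mapping.lookup p m * Poly_Mapping.lookup q n))"
    by (subst mpoly_expand[of p], subst mpoly_expand[of q]) (simp add: sum_product mult_single)
  hence "mpoly_eval (p * q) v = (\<Sum>m\<in>?P. \<Sum>n\<in>?Q.
     (of_int (Poly_Mapping.lookup p m) * mon_eval v m) * (of_int (Poly_Mapping.lookup q n) * mon_eval v n))"
    by (simp add: mpoly_eval_sum mpoly_eval_single mon_eval_add mult_ac)
  also have "\<dots> = mpoly_eval p v * mpoly_eval q v"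
    by (simp add: sum_product mpoly_eval_def mon_eval_def)
  finally show ?thesis .
qed

lemma mpoly_eval_of_int [simp]: "mpoly_eval (of_int c) v = of_int c"
  using mpoly_eval_single[of 0 c v] by (simp flip: single_of_int)

lemma mpoly_eval_1 [simp]: "mpoly_eval 1 v = 1"
  using mpoly_eval_of_int[of 1 v] by simp

lemma mpoly_eval_mvar [simp]: "mpoly_eval (mvar i) v = v i"
  by (simp add: mvar_def mpoly_eval_single mon_eval_def)

lemma mpoly_eval_prod: "mpoly_eval (prod f A) v = (\<Prod>i\<in>A. mpoly_eval (f i) v)"
  by (induction A rule: infinite_finite_induct) (auto simp: mpoly_eval_mult)

lemma mpoly_eval_power: "mpoly_eval (p ^ k) v = mpoly_eval p v ^ k"
  by (induction k) (auto simp: mpoly_eval_mult)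

lemma mpoly_eval_compose: "mpoly_eval (mpoly_eval P w) v = mpoly_eval P (\<lambda>n. mpoly_eval (w n) v)"
  unfolding mpoly_eval_def[of P]
  by (simp add: mpoly_eval_sum mpoly_eval_mult mpoly_eval_prod mpoly_eval_power)

definition esym :: "nat \<Rightarrow> nat \<Rightarrow> (nat \<Rightarrow> 'b::comm_ring_1) \<Rightarrow> 'b" where
  "esym k N x = (\<Sum>S | S \<subseteq> {..<N} \<and> card S = k. \<Prod>i\<in>S. x i)"

lemma mpoly_eval_elem_sym: "mpoly_eval (elem_sym k N) x = esym k N x"
  by (simp add: elem_sym_def esym_def mpoly_eval_sum mpoly_eval_prod)

lemma elem_sym_eq_esym: "elem_sym k N = esym k N mvar"
  by (simp add: elem_sym_def esym_def)

lemma esym_0 [simp]: "esym 0 N x = 1"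
proof -
  have "{S. S \<subseteq> {..<N} \<and> card S = 0} = {{}}"
    using finite_subset[of _ "{..<N}"] by (auto simp: card_eq_0_iff)
  thus ?thesis by (simp add: esym_def)
qed

lemma esym_eq_0: "N < k \<Longrightarrow> esym k N x = 0"
proof -
  assume k: "N < k"
  have "card S \<noteq> k" if "S \<subseteq> {..<N}" for S
    using card_mono[OF _ that] k by simp
  hence "{S. S \<subseteq> {..<N} \<and> card S = k} = {}" by auto
  thus ?thesis by (simp only: esym_def sum.empty)
qed

text \<open>The homogeneous form serves twice: with \<open>z\<close> as the argument of a polynomial
  with prescribed roots, and with \<open>z = 1\<close> as the generating function of the elementary
  symmetric polynomials.\<close>

lemma prod_add_esym:
  "(\<Prod>i<N. z + x i * y) = (\<Sum>k\<le>N. esym k N x * y ^ k * z ^ (N - k))"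
proof -
  have "(\<Prod>i<N. z + x i * y) = (\<Sum>S\<in>Pow {..<N}. (\<Prod>i\<in>S. x i * y) * (\<Prod>i\<in>{..<N}-S. z))"
    using prod_add[of "{..<N}" "\<lambda>i. x i * y" "\<lambda>_. z"] by (simp add: add.commute)
  also have "\<dots> = (\<Sum>S\<in>Pow {..<N}. (\<Prod>i\<in>S. x i) * y ^ card S * z ^ (N - card S))"
    by (intro sum.cong refl) (simp add: prod.distrib card_Diff_subset finite_subset)
  also have "\<dots> = (\<Sum>k\<le>N. \<Sum>S | S \<in> Pow {..<N} \<and> card S = k. (\<Prod>i\<in>S. x i) * y ^ card S * z ^ (N - card S))"
    by (rule sum.group[symmetric]) (auto dest: card_mono[rotated])
  also have "\<dots> = (\<Sum>k\<le>N. esym k N x * y ^ k * z ^ (N - k))"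
    unfolding esym_def by (intro sum.cong refl) (simp add: sum_distrib_right)
  finally show ?thesis .
qed

text \<open>Vieta: a monic polynomial with the prescribed lower coefficients splits over the complex
  numbers, and its negated roots are the required values.\<close>

lemma ex_esym_eq:
  fixes c :: "nat \<Rightarrow> complex"
  shows "\<exists>x. \<forall>k. 0 < k \<and> k \<le> N \<longrightarrow> esym k N x = c k"
proof -
  define d where "d k = (if k = 0 then 1 else c k)" for k
  define p where "p = (\<Sum>k\<le>N. monom (d k) (N - k))"
  have coeff_p: "coeff p (N - k) = d k" if "k \<le> N" for k
  proof -
    have "coeff p (N - k) = (\<Sum>j\<le>N. if j = k then d k else 0)"
      unfolding p_def coeff_sum using that by (intro sum.cong refl) auto
    thus ?thesis using that by simp
  qed
  have deg: "degree p \<le> N" unfolding p_def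
    by (rule degree_sum_le) (auto intro: order_trans[OF degree_monom_le])
  have lc: "coeff p N = 1" using coeff_p[of 0] by (simp add: d_def)
  hence dN: "degree p = N" using deg le_degree[of p N] by simp
  have "p \<noteq> 0" using lc by auto
  then obtain A where A: "size A = N" "p = (\<Prod>r\<in>#A. [:- r, 1:])"
    using alg_closed_imp_factorization[of p] dN lc by auto
  obtain rs where rs: "mset rs = A" using ex_mset by blast
  define x where "x i = - (rs ! i)" for i
  have "(\<Prod>r\<in>#A. [:- r, 1:]) = (\<Prod>i<N. [:- (rs ! i), 1:])"
  proof -
    have "(\<Prod>r\<in>#A. [:- r, 1:]) = prod_list (map (\<lambda>r. [:- r, 1:]) rs)"
      unfolding rs[symmetric] by (simp add: prod_mset_prod_list flip: mset_map)
    also have "\<dots> = (\<Prod>i<N. [:- (rs ! i), 1:])"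
      using A(1) rs by (subst prod.list_conv_set_nth) (auto simp: atLeast0LessThan)
    finally show ?thesis .
  qed
  hence "poly p t = (\<Prod>i<N. t + x i)" for t
    unfolding A(2) by (simp add: poly_prod x_def)
  hence "poly p t = (\<Sum>k\<le>N. esym k N x * t ^ (N - k))" for t
    using prod_add_esym[where z = t and y = 1] by simp
  hence "poly p = poly (\<Sum>k\<le>N. monom (esym k N x) (N - k))"
    by (intro ext) (simp add: poly_sum poly_monom)
  hence pe: "p = (\<Sum>k\<le>N. monom (esym k N x) (N - k))" by (simp add: poly_eq_poly_eq_iff)
  have "esym k N x = d k" if "k \<le> N" for k
  proof -
    have "coeff p (N - k) = (\<Sum>j\<le>N. if j = k then esym k N x else 0)"
      unfolding pe coeff_sum using that by (intro sum.cong refl) auto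
    thus ?thesis using that coeff_p[OF that] by simp
  qed
  thus ?thesis by (intro exI[of _ x]) (auto simp: d_def)
qed

text \<open>Uniqueness of expansions in base \<open>B\<close>; it makes different exponent vectors
  give different powers of \<open>t\<close> in the Kronecker substitution.\<close>

lemma digits_inj:
  fixes f g :: "nat \<Rightarrow> nat"
  assumes "(\<Sum>i<M. f i * B ^ i) = (\<Sum>i<M. g i * B ^ i)" "\<And>i. i < M \<Longrightarrow> f i < B" "\<And>i. i < M \<Longrightarrow> g i < B"
  shows "i < M \<Longrightarrow> f i = g i"
  using assms
proof (induction M arbitrary: f g i)
  case (Suc M)
  have *: "(\<Sum>i<Suc M. h i * B ^ i) = h 0 + B * (\<Sum>i<M. h (Suc i) * B ^ i)" for h :: "nat \<Rightarrow> nat"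
    unfolding sum.lessThan_Suc_shift by (simp add: sum_distrib_left mult_ac)
  have eq: "f 0 + B * (\<Sum>i<M. f (Suc i) * B ^ i) = g 0 + B * (\<Sum>i<M. g (Suc i) * B ^ i)"
    using Suc.prems(2) unfolding * .
  have B: "f 0 < B" "g 0 < B" using Suc.prems(3,4)[of 0] by auto
  have "f 0 = (f 0 + B * (\<Sum>i<M. f (Suc i) * B ^ i)) mod B" using B by simp
  also have "\<dots> = g 0" unfolding eq using B by simp
  finally have 0: "f 0 = g 0" .
  hence "(\<Sum>i<M. f (Suc i) * B ^ i) = (\<Sum>i<M. g (Suc i) * B ^ i)" using eq B by simp
  hence "f (Suc j) = g (Suc j)" if "j < M" for j
    using Suc.IH[OF that, of "\<lambda>i. f (Suc i)" "\<lambda>i. g (Suc i)"] Suc.prems(3,4) by simp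
  with 0 show ?case using Suc.prems(1) by (cases i) auto
qed simp

text \<open>Kronecker substitution: the elementary symmetric functions can be given the values
  \<open>t, t\<^sup>B, t^(B^2), \<dots>\<close>, which separates monomials.\<close>

lemma elem_sym_independent:
  assumes D: "\<And>N. mpoly_eval D (\<lambda>n. elem_sym (Suc n) N) = 0"
  shows "D = 0"
proof (rule ccontr)
  assume "D \<noteq> 0"
  define K where "K = Poly_Mapping.keys D"
  define V where "V = (\<Union>m\<in>K. Poly_Mapping.keys m)"
  have fin: "finite K" "finite V" by (auto simp: K_def V_def)
  obtain M where M: "\<And>i. i \<in> V \<Longrightarrow> i < M" using fin(2) unfolding finite_nat_set_iff_bounded by blast
  have "finite ((\<lambda>(m, i). Poly_Mapping.lookup m i) ` (K \<times> V))" using fin by simp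
  then obtain B where B: "\<And>m i. m \<in> K \<Longrightarrow> i \<in> V \<Longrightarrow> Poly_Mapping.lookup m i < B"
    unfolding finite_nat_set_iff_bounded by force
  \<comment> \<open>The successor keeps the base positive even when \<open>V\<close> is empty, so
    the exponent 0 of an absent variable is a valid digit too.\<close>
  define B' where "B' = Suc B"
  have keys: "Poly_Mapping.keys m \<subseteq> {..<M}" if "m \<in> K" for m using that M by (auto simp: V_def)
  have lt: "Poly_Mapping.lookup m i < B'" if "m \<in> K" for m i
  proof (cases "i \<in> Poly_Mapping.keys m")
    case True
    hence "i \<in> V" using that by (auto simp: V_def)
    thus ?thesis using B[OF that, of i] by (simp add: B'_def)
  qed (simp add: B'_def in_keys_iff)
  define \<phi> where "\<phi> m = (\<Sum>i<M. Poly_Mapping.lookup m i * B' ^ i)" for m :: "nat \<Rightarrow>\<^sub>0 nat"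
  have inj: "inj_on \<phi> K"
  proof (rule inj_onI, rule poly_mapping_eqI)
    fix m n i assume mn: "m \<in> K" "n \<in> K" "\<phi> m = \<phi> n"
    show "Poly_Mapping.lookup m i = Poly_Mapping.lookup n i"
    proof (cases "i < M")
      case True
      thus ?thesis using digits_inj[of "Poly_Mapping.lookup m" B' M "Poly_Mapping.lookup n"] mn lt
        by (auto simp: \<phi>_def)
    next
      case False
      hence "i \<notin> Poly_Mapping.keys m" "i \<notin> Poly_Mapping.keys n" using keys mn by blast+
      thus ?thesis by (simp add: in_keys_iff)
    qed
  qed
  define p where "p = (\<Sum>m\<in>K. monom (of_int (Poly_Mapping.lookup D m) :: complex) (\<phi> m))"
  have "poly p t = 0" for t
  proof -
    \<comment> \<open>\<open>M\<close> variables suffice, because \<open>D\<close> only mentions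
      elementary symmetric functions up to degree \<open>M\<close>.\<close>
    obtain x where x: "\<And>k. 0 < k \<Longrightarrow> k \<le> M \<Longrightarrow> esym k M x = t ^ (B' ^ (k - 1))"
      using ex_esym_eq[of M "\<lambda>k. t ^ (B' ^ (k - 1))"] by blast
    have "0 = mpoly_eval (mpoly_eval D (\<lambda>n. elem_sym (Suc n) M)) x" by (simp add: D)
    also have "\<dots> = mpoly_eval D (\<lambda>n. esym (Suc n) M x)"
      by (simp add: mpoly_eval_compose mpoly_eval_elem_sym)
    also have "\<dots> = (\<Sum>m\<in>K. of_int (Poly_Mapping.lookup D m) * mon_eval (\<lambda>n. esym (Suc n) M x) m)"
      by (rule mpoly_eval_superset) (auto simp: K_def)
    also have "\<dots> = (\<Sum>m\<in>K. of_int (Poly_Mapping.lookup D m) * t ^ \<phi> m)"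
    proof (intro sum.cong refl)
      fix m assume m: "m \<in> K"
      have "mon_eval (\<lambda>n. esym (Suc n) M x) m = (\<Prod>i<M. esym (Suc i) M x ^ Poly_Mapping.lookup m i)"
        by (rule mon_eval_superset[OF _ keys[OF m]]) simp
      also have "\<dots> = (\<Prod>i<M. t ^ (Poly_Mapping.lookup m i * B' ^ i))"
        by (intro prod.cong refl) (simp add: x mult.commute flip: power_mult)
      also have "\<dots> = t ^ \<phi> m" by (simp add: \<phi>_def power_sum)
      finally show "of_int (Poly_Mapping.lookup D m) * mon_eval (\<lambda>n. esym (Suc n) M x) m =
        of_int (Poly_Mapping.lookup D m) * t ^ \<phi> m" by simp
    qed
    finally show ?thesis by (simp add: p_def poly_sum poly_monom)
  qed
  hence "p = 0" using poly_all_0_iff_0[of p] by blast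
  have "K \<noteq> {}" using \<open>D \<noteq> 0\<close> by (simp add: K_def)
  then obtain m where m: "m \<in> K" by blast
  have "coeff p (\<phi> m) = (\<Sum>n\<in>K. if n = m then of_int (Poly_Mapping.lookup D m) else 0)"
    unfolding p_def coeff_sum coeff_monom using inj m by (intro sum.cong refl) (auto dest: inj_onD)
  hence "Poly_Mapping.lookup D m = 0" using \<open>p = 0\<close> m fin by simp
  thus False using m by (simp add: K_def in_keys_iff)
qed

definition elem_poly :: "(nat \<Rightarrow> int_mpoly) \<Rightarrow> bool" where
  "elem_poly f \<longleftrightarrow> (\<exists>P. \<forall>N. f N = mpoly_eval P (\<lambda>n. elem_sym (Suc n) N))"

text \<open>Justifies the definite description: \<open>elem_poly\<close> gives existence, and
  algebraic independence gives uniqueness.\<close>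

lemma elem_expansion_eq:
  assumes "elem_poly f"
  shows "f N = mpoly_eval (elem_expansion f) (\<lambda>n. elem_sym (Suc n) N)"
proof -
  have "\<exists>!P. \<forall>N. f N = mpoly_eval P (\<lambda>n. elem_sym (Suc n) N)"
  proof (rule ex_ex1I)
    show "\<exists>P. \<forall>N. f N = mpoly_eval P (\<lambda>n. elem_sym (Suc n) N)"
      using assms by (simp add: elem_poly_def)
    fix P Q assume PQ: "\<forall>N. f N = mpoly_eval P (\<lambda>n. elem_sym (Suc n) N)"
      "\<forall>N. f N = mpoly_eval Q (\<lambda>n. elem_sym (Suc n) N)"
    have "P - Q = 0"
    proof (rule elem_sym_independent)
      fix N
      have "mpoly_eval P (\<lambda>n. elem_sym (Suc n) N) = mpoly_eval Q (\<lambda>n. elem_sym (Suc n) N)"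
        using PQ by metis
      thus "mpoly_eval (P - Q) (\<lambda>n. elem_sym (Suc n) N) = 0" by (simp add: mpoly_eval_diff)
    qed
    thus "P = Q" by simp
  qed
  from theI'[OF this] show ?thesis unfolding elem_expansion_def by blast
qed

text \<open>Substituting in two stages: the values taken by the elementary symmetric functions come
  from actual variables \<open>x\<close>, so the specialization is evaluation at \<open>x\<close>.
  This is the bridge to finite alphabets.\<close>

lemma specialize_finite:
  assumes "elem_poly f" and E: "\<And>n. E $ Suc n = esym (Suc n) N x"
  shows "specialize f E = mpoly_eval (f N) x"
proof -
  have "mpoly_eval (f N) x = mpoly_eval (mpoly_eval (elem_expansion f) (\<lambda>n. elem_sym (Suc n) N)) x"
    by (simp only: elem_expansion_eq[OF assms(1), of N, symmetric])
  thus ?thesis by (simp add: specialize_def E mpoly_eval_compose mpoly_eval_elem_sym)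
qed

lemma elem_poly_const: "elem_poly (\<lambda>N. of_int c)"
  unfolding elem_poly_def by (intro exI[of _ "of_int c"]) simp

lemma elem_poly_elem_sym: "elem_poly (elem_sym k)"
proof (cases k)
  case 0
  thus ?thesis using elem_poly_const[of 1] by (simp add: elem_poly_def elem_sym_eq_esym)
next
  case (Suc n)
  thus ?thesis unfolding elem_poly_def by (intro exI[of _ "mvar n"]) simp
qed

lemma elem_poly_mult: "elem_poly f \<Longrightarrow> elem_poly g \<Longrightarrow> elem_poly (\<lambda>N. f N * g N)"
proof -
  assume "elem_poly f" "elem_poly g"
  then obtain P Q where "\<And>N. f N = mpoly_eval P (\<lambda>n. elem_sym (Suc n) N)"
    "\<And>N. g N = mpoly_eval Q (\<lambda>n. elem_sym (Suc n) N)" unfolding elem_poly_def by blast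
  thus ?thesis unfolding elem_poly_def by (intro exI[of _ "P * Q"]) (simp add: mpoly_eval_mult)
qed

lemma elem_poly_add: "elem_poly f \<Longrightarrow> elem_poly g \<Longrightarrow> elem_poly (\<lambda>N. f N + g N)"
proof -
  assume "elem_poly f" "elem_poly g"
  then obtain P Q where "\<And>N. f N = mpoly_eval P (\<lambda>n. elem_sym (Suc n) N)"
    "\<And>N. g N = mpoly_eval Q (\<lambda>n. elem_sym (Suc n) N)" unfolding elem_poly_def by blast
  thus ?thesis unfolding elem_poly_def by (intro exI[of _ "P + Q"]) (simp add: mpoly_eval_add)
qed

lemma elem_poly_diff: "elem_poly f \<Longrightarrow> elem_poly g \<Longrightarrow> elem_poly (\<lambda>N. f N - g N)"
proof -
  assume "elem_poly f" "elem_poly g"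
  then obtain P Q where "\<And>N. f N = mpoly_eval P (\<lambda>n. elem_sym (Suc n) N)"
    "\<And>N. g N = mpoly_eval Q (\<lambda>n. elem_sym (Suc n) N)" unfolding elem_poly_def by blast
  thus ?thesis unfolding elem_poly_def by (intro exI[of _ "P - Q"]) (simp add: mpoly_eval_diff)
qed

lemma elem_poly_sum: "(\<And>i. i \<in> A \<Longrightarrow> elem_poly (f i)) \<Longrightarrow> elem_poly (\<lambda>N. \<Sum>i\<in>A. f i N)"
proof (induction A rule: infinite_finite_induct)
  case (insert i A)
  thus ?case by (simp add: elem_poly_add)
qed (use elem_poly_const[of 0] in simp_all)

section \<open>Skew Schur polynomials on diagrams\<close>

definition tableaux :: "diagram \<Rightarrow> diagram \<Rightarrow> nat \<Rightarrow> (nat \<times> nat \<Rightarrow> nat) set" where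
  "tableaux m l N = {T \<in> (cells m - cells l) \<rightarrow>\<^sub>E {..<N}.
     (\<forall>i j j'. (i, j) \<in> cells m - cells l \<longrightarrow> (i, j') \<in> cells m - cells l \<longrightarrow> j < j'
        \<longrightarrow> T (i, j) \<le> T (i, j')) \<and>
     (\<forall>i i' j. (i, j) \<in> cells m - cells l \<longrightarrow> (i', j) \<in> cells m - cells l \<longrightarrow> i < i'
        \<longrightarrow> T (i, j) < T (i', j))}"

text \<open>Over an arbitrary commutative ring, because it is used with polynomial variables, with
  field elements and with constant bivariate series.\<close>

definition skew :: "(nat \<Rightarrow> 'b::comm_ring_1) \<Rightarrow> nat \<Rightarrow> diagram \<Rightarrow> diagram \<Rightarrow> 'b" where
  "skew x N m l = (if l \<le> m then \<Sum>T\<in>tableaux m l N. \<Prod>c\<in>cells m - cells l. x (T c) else 0)"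

lemma finite_tableaux: "finite (tableaux m l N)"
  unfolding tableaux_def by (rule finite_subset[OF _ finite_PiE[of "cells m - cells l" "\<lambda>_. {..<N}"]])
    (auto simp: finite_cells)

lemma skew_schur_eq_skew:
  assumes k: "is_partition k" and l: "is_partition l"
  shows "skew_schur l k N = skew mvar N (diag l) (diag k)"
proof (cases "diag k \<le> diag l")
  case True
  let ?D = "cells (diag l) - cells (diag k)" and ?s = "map_prod Suc Suc :: nat \<times> nat \<Rightarrow> _"
  have inj: "inj ?s" by (rule prod.inj_map) auto
  have D: "boxes l - boxes k = ?s ` ?D"
    by (simp add: boxes_eq k l image_set_diff[OF inj])
  have mem: "(Suc i, Suc j) \<in> ?s ` ?D \<longleftrightarrow> (i, j) \<in> ?D" for i j by force
  have memE: "p \<in> ?s ` ?D \<longleftrightarrow> (\<exists>i j. p = (Suc i, Suc j) \<and> (i, j) \<in> ?D)" for p by force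
  let ?i = "\<lambda>T. \<lambda>c\<in>?s ` ?D. T (fst c - 1, snd c - 1)"
  let ?j = "\<lambda>T. \<lambda>c\<in>?D. T (?s c)"
  have "(\<Sum>T\<in>skew_ssyt l k N. \<Prod>c\<in>?s ` ?D. mvar (T c)) = (\<Sum>T\<in>tableaux (diag l) (diag k) N. \<Prod>c\<in>?D. mvar (T c))"
  proof (rule sum.reindex_bij_witness[where i = ?i and j = ?j])
    fix T assume T: "T \<in> skew_ssyt l k N"
    have TE: "T \<in> (?s ` ?D) \<rightarrow>\<^sub>E {..<N}" using T unfolding skew_ssyt_def D by blast
    have ext: "T c = undefined" if "c \<notin> ?s ` ?D" for c
      by (rule PiE_arb[OF TE that])
    show "?i (?j T) = T"
    proof
      fix c show "?i (?j T) c = T c"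
      proof (cases "c \<in> ?s ` ?D")
        case True
        then obtain i j where "c = (Suc i, Suc j)" "(i, j) \<in> ?D" unfolding memE by blast
        thus ?thesis using True by simp
      qed (simp add: ext)
    qed
    show "?j T \<in> tableaux (diag l) (diag k) N"
    proof -
      have "T (Suc i, Suc j) < N" if "(i, j) \<in> ?D" for i j
        using PiE_mem[OF TE mem[THEN iffD2, OF that]] by simp
      moreover have "T (Suc i, Suc j) \<le> T (Suc i, Suc j')" if "(i, j) \<in> ?D" "(i, j') \<in> ?D" "j < j'" for i j j'
        using T mem[of i j] mem[of i j'] that unfolding skew_ssyt_def D by blast
      moreover have "T (Suc i, Suc j) < T (Suc i', Suc j)" if "(i, j) \<in> ?D" "(i', j) \<in> ?D" "i < i'" for i i' j
        using T mem[of i j] mem[of i' j] that unfolding skew_ssyt_def D by blast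
      ultimately show ?thesis unfolding tableaux_def by auto
    qed
    show "(\<Prod>c\<in>?D. mvar (?j T c)) = (\<Prod>c\<in>?s ` ?D. mvar (T c))"
      using inj by (simp add: prod.reindex inj_on_subset[OF inj])
  next
    fix T assume T: "T \<in> tableaux (diag l) (diag k) N"
    have TE: "T \<in> ?D \<rightarrow>\<^sub>E {..<N}" using T unfolding tableaux_def by blast
    have ext: "T c = undefined" if "c \<notin> ?D" for c
      by (rule PiE_arb[OF TE that])
    show "?j (?i T) = T"
    proof
      fix c show "?j (?i T) c = T c"
      proof (cases "c \<in> ?D")
        case True
        thus ?thesis by (cases c) (auto simp: mem)
      next
        case False
        show ?thesis unfolding restrict_apply[of _ _ c] ext[OF False] using False by (simp only: if_False)
      qed
    qed
    show "?i T \<in> skew_ssyt l k N"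
    proof -
      have "T (i, j) < N" if "(i, j) \<in> ?D" for i j
        using PiE_mem[OF TE that] by simp
      moreover have "T (i, j) \<le> T (i, j')" if "(i, j) \<in> ?D" "(i, j') \<in> ?D" "j < j'" for i j j'
        using T that unfolding tableaux_def by blast
      moreover have "T (i, j) < T (i', j)" if "(i, j) \<in> ?D" "(i', j) \<in> ?D" "i < i'" for i i' j
        using T that unfolding tableaux_def by blast
      ultimately show ?thesis unfolding skew_ssyt_def D
        by (auto simp: memE mem)
    qed
  qed
  thus ?thesis using True D k l by (simp add: skew_schur_def skew_def boxes_subset_iff)
next
  case False
  thus ?thesis using k l by (simp add: skew_schur_def skew_def boxes_subset_iff)
qed


lemma skew_0: "skew x 0 m l = (if m = l then 1 else 0)"
proof (cases "l \<le> m")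
  case True
  show ?thesis
  proof (cases "m = l")
    case True
    hence "tableaux m l 0 = {\<lambda>_. undefined}" by (auto simp: tableaux_def)
    thus ?thesis using True by (simp add: skew_def)
  next
    case False
    hence "cells m - cells l \<noteq> {}" using True cells_subset_iff[of m l] by auto
    hence "tableaux m l 0 = {}" unfolding tableaux_def by auto
    thus ?thesis using False by (simp add: skew_def)
  qed
qed (auto simp: skew_def)

text \<open>The entries smaller than \<open>N\<close> of a tableau fill a smaller skew shape, and the entries equal to \<open>N\<close>
  fill a horizontal strip.\<close>

lemma skew_Suc:
  "skew x (Suc N) m l = (\<Sum>k | l \<le> k \<and> hstrip k m. x N ^ (dsize m - dsize k) * skew x N k l)"
proof (cases "l \<le> m")
  case False
  hence "{k. l \<le> k \<and> hstrip k m} = {}" using hstrip_le by (auto dest: order_trans)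
  thus ?thesis using False by (simp only: skew_def if_False sum.empty)
next
  case lm: True
  define KS where "KS = {k. l \<le> k \<and> hstrip k m}"
  have fin: "finite KS"
    unfolding KS_def by (rule finite_subset[OF _ finite_below[of m]]) (auto dest: hstrip_le)
  define D where "D k = cells k - cells l" for k
  define K where "K T = Diagram (\<lambda>i. card {j. j < row m i \<and> (j < row l i \<or> T (i, j) < N)})" for T :: "nat \<times> nat \<Rightarrow> nat"
  have tabD: "T \<in> tableaux k l n \<longleftrightarrow> T \<in> D k \<rightarrow>\<^sub>E {..<n} \<and>
     (\<forall>i j j'. (i, j) \<in> D k \<longrightarrow> (i, j') \<in> D k \<longrightarrow> j < j' \<longrightarrow> T (i, j) \<le> T (i, j')) \<and>
     (\<forall>i i' j. (i, j) \<in> D k \<longrightarrow> (i', j) \<in> D k \<longrightarrow> i < i' \<longrightarrow> T (i, j) < T (i', j))" for T k n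
    unfolding tableaux_def D_def by simp
  have memD: "(i, j) \<in> D k \<longleftrightarrow> j < row k i \<and> \<not> j < row l i" for i j k
    by (simp add: D_def mem_cells)
  have K: "(\<forall>i j. j < row (K T) i \<longleftrightarrow> j < row m i \<and> (j < row l i \<or> T (i, j) < N)) \<and> K T \<in> KS"
    if T: "T \<in> tableaux m l (Suc N)" for T
  proof -
    define A where "A i = {j. j < row m i \<and> (j < row l i \<or> T (i, j) < N)}" for i
    have TN: "T c \<le> N" if "c \<in> D m" for c
      using T that PiE_mem[of T "D m" "\<lambda>_. {..<Suc N}" c] unfolding tabD by simp
    \<comment> \<open>An entry that has a box below it is smaller than that box's entry, hence
      smaller than \<open>N\<close>. So the boxes with entry \<open>N\<close> form a horizontal
      strip.\<close>
    have Amono: "j \<in> A i" if j: "j < row m (Suc i)" for i j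
    proof (cases "j < row l i")
      case True
      thus ?thesis using j row_antimono[of i "Suc i" m] by (simp add: A_def)
    next
      case False
      hence *: "(i, j) \<in> D m" "(Suc i, j) \<in> D m"
        using j row_antimono[of i "Suc i" m] row_antimono[of i "Suc i" l] by (auto simp: memD)
      hence "T (i, j) < T (Suc i, j)" using T unfolding tabD by blast
      also have "\<dots> \<le> N" using TN *(2) .
      finally show ?thesis using * by (simp add: A_def memD)
    qed
    have Adown: "j' \<in> A i" if "j \<in> A i" "j' < j" for i j j'
    proof (cases "j' < row l i")
      case False
      hence *: "(i, j') \<in> D m" "(i, j) \<in> D m" "T (i, j) < N" using that by (auto simp: A_def memD)
      hence "T (i, j') \<le> T (i, j)" using T that(2) unfolding tabD by blast
      thus ?thesis using * by (simp add: A_def memD)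
    qed (use that in \<open>auto simp: A_def\<close>)
    have finA: "finite (A i)" for i by (rule finite_subset[of _ "{..<row m i}"]) (auto simp: A_def)
    have card_A: "A i = {..<card (A i)}" for i
    proof -
      have "\<exists>n. A i = {..<n}"
      proof (cases "A i = {}")
        case True
        hence "A i = {..<0}" by simp
        thus ?thesis by (rule exI)
      next
        case False
        have "A i = {..<Suc (Max (A i))}"
        proof (rule set_eqI)
          fix j
          show "j \<in> A i \<longleftrightarrow> j \<in> {..<Suc (Max (A i))}"
            using Max_in[OF finA False] Max_ge[OF finA, of j i] Adown[of "Max (A i)" i j]
            unfolding lessThan_iff less_Suc_eq_le le_less by blast
        qed
        thus ?thesis by (rule exI)
      qed
      then obtain n where "A i = {..<n}" ..
      thus ?thesis by simp
    qed
    have rK: "row (K T) = (\<lambda>i. card (A i))"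
      unfolding K_def A_def[symmetric]
    proof (rule row_Diagram)
      have sub: "A (Suc i) \<subseteq> A i" for i
      proof
        fix j assume "j \<in> A (Suc i)"
        hence "j < row m (Suc i)" by (simp add: A_def)
        thus "j \<in> A i" by (rule Amono)
      qed
      show "antimono (\<lambda>i. card (A i))"
        unfolding antimono_iff_le_Suc by (intro allI card_mono finA sub)
      have "row m (nrows m) = 0" by (simp add: row_eq_0_iff)
      thus "card (A (nrows m)) = 0" by (simp add: A_def)
    qed
    have 1: "j < row (K T) i \<longleftrightarrow> j \<in> A i" for i j
      unfolding rK by (subst card_A[of i]) simp
    have "l \<le> K T" unfolding cells_subset_iff[symmetric]
      using row_mono[OF lm] by (auto simp: cells_def 1 A_def dest: order.strict_trans2)
    moreover have "hstrip (K T) m" unfolding hstrip_cells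
    proof
      show "K T \<le> m" unfolding cells_subset_iff[symmetric] by (auto simp: cells_def 1 A_def)
      show "\<forall>i j. j < row m (Suc i) \<longrightarrow> j < row (K T) i" using Amono by (simp add: 1)
    qed
    ultimately show ?thesis using 1 by (simp add: KS_def A_def)
  qed
  \<comment> \<open>The inverse map fills the outer strip with \<open>N\<close>. Both directions
    restrict explicitly, as tableaux are extensional functions.\<close>
  define ext where "ext k T = (\<lambda>c\<in>D m. if c \<in> cells k then T c else N)" for k and T :: "nat \<times> nat \<Rightarrow> nat"
  have extD: "ext k T (i, j) = (if j < row k i then T (i, j) else N)" if "(i, j) \<in> D m" for k T i j
    using that by (simp add: ext_def mem_cells)
  have ext_tab: "ext k T \<in> tableaux m l (Suc N)" and K_ext: "K (ext k T) = k" and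
    restr_ext: "restrict (ext k T) (D k) = T"
    if k: "k \<in> KS" and T: "T \<in> tableaux k l N" for k T
  proof -
    have km: "k \<le> m" and h: "\<And>i j. j < row m (Suc i) \<Longrightarrow> j < row k i" and lk: "l \<le> k"
      using k by (auto simp: KS_def hstrip_cells)
    have TE: "T \<in> D k \<rightarrow>\<^sub>E {..<N}" using T by (simp add: tabD)
    have TN: "T c < N" if "c \<in> D k" for c using PiE_mem[OF TE that] by simp
    have Dk: "(i, j) \<in> D k" if "(i, j) \<in> D m" "j < row k i" for i j using that by (simp add: memD)
    show tab: "ext k T \<in> tableaux m l (Suc N)" unfolding tabD
    proof (intro conjI allI impI)
      show "ext k T \<in> D m \<rightarrow>\<^sub>E {..<Suc N}"
      proof (rule PiE_I)
        fix c assume c: "c \<in> D m"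
        obtain i j where ij: "c = (i, j)" by (cases c)
        show "ext k T c \<in> {..<Suc N}"
          using TN[OF Dk, of i j] c unfolding ij by (auto simp: extD)
      qed (simp add: ext_def)
    next
      fix i j j' assume *: "(i, j) \<in> D m" "(i, j') \<in> D m" "j < j'"
      show "ext k T (i, j) \<le> ext k T (i, j')"
      proof (cases "j' < row k i")
        case True
        hence "(i, j) \<in> D k" "(i, j') \<in> D k" using * by (auto intro!: Dk)
        hence "T (i, j) \<le> T (i, j')" using T *(3) unfolding tabD by blast
        thus ?thesis using True * by (simp add: extD)
      next
        case False
        thus ?thesis using TN[OF Dk, of i j] * by (auto simp: extD)
      qed
    next
      fix i i' j assume *: "(i, j) \<in> D m" "(i', j) \<in> D m" "i < i'"
      show "ext k T (i, j) < ext k T (i', j)"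
      proof (cases "j < row k i'")
        case True
        moreover have "j < row k i" using True row_antimono[of i i' k] *(3) by simp
        ultimately have "(i, j) \<in> D k" "(i', j) \<in> D k" "j < row k i" using * by (auto intro!: Dk)
        moreover from this have "T (i, j) < T (i', j)" using T *(3) unfolding tabD by blast
        ultimately show ?thesis using True * by (simp add: extD)
      next
        case False
        have "j < row m (Suc i)" using *(2,3) row_antimono[of "Suc i" i' m] by (simp add: memD)
        hence "j < row k i" by (rule h)
        thus ?thesis using TN[OF Dk, of i j] * False by (auto simp: extD)
      qed
    qed
    have "j < row (K (ext k T)) i \<longleftrightarrow> j < row k i" for i j
    proof -
      have "j < row (K (ext k T)) i \<longleftrightarrow> j < row m i \<and> (j < row l i \<or> ext k T (i, j) < N)"
        using K[OF tab] by blast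
      also have "\<dots> \<longleftrightarrow> j < row k i"
      proof (cases "(i, j) \<in> D m")
        case True
        thus ?thesis using TN[OF Dk, of i j] by (auto simp: extD memD)
      next
        case False
        thus ?thesis using row_mono[OF lk, of i] row_mono[OF km, of i] by (auto simp: memD)
      qed
      finally show ?thesis .
    qed
    thus "K (ext k T) = k" by (intro diagram_eqI) (meson linorder_neqE_nat less_irrefl)
    show "restrict (ext k T) (D k) = T"
    proof
      fix c :: "nat \<times> nat"
      show "restrict (ext k T) (D k) c = T c"
      proof (cases "c \<in> D k")
        case True
        obtain i j where ij: "c = (i, j)" by (cases c)
        have "(i, j) \<in> D m" "j < row k i" using True row_mono[OF km, of i] by (auto simp: ij memD)
        thus ?thesis using True by (simp add: ij extD)
      next
        case False
        thus ?thesis using PiE_arb[OF TE False] by simp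
      qed
    qed
  qed
  have "(\<Sum>T\<in>tableaux m l (Suc N). \<Prod>c\<in>D m. x (T c)) =
    (\<Sum>(k, T)\<in>Sigma KS (\<lambda>k. tableaux k l N). x N ^ (dsize m - dsize k) * (\<Prod>c\<in>D k. x (T c)))"
  proof (rule sum.reindex_bij_witness[where i = "\<lambda>(k, T). ext k T" and j = "\<lambda>T. (K T, restrict T (D (K T)))"])
    fix p assume "p \<in> Sigma KS (\<lambda>k. tableaux k l N)"
    thus "(case p of (k, T) \<Rightarrow> ext k T) \<in> tableaux m l (Suc N)"
      "(K (case p of (k, T) \<Rightarrow> ext k T), restrict (case p of (k, T) \<Rightarrow> ext k T) (D (K (case p of (k, T) \<Rightarrow> ext k T)))) = p"
      by (auto simp: ext_tab K_ext restr_ext)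
  next
    fix T assume T: "T \<in> tableaux m l (Suc N)"
    have KT: "\<And>i j. j < row (K T) i \<longleftrightarrow> j < row m i \<and> (j < row l i \<or> T (i, j) < N)" "K T \<in> KS"
      using K[OF T] by auto
    have TE: "T \<in> D m \<rightarrow>\<^sub>E {..<Suc N}" using T by (simp add: tabD)
    have DK: "(i, j) \<in> D (K T) \<longleftrightarrow> (i, j) \<in> D m \<and> T (i, j) < N" for i j by (auto simp: memD KT(1))
    have sub: "D (K T) \<subseteq> D m" using DK by auto
    show "(case (K T, restrict T (D (K T))) of (k, T) \<Rightarrow> ext k T) = T"
    proof
      fix c :: "nat \<times> nat"
      obtain i j where ij: "c = (i, j)" by (cases c)
      show "(case (K T, restrict T (D (K T))) of (k, T) \<Rightarrow> ext k T) c = T c"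
      proof (cases "c \<in> D m")
        case True
        have "T c < Suc N" using PiE_mem[OF TE True] by simp
        thus ?thesis using True DK[of i j] by (auto simp: ij extD memD)
      next
        case False
        thus ?thesis using PiE_arb[OF TE False] by (simp add: ext_def)
      qed
    qed
    show "(K T, restrict T (D (K T))) \<in> Sigma KS (\<lambda>k. tableaux k l N)"
    proof -
      have "restrict T (D (K T)) \<in> tableaux (K T) l N" unfolding tabD
      proof (intro conjI allI impI)
        show "restrict T (D (K T)) \<in> D (K T) \<rightarrow>\<^sub>E {..<N}" using DK by auto
        fix i j j' assume *: "(i, j) \<in> D (K T)" "(i, j') \<in> D (K T)" "j < j'"
        hence "T (i, j) \<le> T (i, j')" using T sub unfolding tabD by blast
        thus "restrict T (D (K T)) (i, j) \<le> restrict T (D (K T)) (i, j')" using * by simp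
      next
        fix i i' j assume *: "(i, j) \<in> D (K T)" "(i', j) \<in> D (K T)" "i < i'"
        hence "T (i, j) < T (i', j)" using T sub unfolding tabD by blast
        thus "restrict T (D (K T)) (i, j) < restrict T (D (K T)) (i', j)" using * by simp
      qed
      thus ?thesis using KT(2) by simp
    qed
    have Tc: "x (T c) = x N" if c: "c \<in> D m - D (K T)" for c
    proof -
      obtain i j where ij: "c = (i, j)" by (cases c)
      have "T c < Suc N" using PiE_mem[OF TE] c by auto
      moreover have "\<not> T c < N" using c DK[of i j] by (auto simp: ij)
      ultimately have "T c = N" by simp
      thus ?thesis by simp
    qed
    have le: "K T \<le> m" "l \<le> K T" using KT(2) by (auto simp: KS_def hstrip_le)
    have fD: "finite (D m)" by (simp add: D_def finite_cells)
    have "D m - D (K T) = cells m - cells (K T)"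
      using le by (auto simp: D_def simp flip: cells_subset_iff)
    hence "card (D m - D (K T)) = dsize m - dsize (K T)"
      using le by (simp add: card_Diff_subset finite_cells card_cells cells_subset_iff)
    moreover have "(\<Prod>c\<in>D m. x (T c)) = (\<Prod>c\<in>D m - D (K T). x (T c)) * (\<Prod>c\<in>D (K T). x (T c))"
      by (rule prod.subset_diff[OF sub fD])
    ultimately show "(case (K T, restrict T (D (K T))) of (k, T) \<Rightarrow>
        x N ^ (dsize m - dsize k) * (\<Prod>c\<in>D k. x (T c))) = (\<Prod>c\<in>D m. x (T c))"
      using prod.cong[OF refl Tc, of "D m - D (K T)" "\<lambda>c. c"] by simp
  qed
  also have "\<dots> = (\<Sum>k\<in>KS. \<Sum>T\<in>tableaux k l N. x N ^ (dsize m - dsize k) * (\<Prod>c\<in>D k. x (T c)))"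
    by (rule sum.Sigma[symmetric]) (simp_all add: fin finite_tableaux)
  also have "\<dots> = (\<Sum>k\<in>KS. x N ^ (dsize m - dsize k) * skew x N k l)"
    by (intro sum.cong refl) (simp add: KS_def skew_def D_def sum_distrib_left)
  finally show ?thesis using lm by (simp add: skew_def D_def KS_def)
qed

text \<open>Both sides obey the same branching rule in the last variable. The relations between
  strip operators thereby become identities between skew Schur polynomials.\<close>

lemma Hmat_eq_skew: "Hmat x N m l = skew x N m l"
proof (induction N arbitrary: m l)
  case 0
  show ?case by (simp add: Hmat_def id_mat_def skew_0)
next
  case (Suc N)
  have "Hmat x (Suc N) m l = fsum (\<lambda>k. hmat (x N) m k * skew x N k l)"
    using Suc by (simp add: Hmat_def mmult_def)
  also have "\<dots> = (\<Sum>k | l \<le> k \<and> hstrip k m. hmat (x N) m k * skew x N k l)"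
  proof (rule fsum_finite)
    show "finite {k. l \<le> k \<and> hstrip k m}"
      by (rule finite_subset[OF _ finite_below[of m]]) (auto dest: hstrip_le)
  qed (auto simp: hmat_def skew_def)
  also have "\<dots> = skew x (Suc N) m l" by (simp add: skew_Suc hmat_def)
  finally show ?case .
qed

lemma mpoly_eval_skew: "mpoly_eval (skew w N m l) x = skew (\<lambda>i. mpoly_eval (w i) x) N m l"
  by (simp add: skew_def mpoly_eval_sum mpoly_eval_prod)

definition const2 :: "'r::comm_ring_1 \<Rightarrow> 'r fps fps" where
  "const2 c = fps_const (fps_const c)"

lemma const2_0 [simp]: "const2 0 = 0" and const2_1 [simp]: "const2 1 = 1"
  and const2_add: "const2 (a + b) = const2 a + const2 b"
  and const2_mult: "const2 (a * b) = const2 a * const2 b"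
  by (simp_all add: const2_def)

lemma const2_sum: "const2 (sum f A) = (\<Sum>i\<in>A. const2 (f i))"
  by (induction A rule: infinite_finite_induct) (auto simp: const2_add)

lemma const2_prod: "const2 (prod f A) = (\<Prod>i\<in>A. const2 (f i))"
  by (induction A rule: infinite_finite_induct) (auto simp: const2_mult)

lemma skew_const2: "skew (\<lambda>i. const2 (x i)) N m l = const2 (skew x N m l)"
  by (simp add: skew_def const2_sum const2_prod)

lemma esym_const2: "esym k N (\<lambda>i. const2 (x i)) = const2 (esym k N x)"
  by (simp add: esym_def const2_sum const2_prod)

lemma const2_X_nth: "(const2 c * fps_X ^ k) $ j $ 0 = (if j = k then c else 0)"
  by (simp add: const2_def fps_mult_right_const_nth fps_X_power_mult_right_nth)

text \<open>Compares the coefficients of \<open>y^j\<close> in the relation between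
  \<open>Hmat\<close> and a single \<open>vmat y\<close>, with a series variable as
  \<open>y\<close>. For empty \<open>l\<close> this is the classical Pieri rule for the product of a
  Schur polynomial with an elementary one.\<close>

lemma skew_pieri:
  "(\<Sum>m | vstrip n m \<and> dsize m = dsize n + j. skew x N m l) =
   (\<Sum>t | vstrip t l. if dsize l - dsize t \<le> j then esym (j - (dsize l - dsize t)) N x * skew x N n t else 0)"
proof -
  let ?x = "\<lambda>i. const2 (x i)" and ?y = "fps_X :: 'a fps fps"
  have y: "ord_ge ?y 1" by (auto simp: ord_ge_def)
  have "commutes (Hmat ?x N) (Vmat (\<lambda>_. ?y) 1) 1 (\<Prod>i<N. \<Prod>j<(1::nat). 1 + ?x i * ?y)"
    by (rule commutes_Hmat_Vmat[of ?x "\<lambda>_. ?y" N 1]) (use y in simp)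
  hence *: "fsum (\<lambda>m. Hmat ?x N m l * vmat ?y m n) = (\<Prod>i<N. 1 + ?x i * ?y) * fsum (\<lambda>t. vmat ?y l t * Hmat ?x N n t)"
    by (simp add: commutes_def Vmat_def)
  have "fsum (\<lambda>m. Hmat ?x N m l * vmat ?y m n) $ j $ 0 =
    (\<Sum>m | vstrip n m \<and> dsize m = dsize n + j. (Hmat ?x N m l * vmat ?y m n) $ j $ 0)"
    unfolding fsum_nth
  proof (rule sum.mono_neutral_left)
    show "finite {m. vstrip n m \<and> dsize m = dsize n + j}"
      by (rule finite_subset[OF _ finite_dsize_le[of "dsize n + j"]]) auto
    have "vstrip n m \<and> dsize m = dsize n + j" if "(Hmat ?x N m l * vmat ?y m n) $ j $ 0 \<noteq> 0" for m
      using that dsize_mono[OF vstrip_le, of n m]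
      by (auto simp: Hmat_eq_skew skew_const2 vmat_def const2_X_nth split: if_splits)
    thus "{m. (Hmat ?x N m l * vmat ?y m n) $ j $ 0 \<noteq> 0} \<subseteq> {m. vstrip n m \<and> dsize m = dsize n + j}" by blast
  qed auto
  also have "\<dots> = (\<Sum>m | vstrip n m \<and> dsize m = dsize n + j. skew x N m l)"
    by (intro sum.cong refl) (simp add: Hmat_eq_skew skew_const2 vmat_def const2_X_nth)
  finally have L: "fsum (\<lambda>m. Hmat ?x N m l * vmat ?y m n) $ j $ 0 =
    (\<Sum>m | vstrip n m \<and> dsize m = dsize n + j. skew x N m l)" .
  have fin: "finite {t. vstrip t l}"
    by (rule finite_subset[OF _ finite_below[of l]]) (auto dest: vstrip_le)
  have "fsum (\<lambda>t. vmat ?y l t * Hmat ?x N n t) = (\<Sum>t | vstrip t l. vmat ?y l t * Hmat ?x N n t)"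
    by (rule fsum_finite[OF fin]) (simp add: vmat_def)
  also have "\<dots> = (\<Sum>t | vstrip t l. const2 (skew x N n t) * ?y ^ (dsize l - dsize t))"
    by (intro sum.cong refl) (simp add: vmat_def Hmat_eq_skew skew_const2 mult.commute)
  finally have "(\<Prod>i<N. 1 + ?x i * ?y) * fsum (\<lambda>t. vmat ?y l t * Hmat ?x N n t) =
    (\<Sum>k\<le>N. const2 (esym k N x) * ?y ^ k) * (\<Sum>t | vstrip t l. const2 (skew x N n t) * ?y ^ (dsize l - dsize t))"
    using prod_add_esym[where z = 1 and x = ?x and y = ?y] by (simp add: esym_const2)
  also have "\<dots> = (\<Sum>k\<le>N. \<Sum>t | vstrip t l. const2 (esym k N x * skew x N n t) * ?y ^ (k + (dsize l - dsize t)))"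
    by (simp add: sum_product const2_mult power_add mult_ac)
  finally have "((\<Prod>i<N. 1 + ?x i * ?y) * fsum (\<lambda>t. vmat ?y l t * Hmat ?x N n t)) $ j $ 0 =
    (\<Sum>k\<le>N. \<Sum>t | vstrip t l. if j = k + (dsize l - dsize t) then esym k N x * skew x N n t else 0)"
    by (simp add: fps_sum_nth const2_X_nth)
  also have "\<dots> = (\<Sum>t | vstrip t l. \<Sum>k\<le>N. if j = k + (dsize l - dsize t) then esym k N x * skew x N n t else 0)"
    by (rule sum.swap)
  also have "\<dots> = (\<Sum>t | vstrip t l. if dsize l - dsize t \<le> j then esym (j - (dsize l - dsize t)) N x * skew x N n t else 0)"
  proof (intro sum.cong refl)
    fix t
    define d where "d = dsize l - dsize t"
    show "(\<Sum>k\<le>N. if j = k + (dsize l - dsize t) then esym k N x * skew x N n t else 0) =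
      (if dsize l - dsize t \<le> j then esym (j - (dsize l - dsize t)) N x * skew x N n t else 0)"
      unfolding d_def[symmetric]
    proof (cases "d \<le> j")
      case True
      have "(\<Sum>k\<le>N. if j = k + d then esym k N x * skew x N n t else 0) =
        (\<Sum>k\<le>N. if k = j - d then esym (j - d) N x * skew x N n t else 0)"
        using True by (intro sum.cong refl) auto
      thus "(\<Sum>k\<le>N. if j = k + d then esym k N x * skew x N n t else 0) =
        (if d \<le> j then esym (j - d) N x * skew x N n t else 0)" using True by (auto simp: esym_eq_0)
    qed auto
  qed
  finally show ?thesis using L * by simp
qed

text \<open>Removing the first column of \<open>m\<close> leaves a diagram \<open>n\<close> such that \<open>m\<close> is the shape with the fewest rows
  in the Pieri rule for \<open>n\<close>; this gives a recursion for the skew Schur functions.\<close>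

lemma elem_poly_skew: "elem_poly (\<lambda>N. skew mvar N m l)"
proof -
  \<comment> \<open>Fewer boxes first, then more rows. The second component decreases because a
    diagram has at most as many rows as boxes.\<close>
  let ?R = "inv_image (less_than <*lex*> less_than) (\<lambda>m. (dsize m, dsize m - nrows m))"
  have wf: "wf ?R" by auto
  show ?thesis
  proof (induction m arbitrary: l rule: wf_induct_rule[OF wf])
    case (1 m)
    have IH: "elem_poly (\<lambda>N. skew mvar N k l)"
      if "dsize k < dsize m \<or> dsize k = dsize m \<and> dsize k - nrows k < dsize m - nrows m" for k l
      using 1[of k l] that by auto
    show ?case
    proof (cases "nrows m = 0")
      case True
      hence d0: "dsize m = 0" by (simp add: dsize_def)
      have "skew mvar N m l = of_int (if m = l then 1 else 0)" for N
      proof (cases "l \<le> m")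
        case True
        hence "m = l" using d0 dsize_mono[OF True] dsize_eq_imp_eq[OF True] by simp
        moreover have "tableaux l l N = {\<lambda>_. undefined}" by (auto simp: tableaux_def)
        ultimately show ?thesis by (simp add: skew_def)
      qed (auto simp: skew_def)
      thus ?thesis using elem_poly_const by presburger
    next
      case False
      define n where "n = Diagram (\<lambda>i. row m i - 1)"
      have rn: "row n = (\<lambda>i. row m i - 1)" unfolding n_def
      proof (rule row_Diagram)
        show "antimono (\<lambda>i. row m i - 1)"
          unfolding antimono_def by (auto intro!: diff_le_mono row_antimono)
        have "row m (nrows m) = 0" by (simp add: row_eq_0_iff)
        thus "row m (nrows m) - 1 = 0" by simp
      qed
      have v: "vstrip n m" by (auto simp: vstrip_def rn)
      have "nrows n \<le> nrows m" by (rule nrows_mono[OF vstrip_le[OF v]])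
      hence "dsize n + nrows m = (\<Sum>i<nrows m. row n i + 1)"
        unfolding sum.distrib by (subst dsize_eq_sum[of n "nrows m"]) simp_all
      also have "\<dots> = dsize m"
        unfolding dsize_def rn
      proof (intro sum.cong refl)
        fix i assume "i \<in> {..<nrows m}"
        hence "row m i \<noteq> 0" by (simp add: row_eq_0_iff)
        thus "row m i - 1 + 1 = row m i" by simp
      qed
      finally have sz: "dsize n + nrows m = dsize m" .
      define A where "A = {k. vstrip n k \<and> dsize k = dsize n + nrows m}"
      have finA: "finite A" unfolding A_def
        by (rule finite_subset[OF _ finite_dsize_le[of "dsize m"]]) (auto simp: sz)
      have mA: "m \<in> A" by (simp add: A_def v sz)
      define R where "R N = (\<Sum>t | vstrip t l. if dsize l - dsize t \<le> nrows m
         then elem_sym (nrows m - (dsize l - dsize t)) N * skew mvar N n t else 0)" for N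
      have "elem_poly R" unfolding R_def
      proof (rule elem_poly_sum)
        fix t
        have "elem_poly (\<lambda>N. elem_sym (nrows m - (dsize l - dsize t)) N * skew mvar N n t)"
          by (intro elem_poly_mult elem_poly_elem_sym IH) (use sz False in auto)
        thus "elem_poly (\<lambda>N. if dsize l - dsize t \<le> nrows m
         then elem_sym (nrows m - (dsize l - dsize t)) N * skew mvar N n t else 0)"
          using elem_poly_const[of 0] by (cases "dsize l - dsize t \<le> nrows m") simp_all
      qed
      moreover have "elem_poly (\<lambda>N. \<Sum>k\<in>A - {m}. skew mvar N k l)"
      proof (rule elem_poly_sum, rule IH)
        fix k assume k: "k \<in> A - {m}"
        hence vk: "vstrip n k" and dk: "dsize k = dsize m" by (auto simp: A_def sz)
        \<comment> \<open>A vertical strip on \<open>n\<close> within the rows of \<open>m\<close>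
          stays inside \<open>m\<close>, since \<open>m\<close> already has the extra box in each of
          these rows. Equal size would then force \<open>k = m\<close>.\<close>
        have "\<not> nrows k \<le> nrows m"
        proof
          assume le: "nrows k \<le> nrows m"
          have "row k i \<le> row m i" for i
          proof (cases "i < nrows m")
            case True
            hence "row m i \<noteq> 0" by (simp add: row_eq_0_iff)
            moreover have "row k i \<le> Suc (row n i)" using vk by (simp add: vstrip_def)
            ultimately show ?thesis by (simp add: rn)
          next
            case False
            hence "row k i = 0" using le by (simp add: row_eq_0_iff)
            thus ?thesis by simp
          qed
          hence "k \<le> m" by (simp add: less_eq_diagram_def)
          thus False using dsize_eq_imp_eq[of k m] dk k by simp
        qed
        thus "dsize k < dsize m \<or> dsize k = dsize m \<and> dsize k - nrows k < dsize m - nrows m"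
          using dk nrows_le_dsize[of k] by auto
      qed
      ultimately have "elem_poly (\<lambda>N. R N - (\<Sum>k\<in>A - {m}. skew mvar N k l))"
        by (rule elem_poly_diff)
      moreover have "R N - (\<Sum>k\<in>A - {m}. skew mvar N k l) = skew mvar N m l" for N
      proof -
        have "R N = (\<Sum>k\<in>A. skew mvar N k l)"
          unfolding R_def A_def by (subst skew_pieri) (simp add: elem_sym_eq_esym cong: if_cong)
        also have "\<dots> = skew mvar N m l + (\<Sum>k\<in>A - {m}. skew mvar N k l)"
          by (rule sum.remove[OF finA mA])
        finally show ?thesis by simp
      qed
      ultimately show ?thesis by simp
    qed
  qed
qed

lemma specialize_skew_schur:
  assumes "is_partition k" "is_partition l" "\<And>n. E $ Suc n = esym (Suc n) N x"
  shows "specialize (skew_schur l k) E = skew x N (diag l) (diag k)"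
proof -
  have "skew_schur l k = (\<lambda>N. skew mvar N (diag l) (diag k))"
    using assms by (intro ext skew_schur_eq_skew)
  hence "specialize (skew_schur l k) E = mpoly_eval (skew_schur l k N) x"
    using assms(3) by (intro specialize_finite) (simp_all add: elem_poly_skew)
  thus ?thesis using assms by (simp add: skew_schur_eq_skew mpoly_eval_skew)
qed

section \<open>Finite alphabets and the hook product\<close>

text \<open>The finite q-binomial theorem, by the q-Pascal recursion \<open>rec\<close>. At this
  value of e^(-t) the numerator contains the factor 0 as soon as \<open>n\<close> exceeds
  \<open>N\<close>, so the series terminates.\<close>

lemma q_binomial:
  fixes q :: "'a::field"
  assumes q0: "q \<noteq> 0" and q: "\<And>n. n > 0 \<Longrightarrow> q ^ n \<noteq> 1"
  shows "Abs_fps (\<lambda>n. \<Prod>i = 1..n. (1 - q powi (- int N) * q ^ (i - 1)) / (q ^ i - 1)) =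
    (\<Prod>i<N. 1 + fps_const (q powi (- int i - 1)) * fps_X)"
proof (induction N)
  case 0
  show ?case
  proof (rule fps_ext)
    fix n
    have "(\<Prod>i = 1..n. (1 - q powi (- int 0) * q ^ (i - 1)) / (q ^ i - 1)) = 0" if "n > 0"
      using that by (intro prod_zero) (auto intro!: bexI[of _ 1])
    thus "Abs_fps (\<lambda>n. \<Prod>i = 1..n. (1 - q powi (- int 0) * q ^ (i - 1)) / (q ^ i - 1)) $ n =
      (\<Prod>i<0. 1 + fps_const (q powi (- int i - 1)) * fps_X) $ n"
      by (cases n) auto
  qed
next
  case (Suc N)
  define c where "c M n = (\<Prod>i = 1..n. (1 - q powi (- int M) * q ^ (i - 1)) / (q ^ i - 1))" for M n
  define w where "w = q powi (- int N - 1)"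
  have v: "q powi (- int (Suc N)) = w" "q powi (- int N) = q * w"
  proof -
    show "q powi (- int (Suc N)) = w" unfolding w_def by (rule arg_cong[where f = "\<lambda>k. q powi k"]) simp
    have "q powi (1 + (- int N - 1)) = q powi 1 * q powi (- int N - 1)"
      by (rule power_int_add) (simp add: q0)
    thus "q powi (- int N) = q * w" by (simp add: w_def)
  qed
  have step: "c (Suc N) (Suc n) = (1 - w) * c N n / (q ^ Suc n - 1)" for n
  proof -
    define P where "P = (\<Prod>i=1..n. q ^ i - 1)"
    have P: "P \<noteq> 0" using q by (auto simp: P_def)
    have "c (Suc N) (Suc n) = (\<Prod>i<Suc n. 1 - w * q ^ i) / (P * (q ^ Suc n - 1))"
      unfolding c_def v prod_dividef P_def
      by (simp add: prod.atLeast1_atMost_eq atLeast0LessThan)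
    also have "(\<Prod>i<Suc n. 1 - w * q ^ i) = (1 - w) * (\<Prod>i<n. 1 - q * w * q ^ i)"
      unfolding prod.lessThan_Suc_shift by (simp add: mult_ac)
    also have "(\<Prod>i<n. 1 - q * w * q ^ i) = c N n * P"
    proof -
      have "c N n = (\<Prod>i<n. 1 - q * w * q ^ i) / P"
        unfolding c_def v prod_dividef P_def by (simp add: prod.atLeast1_atMost_eq atLeast0LessThan)
      thus ?thesis using P by simp
    qed
    also have "(1 - w) * (c N n * P) / (P * (q ^ Suc n - 1)) = (1 - w) * c N n / (q ^ Suc n - 1)"
      using P by (simp add: mult_ac)
    finally show ?thesis .
  qed
  have step': "c N (Suc n) = c N n * ((1 - q * w * q ^ n) / (q ^ Suc n - 1))" for n
    by (simp add: c_def v)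
  have rec: "c (Suc N) (Suc n) = c N (Suc n) + w * c N n" for n
  proof -
    have "q ^ Suc n - 1 \<noteq> 0" using q[of "Suc n"] by simp
    hence "c N (Suc n) + w * c N n = c N n * ((1 - q * w * q ^ n) + w * (q ^ Suc n - 1)) / (q ^ Suc n - 1)"
      unfolding step' by (simp add: field_simps)
    also have "(1 - q * w * q ^ n) + w * (q ^ Suc n - 1) = 1 - w" by (simp add: algebra_simps)
    finally show ?thesis unfolding step by simp
  qed
  have "Abs_fps (c (Suc N)) = Abs_fps (c N) * (1 + fps_const w * fps_X)"
  proof (rule fps_ext)
    fix n
    show "Abs_fps (c (Suc N)) $ n = (Abs_fps (c N) * (1 + fps_const w * fps_X)) $ n"
    proof (cases n)
      case 0
      thus ?thesis by (simp add: c_def)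
    next
      case (Suc m)
      have "(Abs_fps (c N) * (1 + fps_const w * fps_X)) $ Suc m =
        c N (Suc m) + (fps_const w * (Abs_fps (c N) * fps_X)) $ Suc m"
        by (simp add: distrib_left mult_ac)
      also have "\<dots> = c N (Suc m) + w * c N m" by simp
      finally show ?thesis using Suc rec by simp
    qed
  qed
  thus ?case using Suc unfolding c_def w_def by (simp add: mult_ac)
qed

text \<open>The exponents \<mu>_i - i are the positions of the Maya diagram of the partition; the
  \<open>- 1\<close> comes from counting rows from 0.\<close>

definition maya :: "'a::field \<Rightarrow> diagram \<Rightarrow> nat \<Rightarrow> 'a" where
  "maya q d i = q powi (int (row d i) - int i - 1)"

text \<open>\<open>q\<close> and \<open>v\<close> are independent arguments, so that
  \<open>v\<close> can run through q^(-N) and be treated as a polynomial variable while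
  \<open>q\<close> stays fixed.\<close>

definition E_ser :: "'a::field \<Rightarrow> 'a \<Rightarrow> nat list \<Rightarrow> 'a fps" where
  "E_ser q v \<mu> = (\<Prod>i = 1..length \<mu>. (1 + fps_const (q powi (int (part \<mu> i) - int i)) * fps_X) /
                          (1 + fps_const (q powi (- int i)) * fps_X)) *
     Abs_fps (\<lambda>n. \<Prod>i = 1..n. (1 - v * q ^ (i - 1)) / (q ^ i - 1))"

lemma E_series_eq: "E_series qh eh \<mu> = E_ser (qh\<^sup>2) (inverse (eh\<^sup>2)) \<mu>"
  by (simp add: E_series_def E_ser_def Let_def)

text \<open>The denominators cancel the first \<open>length \<mu>\<close> factors of the q-binomial
  product. The remaining factors already have the right form, because the corresponding parts of
  \<mu> are 0.\<close>

lemma E_ser_finite: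
  fixes q :: "'a::field"
  assumes q0: "q \<noteq> 0" and q: "\<And>n. n > 0 \<Longrightarrow> q ^ n \<noteq> 1"
    and \<mu>: "is_partition \<mu>" and N: "length \<mu> \<le> N"
  shows "E_ser q (q powi (- int N)) \<mu> = (\<Prod>i<N. 1 + fps_const (maya q (diag \<mu>) i) * fps_X)"
proof -
  define A where "A i = 1 + fps_const (maya q (diag \<mu>) i) * fps_X" for i
  define B where "B i = 1 + fps_const (q powi (- int i - 1)) * fps_X" for i
  have AB: "A i / B i * B i = A i" for i
  proof -
    have "is_unit (B i)" by (simp add: B_def fps_is_unit_iff)
    thus ?thesis by simp
  qed
  have 1: "(\<Prod>i = 1..length \<mu>. (1 + fps_const (q powi (int (part \<mu> i) - int i)) * fps_X) /
      (1 + fps_const (q powi (- int i)) * fps_X)) = (\<Prod>i<length \<mu>. A i / B i)"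
  proof -
    have "- int (Suc i) = - int i - 1" "int k - int (Suc i) = int k - int i - 1" for i k by simp_all
    thus ?thesis unfolding One_nat_def prod.atLeast1_atMost_eq A_def B_def maya_def
      by (simp only: row_diag_part[OF \<mu>])
  qed
  have 2: "Abs_fps (\<lambda>n. \<Prod>i = 1..n. (1 - q powi (- int N) * q ^ (i - 1)) / (q ^ i - 1)) = (\<Prod>i<N. B i)"
    unfolding B_def by (rule q_binomial[OF q0 q])
  have "E_ser q (q powi (- int N)) \<mu> = (\<Prod>i<length \<mu>. A i / B i) * (\<Prod>i<N. B i)"
    by (simp only: E_ser_def 1 2)
  also have "(\<Prod>i<N. B i) = (\<Prod>i<length \<mu>. B i) * (\<Prod>i=length \<mu>..<N. B i)"
    using N by (simp add: atLeast0LessThan[symmetric] prod.atLeastLessThan_concat del: atLeast0LessThan)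
  also have "(\<Prod>i=length \<mu>..<N. B i) = (\<Prod>i=length \<mu>..<N. A i)"
    by (intro prod.cong refl) (simp add: A_def B_def maya_def row_diag[OF \<mu>])
  also have "(\<Prod>i<length \<mu>. A i / B i) * ((\<Prod>i<length \<mu>. B i) * (\<Prod>i=length \<mu>..<N. A i)) =
     (\<Prod>i<length \<mu>. A i) * (\<Prod>i=length \<mu>..<N. A i)"
    by (simp add: mult.assoc[symmetric] prod.distrib[symmetric] AB)
  also have "\<dots> = (\<Prod>i<N. A i)"
    using N by (simp add: atLeast0LessThan[symmetric] prod.atLeastLessThan_concat del: atLeast0LessThan)
  finally show ?thesis by (simp add: A_def)
qed

lemma esym_fps_const: "esym k N (\<lambda>i. fps_const (x i)) = fps_const (esym k N x :: 'a::comm_ring_1)"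
proof -
  have s: "(\<Sum>i\<in>A. fps_const (f i)) = fps_const (sum f A)" for f :: "_ \<Rightarrow> 'a" and A
    by (induction A rule: infinite_finite_induct) auto
  have p: "(\<Prod>i\<in>A. fps_const (f i)) = fps_const (prod f A)" for f :: "_ \<Rightarrow> 'a" and A
    by (induction A rule: infinite_finite_induct) auto
  show ?thesis by (simp add: esym_def s p)
qed

lemma prod_linear_nth: "(\<Prod>i<N. 1 + fps_const (x i) * fps_X) $ n = esym n N (x :: nat \<Rightarrow> 'a::comm_ring_1)"
proof -
  have "(\<Prod>i<N. 1 + fps_const (x i) * fps_X) = (\<Sum>k\<le>N. fps_const (esym k N x) * fps_X ^ k)"
    using prod_add_esym[where z = 1 and x = "\<lambda>i. fps_const (x i)" and y = fps_X]
    by (simp add: esym_fps_const)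
  hence "(\<Prod>i<N. 1 + fps_const (x i) * fps_X) $ n = (\<Sum>k\<le>N. if n = k then esym n N x else 0)"
    by (simp add: fps_sum_nth fps_X_power_mult_right_nth if_distrib cong: if_cong sum.cong)
  thus ?thesis by (auto simp: esym_eq_0)
qed

lemma specialize_E_ser:
  fixes q :: "'a::field"
  assumes "q \<noteq> 0" "\<And>n. n > 0 \<Longrightarrow> q ^ n \<noteq> 1" "is_partition \<mu>" "length \<mu> \<le> N" "is_partition k" "is_partition l"
  shows "specialize (skew_schur l k) (E_ser q (q powi (- int N)) \<mu>) = skew (maya q (diag \<mu>)) N (diag l) (diag k)"
  by (rule specialize_skew_schur) (use assms in \<open>simp_all add: E_ser_finite prod_linear_nth\<close>)

text \<open>The numbers \<open>s i\<close> and \<open>r j\<close> of the proof together are the integers from \<open>-N\<close> to \<open>N - 1\<close>, and \<open>s i - r j\<close>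
  is positive exactly if \<open>(i, j)\<close> is a box. So the factors of a row, completed by the differences of two
  numbers \<open>s\<close>, run over an interval; these differences cancel.\<close>

lemma hook_product:
  fixes f :: "int \<Rightarrow> 'b::idom"
  assumes f0: "\<And>k. f k \<noteq> 0" and N: "nrows d \<le> N" "nrows (mirror d) \<le> N"
  defines "h \<equiv> \<lambda>i j. int (row d i) + int (row (mirror d) j) - int i - int j - 1"
  shows "(\<Prod>i<N. \<Prod>j<N. f (h i j)) * (\<Prod>(i, j)\<in>cells d. f (int j - int i - int N) * f (int i - int j - int N)) =
    (\<Prod>i<N. \<Prod>j<N. f (- int i - int j - 1)) * (\<Prod>(i, j)\<in>cells d. f (h i j) * f (- h i j))"
proof -
  define s where "s i = int (row d i) - int i - 1" for i
  define r where "r j = int j - int (row (mirror d) j)" for j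
  have h: "h i j = s i - r j" for i j by (simp add: h_def s_def r_def)
  have rowN: "row d i \<le> N" for i
    using less_row_mirror_iff[of i d N] row_eq_0_iff[of "mirror d" N] N(2) by (simp add: not_less)
  have rowtrN: "row (mirror d) j \<le> N" for j
    using less_row_mirror_iff[of N d j] row_eq_0_iff[of d N] N(1) by (simp add: not_less)
  have cell_pos: "r j < s i" if "j < row d i" for i j
    using that less_row_mirror_iff[of i d j] by (simp add: s_def r_def)
  have cell_neg: "s i < r j" if "\<not> j < row d i" for i j
    using that less_row_mirror_iff[of i d j] by (simp add: s_def r_def)
  have sdec: "s k < s i" if "i < k" for i k
    using row_antimono[of i k d] that by (simp add: s_def)
  have rinc: "r k < r j" if "k < j" for j k
    using row_antimono[of k j "mirror d"] that by (simp add: r_def)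
  have inj_s: "inj_on s A" for A
    by (rule inj_onI) (metis less_irrefl linorder_neqE_nat sdec)
  have inj_r: "inj_on r A" for A
    by (rule inj_onI) (metis less_irrefl linorder_neqE_nat rinc)
  have rs: "r j \<noteq> s i" for i j using cell_pos[of j i] cell_neg[of j i] by fastforce
  have disj: "r ` A \<inter> s ` B = {}" for A B using rs by auto

  \<comment> \<open>With the sign reversed, \<open>g\<close> is applied to positive arguments only:
    upward and downward distances between the positions \<open>s\<close> and
    \<open>r\<close>.\<close>
  define g where "g t = f (- t)" for t
  have g0: "g t \<noteq> 0" for t by (simp add: g_def f0)
  define G where "G n = (\<Prod>u<n. g (int u + 1))" for n :: nat
  have G_add: "G (m + n) = G m * (\<Prod>u<n. g (int m + int u + 1))" for m n
    by (induction n) (simp_all add: G_def mult_ac)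
  have G0: "G n \<noteq> 0" for n by (simp add: G_def g0)

  define a where "a i = (\<Prod>j\<in>{row d i..<N}. g (r j - s i))" for i
  define b where "b i = (\<Prod>j<row d i. g (s i - r j))" for i
  \<comment> \<open>The positions above \<open>s i\<close> and below \<open>N\<close> are the
    \<open>r j\<close> with \<open>j\<close> outside row \<open>i\<close> and the \<open>s k\<close>
    with \<open>k < i\<close>. Inclusion and equal cardinality show this.\<close>
  have A: "a i * (\<Prod>k<i. g (s k - s i)) = G (N + i - row d i)" if i: "i < N" for i
  proof -
    let ?T = "{s i<..<int N}"
    have "r ` {row d i..<N} \<union> s ` {..<i} \<subseteq> ?T"
    proof safe
      fix j assume "j \<in> {row d i..<N}"
      thus "r j \<in> ?T" using cell_neg[of j i] by (auto simp: r_def)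
    next
      fix k assume k: "k < i"
      have "s k < int N" using rowN[of k] by (simp add: s_def)
      thus "s k \<in> ?T" using sdec[OF k] by simp
    qed
    moreover have "card (r ` {row d i..<N} \<union> s ` {..<i}) = card ?T"
      using rowN[of i] by (simp add: card_Un_disjoint disj card_image inj_r inj_s) (simp add: s_def)
    ultimately have eq: "r ` {row d i..<N} \<union> s ` {..<i} = ?T" by (intro card_subset_eq) auto
    have "a i * (\<Prod>k<i. g (s k - s i)) = (\<Prod>t\<in>r ` {row d i..<N} \<union> s ` {..<i}. g (t - s i))"
      by (simp add: prod.union_disjoint disj prod.reindex inj_r inj_s a_def)
    also have "\<dots> = (\<Prod>u<N + i - row d i. g (int u + 1))"
      unfolding eq
      by (rule prod.reindex_bij_witness[where i = "\<lambda>u. s i + 1 + int u" and j = "\<lambda>t. nat (t - s i - 1)"])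
        (use rowN[of i] in \<open>auto simp: s_def intro!: arg_cong[where f = g]\<close>)
    finally show ?thesis by (simp add: G_def)
  qed
  have B: "b i * (\<Prod>k\<in>{i<..<N}. g (s i - s k)) = G (N - 1 - i + row d i)" if i: "i < N" for i
  proof -
    let ?T = "{- int N..<s i}"
    have "r ` {..<row d i} \<union> s ` {i<..<N} \<subseteq> ?T"
    proof safe
      fix j assume "j < row d i"
      thus "r j \<in> ?T" using cell_pos[of j i] rowtrN[of j] by (auto simp: r_def)
    next
      fix k assume k: "k \<in> {i<..<N}"
      thus "s k \<in> ?T" using sdec[of i k] by (auto simp: s_def)
    qed
    moreover have "card (r ` {..<row d i} \<union> s ` {i<..<N}) = card ?T"
      using i by (simp add: card_Un_disjoint disj card_image inj_r inj_s) (simp add: s_def)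
    ultimately have eq: "r ` {..<row d i} \<union> s ` {i<..<N} = ?T" by (intro card_subset_eq) auto
    have "b i * (\<Prod>k\<in>{i<..<N}. g (s i - s k)) = (\<Prod>t\<in>r ` {..<row d i} \<union> s ` {i<..<N}. g (s i - t))"
      by (simp add: prod.union_disjoint disj prod.reindex inj_r inj_s b_def)
    also have "\<dots> = (\<Prod>u<N - 1 - i + row d i. g (int u + 1))"
      unfolding eq
      by (rule prod.reindex_bij_witness[where i = "\<lambda>u. s i - 1 - int u" and j = "\<lambda>t. nat (s i - t - 1)"])
        (use i in \<open>auto simp: s_def intro!: arg_cong[where f = g]\<close>)
    finally show ?thesis by (simp add: G_def)
  qed
  \<comment> \<open>Each pair \<open>k < i\<close> is counted once looking up from
    \<open>s i\<close> and once looking down from \<open>s k\<close>, so the same product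
    \<open>D\<close> enters both families and cancels.\<close>
  define D where "D = (\<Prod>i<N. \<Prod>k<i. g (s k - s i))"
  have D': "(\<Prod>i<N. \<Prod>k\<in>{i<..<N}. g (s i - s k)) = D"
  proof -
    have "(\<Prod>i<N. \<Prod>k\<in>{i<..<N}. g (s i - s k)) = (\<Prod>(i, k)\<in>(SIGMA i:{..<N}. {i<..<N}). g (s i - s k))"
      by (rule prod.Sigma) auto
    also have "\<dots> = (\<Prod>(i, k)\<in>(SIGMA i:{..<N}. {..<i}). g (s k - s i))"
      by (rule prod.reindex_bij_witness[where i = prod.swap and j = prod.swap]) auto
    also have "\<dots> = D" unfolding D_def by (rule prod.Sigma[symmetric]) auto
    finally show ?thesis .
  qed
  have D0: "D \<noteq> 0" by (simp add: D_def g0)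
  \<comment> \<open>The content factors of a row have consecutive arguments, so they extend the
    partial products \<open>G\<close> to a length (in \<open>C1\<close>) or from a length (in
    \<open>C2\<close>) that does not depend on the row of the diagram.\<close>
  define c1 where "c1 i = (\<Prod>j<row d i. g (int N - (int j - int i)))" for i
  define c2 where "c2 i = (\<Prod>j<row d i. g (int N + (int j - int i)))" for i
  define e where "e i = (\<Prod>j<N. g (int i + int j + 1))" for i
  have C1: "G (N + i - row d i) * c1 i = G (N + i)" for i
  proof -
    have "c1 i = (\<Prod>u<row d i. g (int (N + i - row d i) + int u + 1))"
      unfolding c1_def
      by (rule prod.reindex_bij_witness[where i = "\<lambda>u. row d i - 1 - u" and j = "\<lambda>u. row d i - 1 - u"])
        (use rowN[of i] in \<open>auto simp: of_nat_diff intro!: arg_cong[where f = g]\<close>)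
    thus ?thesis using G_add[of "N + i - row d i" "row d i"] rowN[of i] by simp
  qed
  have C2: "G (N - 1 - i) * c2 i = G (N - 1 - i + row d i)" if "i < N" for i
    unfolding G_add c2_def using that by (simp add: of_nat_diff algebra_simps)
  have E: "G i * e i = G (N + i)" for i
    using G_add[of i N] by (simp add: e_def add.commute)
  have rev: "(\<Prod>i<N. G (N - 1 - i)) = (\<Prod>i<N. G i)"
    by (rule prod.reindex_bij_witness[where i = "\<lambda>u. N - 1 - u" and j = "\<lambda>u. N - 1 - u"]) auto
  have "(D * (\<Prod>i<N. G i)) * ((\<Prod>i<N. a i) * (\<Prod>i<N. c1 i * c2 i)) =
     (\<Prod>i<N. a i * (\<Prod>k<i. g (s k - s i))) * (\<Prod>i<N. c1 i) * ((\<Prod>i<N. G (N - 1 - i)) * (\<Prod>i<N. c2 i))"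
    unfolding D_def rev by (simp add: prod.distrib mult_ac)
  also have "\<dots> = (\<Prod>i<N. G (N + i - row d i) * c1 i) * (\<Prod>i<N. G (N - 1 - i) * c2 i)"
    by (simp add: A prod.distrib)
  also have "\<dots> = (\<Prod>i<N. G (N + i)) * (\<Prod>i<N. G (N - 1 - i + row d i))"
    using prod.cong[OF refl C2, of "{..<N}" "\<lambda>i. i"] by (simp add: C1)
  also have "\<dots> = (\<Prod>i<N. G i * e i) * (\<Prod>i<N. b i * (\<Prod>k\<in>{i<..<N}. g (s i - s k)))"
    by (simp add: B E)
  also have "\<dots> = (D * (\<Prod>i<N. G i)) * ((\<Prod>i<N. e i) * (\<Prod>i<N. b i))"
    unfolding D'[symmetric] by (simp add: prod.distrib mult_ac)
  finally have key: "(\<Prod>i<N. a i) * (\<Prod>i<N. c1 i * c2 i) = (\<Prod>i<N. e i) * (\<Prod>i<N. b i)"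
    using D0 G0 by simp
  have cells: "(\<Prod>(i, j)\<in>cells d. F i j) = (\<Prod>i<N. \<Prod>j<row d i. F i j)" for F :: "nat \<Rightarrow> nat \<Rightarrow> 'b"
  proof -
    have "cells d = (SIGMA i:{..<N}. {..<row d i})"
      using N(1) row_eq_0_iff[of d] by (auto simp: cells_def) (metis less_zeroE linorder_not_le order_trans)
    thus ?thesis by (simp add: prod.Sigma)
  qed
  have split: "(\<Prod>j<N. f (h i j)) = (\<Prod>j<row d i. f (h i j)) * a i" for i
  proof -
    have "(\<Prod>j<N. f (h i j)) = (\<Prod>j<row d i. f (h i j)) * (\<Prod>j\<in>{row d i..<N}. f (h i j))"
      using rowN[of i] by (simp add: atLeast0LessThan[symmetric] prod.atLeastLessThan_concat del: atLeast0LessThan)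
    thus ?thesis by (simp add: a_def g_def h)
  qed
  have "(\<Prod>i<N. \<Prod>j<N. f (h i j)) * (\<Prod>i<N. c1 i * c2 i) =
    (\<Prod>i<N. \<Prod>j<row d i. f (h i j)) * ((\<Prod>i<N. a i) * (\<Prod>i<N. c1 i * c2 i))"
    by (simp add: split prod.distrib mult_ac)
  also have "\<dots> = (\<Prod>i<N. e i) * ((\<Prod>i<N. \<Prod>j<row d i. f (h i j)) * (\<Prod>i<N. b i))"
    unfolding key by (simp add: mult_ac)
  finally have "(\<Prod>i<N. \<Prod>j<N. f (h i j)) * (\<Prod>i<N. c1 i * c2 i) =
    (\<Prod>i<N. e i) * ((\<Prod>i<N. \<Prod>j<row d i. f (h i j)) * (\<Prod>i<N. b i))" .
  moreover have "c1 i = (\<Prod>j<row d i. f (int j - int i - int N))" for i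
    unfolding c1_def g_def by (intro prod.cong refl arg_cong[where f = f]) simp
  moreover have "c2 i = (\<Prod>j<row d i. f (int i - int j - int N))" for i
    unfolding c2_def g_def by (intro prod.cong refl arg_cong[where f = f]) simp
  moreover have "b i = (\<Prod>j<row d i. f (- h i j))" for i
    unfolding b_def g_def h ..
  moreover have "e i = (\<Prod>j<N. f (- int i - int j - 1))" for i
    unfolding e_def g_def by (intro prod.cong refl arg_cong[where f = f]) simp
  ultimately show ?thesis unfolding cells by (simp only: prod.distrib)
qed

section \<open>Vertex sums\<close>

text \<open>Coefficients need not lie in a field: this is applied to series whose coefficients are
  again series, where only some elements are invertible.\<close>

lemma fps_mult_inverse_unit:
  fixes g :: "'b::{comm_ring_1, inverse} fps"
  assumes "g $ 0 * inverse (g $ 0) = 1"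
  shows "g * inverse g = 1"
  unfolding fps_inverse_def using assms by (rule fps_right_inverse)

lemma fps_divide_mult_unit:
  fixes g :: "'b::{comm_ring_1, inverse} fps"
  assumes "g $ 0 * inverse (g $ 0) = 1"
  shows "f / g * g = f" "f * g / g = f"
proof -
  have "g $ 0 \<noteq> 0" using assms by auto
  hence *: "h / g = h * inverse g" for h by (rule fps_divide_unit)
  have "inverse g * g = 1" using fps_mult_inverse_unit[OF assms] by (simp add: mult.commute)
  thus "f / g * g = f" "f * g / g = f"
    using fps_mult_inverse_unit[OF assms] by (simp_all add: * mult.assoc)
qed

lemma unit2: "U $ 0 $ 0 = 1 \<Longrightarrow> U $ 0 * inverse (U $ 0) = 1" for U :: "'a::field fps fps"
  by (rule inverse_mult_eq_1') simp

lemma ord_ge_1_iff: "ord_ge F (Suc 0) \<longleftrightarrow> F $ 0 $ 0 = 0"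
  by (auto simp: ord_ge_def)

definition unital :: "'r::comm_ring_1 fps fps \<Rightarrow> bool" where
  "unital U \<longleftrightarrow> U $ 0 $ 0 = 1"

lemma unital_ord_ge: "unital U \<Longrightarrow> ord_ge (U - 1) 1"
  by (simp add: unital_def ord_ge_1_iff)

lemma unital_mult: "unital U \<Longrightarrow> unital V \<Longrightarrow> unital (U * V)"
  by (simp add: unital_def fps_mult_nth)

lemma unital_1 [simp]: "unital 1"
  by (simp add: unital_def)

lemma unital_prod: "(\<And>i. i \<in> A \<Longrightarrow> unital (f i)) \<Longrightarrow> unital (prod f A)"
  by (induction A rule: infinite_finite_induct) (auto intro: unital_mult)

lemma unital_power: "unital U \<Longrightarrow> unital (U ^ n)"
  by (induction n) (auto intro: unital_mult)

lemma unital_1_minus: "ord_ge M 1 \<Longrightarrow> unital (1 - c * M)"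
  using ord_ge_mult_left[of M 1 c] by (simp add: unital_def ord_ge_1_iff)

lemma unital_1_minus': "ord_ge M 1 \<Longrightarrow> unital (1 - M * c)"
  using unital_1_minus[of M c] by (simp add: mult.commute)

section \<open>Polynomial dependence on \<open>v\<close>\<close>

definition poly_fun :: "('a::field \<Rightarrow> 'a) \<Rightarrow> bool" where
  "poly_fun f \<longleftrightarrow> (\<exists>p. \<forall>v. f v = poly p v)"

lemma poly_funI: "(\<And>v. f v = poly p v) \<Longrightarrow> poly_fun f"
  by (auto simp: poly_fun_def)

lemma poly_fun_const: "poly_fun (\<lambda>_. c)"
  by (rule poly_funI[of _ "[:c:]"]) simp

lemma poly_fun_id: "poly_fun (\<lambda>v. v)"
  by (rule poly_funI[of _ "[:0, 1:]"]) simp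

lemma poly_fun_add: "poly_fun f \<Longrightarrow> poly_fun g \<Longrightarrow> poly_fun (\<lambda>v. f v + g v)"
  and poly_fun_diff: "poly_fun f \<Longrightarrow> poly_fun g \<Longrightarrow> poly_fun (\<lambda>v. f v - g v)"
  and poly_fun_mult: "poly_fun f \<Longrightarrow> poly_fun g \<Longrightarrow> poly_fun (\<lambda>v. f v * g v)"
proof -
  assume "poly_fun f" "poly_fun g"
  then obtain p r where "\<And>v. f v = poly p v" "\<And>v. g v = poly r v" unfolding poly_fun_def by blast
  thus "poly_fun (\<lambda>v. f v + g v)" "poly_fun (\<lambda>v. f v - g v)" "poly_fun (\<lambda>v. f v * g v)"
    by (auto intro: poly_funI[of _ "p + r"] poly_funI[of _ "p - r"] poly_funI[of _ "p * r"])
qed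

lemma poly_fun_sum: "(\<And>i. i \<in> A \<Longrightarrow> poly_fun (f i)) \<Longrightarrow> poly_fun (\<lambda>v. \<Sum>i\<in>A. f i v)"
  by (induction A rule: infinite_finite_induct) (auto intro: poly_fun_add poly_fun_const)

lemma poly_fun_prod: "(\<And>i. i \<in> A \<Longrightarrow> poly_fun (f i)) \<Longrightarrow> poly_fun (\<lambda>v. \<Prod>i\<in>A. f i v)"
  by (induction A rule: infinite_finite_induct) (auto intro: poly_fun_mult poly_fun_const)

lemma poly_fun_power: "poly_fun f \<Longrightarrow> poly_fun (\<lambda>v. f v ^ n)"
  by (induction n) (auto intro: poly_fun_mult poly_fun_const)

lemma poly_fun_divide_const: "poly_fun f \<Longrightarrow> poly_fun (\<lambda>v. f v / c)"
  using poly_fun_mult[OF _ poly_fun_const[of "inverse c"], of f] by (simp add: divide_inverse)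

lemma poly_fun_zero:
  assumes "poly_fun f" "infinite {v. f v = 0}"
  shows "f v = 0"
proof -
  obtain p where p: "\<And>v. f v = poly p v" using assms(1) unfolding poly_fun_def by blast
  have "p = 0" using poly_roots_finite[of p] assms(2) by (auto simp: p)
  thus ?thesis by (simp add: p)
qed

text \<open>\<open>elem_expansion f\<close> does not involve \<open>v\<close>, so the specialization
  is a fixed polynomial in the coefficients of \<open>E_ser\<close>, and these are polynomials in
  \<open>v\<close>.\<close>

lemma poly_fun_specialize: "poly_fun (\<lambda>v. specialize f (E_ser q v \<mu>))"
proof -
  have "poly_fun (\<lambda>v. E_ser q v \<mu> $ n)" for n
    unfolding E_ser_def fps_mult_nth fps_nth_Abs_fps
    by (intro poly_fun_sum poly_fun_mult poly_fun_prod poly_fun_divide_const poly_fun_diff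
        poly_fun_const poly_fun_id)
  thus ?thesis unfolding specialize_def mpoly_eval_def
    by (intro poly_fun_sum poly_fun_mult poly_fun_prod poly_fun_power poly_fun_const)
qed

definition poly_ser :: "('a::field \<Rightarrow> 'a fps fps) \<Rightarrow> bool" where
  "poly_ser F \<longleftrightarrow> (\<forall>b c. poly_fun (\<lambda>v. F v $ b $ c))"

lemma poly_ser_const: "poly_ser (\<lambda>_. F)"
  by (simp add: poly_ser_def poly_fun_const)

lemma poly_ser_diff: "poly_ser F \<Longrightarrow> poly_ser G \<Longrightarrow> poly_ser (\<lambda>v. F v - G v)"
  by (simp add: poly_ser_def poly_fun_diff)

lemma poly_ser_mult: "poly_ser F \<Longrightarrow> poly_ser G \<Longrightarrow> poly_ser (\<lambda>v. F v * G v)"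
  unfolding poly_ser_def fps2_mult_nth by (intro allI poly_fun_sum poly_fun_mult) auto

lemma poly_ser_prod: "(\<And>i. i \<in> A \<Longrightarrow> poly_ser (F i)) \<Longrightarrow> poly_ser (\<lambda>v. \<Prod>i\<in>A. F i v)"
  by (induction A rule: infinite_finite_induct) (auto intro: poly_ser_mult poly_ser_const)

lemma poly_ser_power: "poly_ser F \<Longrightarrow> poly_ser (\<lambda>v. F v ^ n)"
  by (induction n) (auto intro: poly_ser_mult poly_ser_const)

lemma poly_ser_const2: "poly_fun f \<Longrightarrow> poly_ser (\<lambda>v. const2 (f v))"
proof -
  assume f: "poly_fun f"
  have "const2 (f v) $ b $ c = (if b = 0 \<and> c = 0 then f v else 0)" for v b c
    by (simp add: const2_def)
  moreover have "poly_fun (\<lambda>v. if b = 0 \<and> c = 0 then f v else 0)" for b c :: nat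
    using f poly_fun_const[of 0] by (cases "b = 0 \<and> c = 0") auto
  ultimately show ?thesis by (simp add: poly_ser_def)
qed

lemma skew_scale: "skew (\<lambda>i. a * x i) N m l = a ^ (dsize m - dsize l) * skew x N m l"
proof (cases "l \<le> m")
  case True
  hence "card (cells m - cells l) = dsize m - dsize l"
    by (simp add: card_Diff_subset finite_cells cells_subset_iff card_cells)
  thus ?thesis using True by (simp add: skew_def prod.distrib sum_distrib_left)
qed (simp add: skew_def)

definition vertex_sum :: "'a::field \<Rightarrow> 'a \<Rightarrow> nat list \<Rightarrow> nat list \<Rightarrow> nat list \<Rightarrow> 'a" where
  "vertex_sum qh v \<mu> \<eta> \<nu> = (\<Sum>\<sigma> | is_partition \<sigma> \<and> boxes \<sigma> \<subseteq> boxes \<eta> \<and> boxes \<sigma> \<subseteq> boxes (conjugate \<nu>).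
     qh powi (int (sum_list \<eta>) - int (sum_list \<sigma>)) * specialize (skew_schur \<eta> \<sigma>) (E_ser (qh\<^sup>2) v (conjugate \<mu>)) *
     (qh powi (int (sum_list \<nu>) - int (sum_list \<sigma>)) * specialize (skew_schur (conjugate \<nu>) \<sigma>) (E_ser (qh\<^sup>2) v \<mu>)))"

text \<open>The contribution of a fixed \<mu>, stripped of all prefactors and of the sign of \<mu>.
  What remains depends on \<open>eh\<close> through \<open>v\<close> only, and polynomially. The
  case of the empty partition is \<open>Z_pert\<close>.\<close>

definition vertex_series :: "'a::field \<Rightarrow> 'a \<Rightarrow> nat list \<Rightarrow> 'a fps fps" where
  "vertex_series qh v \<mu> = Abs_fps (\<lambda>b. Abs_fps (\<lambda>c. \<Sum>\<nu>\<in>partitions b. \<Sum>\<eta>\<in>partitions c.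
     (- 1) ^ b * (- 1) ^ c * (vertex_sum qh v \<mu> \<eta> \<nu> *
       vertex_sum qh v (conjugate \<mu>) (conjugate \<eta>) (conjugate \<nu>))))"

lemma vertex_eq:
  "vertex qh eh \<eta> \<mu> \<nu> = qh powi kappa \<nu> * eh powi (- int (sum_list \<mu>)) * quantum_dim qh eh \<mu> *
     vertex_sum qh (inverse (eh\<^sup>2)) \<mu> \<eta> \<nu>"
  by (simp add: vertex_def vertex_sum_def E_series_eq)

lemma poly_ser_vertex_series: "poly_ser (\<lambda>v. vertex_series qh v \<mu>)"
  unfolding poly_ser_def vertex_series_def fps_nth_Abs_fps vertex_sum_def
  by (intro allI poly_fun_sum poly_fun_mult poly_fun_const poly_fun_specialize)

lemma is_partition_conjugate: "is_partition l \<Longrightarrow> is_partition (conjugate l)"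
  and diag_conjugate: "is_partition l \<Longrightarrow> diag (conjugate l) = mirror (diag l)"
  by (rule is_partition_conjugate_diag; assumption)+

lemma sum_list_conjugate: "is_partition l \<Longrightarrow> sum_list (conjugate l) = sum_list l"
  by (metis diag_conjugate dsize_diag dsize_mirror is_partition_conjugate)

lemma conjugate_conjugate: "is_partition l \<Longrightarrow> conjugate (conjugate l) = l"
  by (rule inj_onD[OF inj_on_diag]) (simp_all add: diag_conjugate is_partition_conjugate)

text \<open>Skew Schur polynomials are homogeneous, so the powers of \<open>qh\<close> are absorbed
  into the variables. The large index set \<open>B\<close> only adds zero terms and can be chosen
  independently of the outer shapes, which permits exchanging sums later.\<close>

lemma vertex_sum_finite:
  fixes qh :: "'a::field"
  assumes qh: "qh \<noteq> 0" and q: "\<And>n. n > 0 \<Longrightarrow> (qh\<^sup>2) ^ n \<noteq> 1"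
    and p: "is_partition \<mu>" "is_partition \<eta>" "is_partition \<nu>"
    and N: "length \<mu> \<le> N" "length (conjugate \<mu>) \<le> N"
    and B: "finite B" "{s. s \<le> diag \<eta>} \<subseteq> B"
  shows "vertex_sum qh ((qh\<^sup>2) powi (- int N)) \<mu> \<eta> \<nu> =
    (\<Sum>s\<in>B. skew (\<lambda>i. qh * maya (qh\<^sup>2) (mirror (diag \<mu>)) i) N (diag \<eta>) s *
            skew (\<lambda>i. qh * maya (qh\<^sup>2) (diag \<mu>) i) N (mirror (diag \<nu>)) s)"
proof -
  let ?q = "qh\<^sup>2" and ?x = "\<lambda>i. qh * maya (qh\<^sup>2) (diag \<mu>) i" and ?y = "\<lambda>i. qh * maya (qh\<^sup>2) (mirror (diag \<mu>)) i"
  have q0: "?q \<noteq> 0" using qh by simp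
  let ?I = "{\<sigma>. is_partition \<sigma> \<and> boxes \<sigma> \<subseteq> boxes \<eta> \<and> boxes \<sigma> \<subseteq> boxes (conjugate \<nu>)}"
  have pc: "is_partition (conjugate \<mu>)" "is_partition (conjugate \<nu>)" using p by (simp_all add: is_partition_conjugate)
  have bij: "bij_betw diag ?I {s. s \<le> diag \<eta> \<and> s \<le> mirror (diag \<nu>)}"
  proof (rule bij_betw_imageI)
    show "inj_on diag ?I" using inj_on_diag by (rule inj_on_subset) auto
    show "diag ` ?I = {s. s \<le> diag \<eta> \<and> s \<le> mirror (diag \<nu>)}"
    proof (intro set_eqI iffI)
      fix s assume "s \<in> diag ` ?I"
      thus "s \<in> {s. s \<le> diag \<eta> \<and> s \<le> mirror (diag \<nu>)}"
        using p pc by (auto simp: boxes_subset_iff diag_conjugate)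
    next
      fix s assume s: "s \<in> {s. s \<le> diag \<eta> \<and> s \<le> mirror (diag \<nu>)}"
      obtain \<sigma> where \<sigma>: "is_partition \<sigma>" "diag \<sigma> = s" using diag_surj by blast
      have "boxes \<sigma> \<subseteq> boxes \<eta>" "boxes \<sigma> \<subseteq> boxes (conjugate \<nu>)"
        using s p pc \<sigma> by (simp_all add: boxes_subset_iff diag_conjugate)
      thus "s \<in> diag ` ?I" using \<sigma> by blast
    qed
  qed
  have "vertex_sum qh (?q powi (- int N)) \<mu> \<eta> \<nu> = (\<Sum>\<sigma>\<in>?I. skew ?y N (diag \<eta>) (diag \<sigma>) * skew ?x N (mirror (diag \<nu>)) (diag \<sigma>))"
    unfolding vertex_sum_def
  proof (rule sum.cong[OF refl])
    fix \<sigma> assume \<sigma>: "\<sigma> \<in> ?I"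
    hence ps: "is_partition \<sigma>" and le: "diag \<sigma> \<le> diag \<eta>" "diag \<sigma> \<le> diag (conjugate \<nu>)"
      using p pc by (auto simp: boxes_subset_iff)
    have sz: "sum_list \<sigma> \<le> sum_list \<eta>" "sum_list \<sigma> \<le> sum_list \<nu>"
      using dsize_mono[OF le(1)] dsize_mono[OF le(2)] p pc ps by (simp_all add: dsize_diag diag_conjugate)
    have pw: "qh powi (int a - int b) = qh ^ (a - b)" if "b \<le> a" for a b
      using that by (simp flip: of_nat_diff)
    show "qh powi (int (sum_list \<eta>) - int (sum_list \<sigma>)) * specialize (skew_schur \<eta> \<sigma>) (E_ser ?q (?q powi (- int N)) (conjugate \<mu>)) *
     (qh powi (int (sum_list \<nu>) - int (sum_list \<sigma>)) * specialize (skew_schur (conjugate \<nu>) \<sigma>) (E_ser ?q (?q powi (- int N)) \<mu>)) =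
     skew ?y N (diag \<eta>) (diag \<sigma>) * skew ?x N (mirror (diag \<nu>)) (diag \<sigma>)"
      using specialize_E_ser[OF q0 q pc(1) N(2) ps p(2)] specialize_E_ser[OF q0 q p(1) N(1) ps pc(2)] sz p ps
      by (simp add: pw skew_scale diag_conjugate dsize_diag)
  qed
  also have "\<dots> = (\<Sum>s | s \<le> diag \<eta> \<and> s \<le> mirror (diag \<nu>). skew ?y N (diag \<eta>) s * skew ?x N (mirror (diag \<nu>)) s)"
    by (rule sum.reindex_bij_betw[OF bij])
  also have "\<dots> = (\<Sum>s\<in>B. skew ?y N (diag \<eta>) s * skew ?x N (mirror (diag \<nu>)) s)"
    by (rule sum.mono_neutral_left) (use B in \<open>auto simp: skew_def\<close>)
  finally show ?thesis .
qed

definition Qm_var :: "'a::comm_ring_1 fps fps" where "Qm_var = fps_const fps_X"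

lemma ord_ge_Qm: "ord_ge (Qm_var) 1" and ord_ge_Q1: "ord_ge (fps_X :: 'a::comm_ring_1 fps fps) 1"
  by (simp_all add: ord_ge_1_iff Qm_var_def)

lemma const2_monom_nth:
  "(const2 a * (Qm_var ^ e * fps_X ^ n)) $ b $ c = (if b = n \<and> c = e then a else 0)"
proof -
  have "Qm_var ^ e = fps_const (fps_X ^ e :: 'a fps)" by (simp add: Qm_var_def fps_const_power)
  thus ?thesis
    by (simp add: const2_def fps_mult_left_const_nth fps_X_power_mult_right_nth mult.assoc)
qed

text \<open>After \<nu> is replaced by its transpose, the first vertex is a product of entries of
  \<open>Hmat\<close>, and the second one, with all diagrams transposed, a product of entries of
  \<open>Vmat\<close>. The signs of the two sums go into the weights \<open>- Qm_var\<close> and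
  \<open>- fps_X\<close>.\<close>

lemma vertex_series_finite:
  fixes qh :: "'a::field"
  assumes qh: "qh \<noteq> 0" and q: "\<And>n. n > 0 \<Longrightarrow> (qh\<^sup>2) ^ n \<noteq> 1"
    and \<mu>: "is_partition \<mu>" and N: "length \<mu> \<le> N" "length (conjugate \<mu>) \<le> N"
  shows "vertex_series qh ((qh\<^sup>2) powi (- int N)) \<mu> =
    schur_cyc (\<lambda>i. const2 (qh * maya (qh\<^sup>2) (diag \<mu>) i)) (\<lambda>i. const2 (qh * maya (qh\<^sup>2) (mirror (diag \<mu>)) i)) N
      (- Qm_var) (- fps_X) 1 1 1 1"
proof (intro fps_ext)
  fix b c
  define x where "x i = qh * maya (qh\<^sup>2) (diag \<mu>) i" for i
  define y where "y i = qh * maya (qh\<^sup>2) (mirror (diag \<mu>)) i" for i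
  define v where "v = (qh\<^sup>2) powi (- int N)"
  define sg :: 'a where "sg = (- 1) ^ b * (- 1) ^ c"
  \<comment> \<open>Both inner diagrams lie inside \<eta> or its transpose, which have
    \<open>c\<close> boxes.\<close>
  define B where "B = {d. dsize d \<le> c}"
  define F where "F = cyc (- Qm_var) (- fps_X) (Hmat (\<lambda>i. const2 (y i)) N) (Hmat (\<lambda>i. const2 (x i)) N)
     (Vmat (\<lambda>i. const2 (y i)) N) (Vmat (\<lambda>i. const2 (x i)) N)"
  define X where "X e w = (\<Sum>s\<in>B. skew y N e s * skew x N w s)" for e w
  define Y where "Y e w = (\<Sum>t\<in>B. skew y N (mirror w) (mirror t) * skew x N (mirror e) (mirror t))" for e w
  have finB: "finite B" by (simp add: B_def finite_dsize_le)
  have pc: "is_partition (conjugate \<mu>)" using \<mu> by (simp add: is_partition_conjugate)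
  define W where "W s t e w = (skew y N e s * skew x N w s) * (skew y N (mirror w) (mirror t) * skew x N (mirror e) (mirror t))"
    for s t e w
  have F: "F ((s, t), e, w) = const2 ((- 1) ^ dsize w * (- 1) ^ dsize e *
     W s t e w) * (Qm_var ^ dsize e * fps_X ^ dsize w)"
    for s t e w
  proof -
    have "(- Qm_var) ^ dsize e * (- fps_X) ^ dsize w =
      const2 ((- 1) ^ dsize w * (- 1) ^ dsize e) * (Qm_var ^ dsize e * fps_X ^ dsize w :: 'a fps fps)"
    proof -
      have "const2 ((- 1) ^ n :: 'a) = (- 1) ^ n" for n
        by (induction n) (simp_all add: const2_mult, simp add: const2_def flip: fps_const_neg)
      thus ?thesis unfolding const2_mult power_minus[of Qm_var] power_minus[of fps_X] by (simp add: mult_ac)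
    qed
    thus ?thesis by (simp add: F_def W_def cyc_def Vmat_eq_Hmat_mirror Hmat_eq_skew skew_const2 const2_mult mult_ac)
  qed
  have Fn: "F ((s, t), e, w) $ b $ c = (if b = dsize w \<and> c = dsize e then
     sg * W s t e w else 0)" for s t e w
    unfolding F const2_monom_nth sg_def by simp
  let ?E = "{e. dsize e = c}" and ?W = "{w. dsize w = b}"
  have finE: "finite ?E" "finite ?W"
    by (rule finite_subset[OF _ finite_dsize_le[of c]], force) (rule finite_subset[OF _ finite_dsize_le[of b]], force)
  have "fsum F $ b $ c = (\<Sum>p\<in>(B \<times> B) \<times> ?E \<times> ?W. F p $ b $ c)"
    unfolding fsum_nth
  proof (rule sum.mono_neutral_left)
    show "finite ((B \<times> B) \<times> ?E \<times> ?W)" using finB finE by simp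
    show "{p. F p $ b $ c \<noteq> 0} \<subseteq> (B \<times> B) \<times> ?E \<times> ?W"
    proof
      fix p assume p: "p \<in> {p. F p $ b $ c \<noteq> 0}"
      obtain s t e w where pe: "p = ((s, t), e, w)" by (metis prod.collapse)
      have nz: "b = dsize w" "c = dsize e" "skew y N e s \<noteq> 0" "skew x N (mirror e) (mirror t) \<noteq> 0"
        using p unfolding pe by (auto simp: Fn W_def split: if_splits)
      hence "s \<le> e" "t \<le> e" by (auto simp: skew_def split: if_splits)
      thus "p \<in> (B \<times> B) \<times> ?E \<times> ?W" using nz unfolding pe B_def by (auto dest: dsize_mono)
    qed
  qed auto
  also have "\<dots> = (\<Sum>(s, t)\<in>B \<times> B. \<Sum>(e, w)\<in>?E \<times> ?W.
      sg * W s t e w)"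
  proof -
    have "(\<Sum>p\<in>(B \<times> B) \<times> ?E \<times> ?W. F p $ b $ c) = (\<Sum>p\<in>B \<times> B. \<Sum>r\<in>?E \<times> ?W. F (p, r) $ b $ c)"
      by (subst sum.cartesian_product) (simp add: case_prod_unfold)
    also have "\<dots> = (\<Sum>(s, t)\<in>B \<times> B. \<Sum>(e, w)\<in>?E \<times> ?W.
      sg * W s t e w)"
      unfolding case_prod_unfold
    proof (intro sum.cong refl)
      fix p r assume pr: "p \<in> B \<times> B" "r \<in> ?E \<times> ?W"
      show "F (p, r) $ b $ c = sg * W (fst p) (snd p) (fst r) (snd r)"
        using pr by (cases p; cases r) (simp add: Fn)
    qed
    finally show ?thesis .
  qed
  also have "\<dots> = (\<Sum>(e, w)\<in>?E \<times> ?W. \<Sum>(s, t)\<in>B \<times> B.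
      sg * W s t e w)"
    unfolding case_prod_unfold by (rule sum.swap)
  also have "\<dots> = (\<Sum>(e, w)\<in>?E \<times> ?W. sg * (X e w * Y e w))"
  proof -
    have XY: "X e w * Y e w = (\<Sum>(s, t)\<in>B \<times> B. W s t e w)" for e w
      unfolding X_def Y_def W_def sum_product sum.cartesian_product ..
    show ?thesis by (simp only: XY sum_distrib_left case_prod_unfold)
  qed
  also have "\<dots> = (\<Sum>e\<in>?E. \<Sum>w\<in>?W. sg * (X e w * Y e w))"
    by (simp add: sum.cartesian_product)
  also have "\<dots> = (\<Sum>w\<in>?W. \<Sum>e\<in>?E. sg * (X e w * Y e w))" by (rule sum.swap)
  \<comment> \<open>In the cyclic sum \<open>w\<close> stands for the transpose of \<nu>.\<close>
  also have "\<dots> = (\<Sum>w\<in>?W. \<Sum>e\<in>?E. sg * (X e (mirror w) * Y e (mirror w)))"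
  proof -
    have "bij_betw mirror ?W ?W" by (rule bij_betw_byWitness[of _ mirror]) auto
    from sum.reindex_bij_betw[OF this, of "\<lambda>w. \<Sum>e\<in>?E. sg * (X e w * Y e w)"]
    show ?thesis by (rule sym)
  qed
  also have "\<dots> = (\<Sum>\<nu>\<in>partitions b. \<Sum>\<eta>\<in>partitions c. sg * (X (diag \<eta>) (mirror (diag \<nu>)) * Y (diag \<eta>) (mirror (diag \<nu>))))"
    by (simp add: sum.reindex_bij_betw[OF bij_betw_diag_partitions, symmetric])
  also have "\<dots> = (\<Sum>\<nu>\<in>partitions b. \<Sum>\<eta>\<in>partitions c. sg * (vertex_sum qh v \<mu> \<eta> \<nu> *
       vertex_sum qh v (conjugate \<mu>) (conjugate \<eta>) (conjugate \<nu>)))"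
  proof (intro sum.cong refl)
    fix \<nu> \<eta> assume "\<nu> \<in> partitions b" "\<eta> \<in> partitions c"
    hence p: "is_partition \<nu>" "is_partition \<eta>" and c: "sum_list \<eta> = c" by (auto simp: partitions_def)
    have sub: "{s. s \<le> diag \<eta>} \<subseteq> B" using c p dsize_mono[of _ "diag \<eta>"] by (auto simp: B_def dsize_diag)
    have X: "vertex_sum qh v \<mu> \<eta> \<nu> = X (diag \<eta>) (mirror (diag \<nu>))"
      unfolding v_def X_def x_def y_def
      by (rule vertex_sum_finite[OF qh q \<mu> p(2,1) N finB sub])
    have "{s. s \<le> diag (conjugate \<eta>)} \<subseteq> B"
      using c p dsize_mono[of _ "mirror (diag \<eta>)"] by (auto simp: B_def dsize_diag diag_conjugate)
    hence "vertex_sum qh v (conjugate \<mu>) (conjugate \<eta>) (conjugate \<nu>) =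
      (\<Sum>t\<in>B. skew x N (mirror (diag \<eta>)) t * skew y N (diag \<nu>) t)"
      unfolding v_def x_def y_def using p \<mu> pc N
      by (subst vertex_sum_finite[OF qh q pc _ _ _ _ finB])
        (simp_all add: is_partition_conjugate diag_conjugate conjugate_conjugate)
    also have "\<dots> = (\<Sum>t\<in>B. skew x N (mirror (diag \<eta>)) (mirror t) * skew y N (diag \<nu>) (mirror t))"
    proof -
      have "bij_betw mirror B B" by (rule bij_betw_byWitness[of _ mirror]) (auto simp: B_def)
      from sum.reindex_bij_betw[OF this, of "\<lambda>t. skew x N (mirror (diag \<eta>)) t * skew y N (diag \<nu>) t"]
      show ?thesis by (rule sym)
    qed
    finally have "vertex_sum qh v (conjugate \<mu>) (conjugate \<eta>) (conjugate \<nu>) = Y (diag \<eta>) (mirror (diag \<nu>))"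
      by (simp add: Y_def mult.commute)
    with X show "sg * (X (diag \<eta>) (mirror (diag \<nu>)) * Y (diag \<eta>) (mirror (diag \<nu>))) = sg * (vertex_sum qh v \<mu> \<eta> \<nu> *
       vertex_sum qh v (conjugate \<mu>) (conjugate \<eta>) (conjugate \<nu>))" by simp
  qed
  finally have "fsum F $ b $ c = vertex_series qh v \<mu> $ b $ c"
    by (simp add: vertex_series_def sg_def)
  thus "vertex_series qh ((qh\<^sup>2) powi (- int N)) \<mu> $ b $ c =
    schur_cyc (\<lambda>i. const2 (qh * maya (qh\<^sup>2) (diag \<mu>) i)) (\<lambda>i. const2 (qh * maya (qh\<^sup>2) (mirror (diag \<mu>)) i)) N
      (- Qm_var) (- fps_X) 1 1 1 1 $ b $ c"
    unfolding v_def F_def schur_cyc_def x_def y_def by simp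
qed

definition hook_factor :: "'a::field \<Rightarrow> nat list \<Rightarrow> nat \<times> nat \<Rightarrow> 'a fps fps \<Rightarrow> 'a fps fps" where
  "hook_factor q \<mu> p M = (1 - const2 (q powi hook \<mu> p) * M) * (1 - const2 (q powi (- hook \<mu> p)) * M)"

definition content_factor :: "'a::field \<Rightarrow> 'a \<Rightarrow> nat \<times> nat \<Rightarrow> 'a fps fps \<Rightarrow> 'a fps fps" where
  "content_factor q v p M =
     (1 - const2 (v * q powi box_content p) * M) * (1 - const2 (v * q powi (- box_content p)) * M)"

lemma unital_hook_factor: "ord_ge M 1 \<Longrightarrow> unital (hook_factor q \<mu> p M)"
  and unital_content_factor: "ord_ge M 1 \<Longrightarrow> unital (content_factor q v p M)"
  unfolding hook_factor_def content_factor_def by (intro unital_mult unital_1_minus; assumption)+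

text \<open>The two factors \<open>qh\<close> supply the \<open>+ 1\<close> of the hook length:
  \<open>x i * y j\<close> is \<open>q\<close> to the power \<mu>_i + \<mu>^t_j - i - j + 1 in
  numbering from 1, also for pairs outside the diagram. So \<open>hook_product\<close> applies with
  \<open>f k = 1 - q^k M\<close>, which is nonzero because \<open>M\<close> has no constant
  term.\<close>

lemma kern_maya:
  fixes qh :: "'a::field"
  assumes qh: "qh \<noteq> 0" and \<mu>: "is_partition \<mu>" and N: "length \<mu> \<le> N" "length (conjugate \<mu>) \<le> N"
    and M: "ord_ge M 1"
  defines "K \<equiv> \<lambda>d. kern (\<lambda>i. const2 (qh * maya (qh\<^sup>2) d i)) (\<lambda>i. const2 (qh * maya (qh\<^sup>2) (mirror d) i)) N M"
  shows "K (diag \<mu>) * (\<Prod>p\<in>boxes \<mu>. content_factor (qh\<^sup>2) ((qh\<^sup>2) powi (- int N)) p M) =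
    K (diag []) * (\<Prod>p\<in>boxes \<mu>. hook_factor (qh\<^sup>2) \<mu> p M)"
proof -
  let ?q = "qh\<^sup>2"
  have q0: "?q \<noteq> 0" using qh by simp
  define f where "f k = 1 - const2 (?q powi k) * M" for k
  have f0: "f k \<noteq> 0" for k 
  proof -
    have "f k $ 0 $ 0 = 1" using unital_1_minus[OF M] unfolding f_def unital_def by blast
    thus ?thesis by auto
  qed
  let ?d = "diag \<mu>"
  have K: "K d = (\<Prod>i<N. \<Prod>j<N. f (int (row d i) + int (row (mirror d) j) - int i - int j - 1))" for d
    unfolding K_def kern_def
  proof (intro prod.cong refl)
    fix i j
    have add: "Q powi (1 + a + b) = Q * Q powi a * Q powi b" if "Q \<noteq> 0" for Q :: 'a and a b
      using that by (simp add: power_int_add)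
    have "qh * maya ?q d i * (qh * maya ?q (mirror d) j) = ?q * maya ?q d i * maya ?q (mirror d) j"
      by (simp add: power2_eq_square)
    also have "\<dots> = ?q powi (1 + (int (row d i) - int i - 1) + (int (row (mirror d) j) - int j - 1))"
      unfolding maya_def by (rule add[OF q0, symmetric])
    also have "1 + (int (row d i) - int i - 1) + (int (row (mirror d) j) - int j - 1) =
      int (row d i) + int (row (mirror d) j) - int i - int j - 1" by simp
    finally show "1 - M * (const2 (qh * maya ?q d i) * const2 (qh * maya ?q (mirror d) j)) =
      f (int (row d i) + int (row (mirror d) j) - int i - int j - 1)"
      by (simp add: f_def mult.commute flip: const2_mult)
  qed
  have p0: "is_partition []" by (simp add: is_partition_def)
  have e: "row (diag []) i = 0" "row (mirror (diag [])) i = 0" for i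
    using row_diag[OF p0] by (simp_all add: row_mirror)
  have K0: "K (diag []) = (\<Prod>i<N. \<Prod>j<N. f (- int i - int j - 1))"
    unfolding K by (simp add: e)
  have N': "nrows ?d \<le> N" "nrows (mirror ?d) \<le> N"
    using N nrows_diag[OF \<mu>] nrows_diag[OF is_partition_conjugate[OF \<mu>]] by (simp_all add: diag_conjugate[OF \<mu>])
  have inj: "inj_on (map_prod Suc Suc) (cells ?d)" by (rule inj_on_subset[of _ UNIV]) (auto intro: prod.inj_map)
  have 1: "(\<Prod>p\<in>boxes \<mu>. content_factor ?q (?q powi (- int N)) p M) =
     (\<Prod>(i, j)\<in>cells ?d. f (int j - int i - int N) * f (int i - int j - int N))"
    unfolding boxes_eq[OF \<mu>] prod.reindex[OF inj]
  proof (intro prod.cong refl, clarify)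
    fix i j
    have "?q powi (- int N) * ?q powi (int j - int i) = ?q powi (int j - int i - int N)"
      "?q powi (- int N) * ?q powi (- (int j - int i)) = ?q powi (int i - int j - int N)"
      using q0 by (simp_all flip: power_int_add add: algebra_simps)
    thus "((\<lambda>p. content_factor ?q (?q powi (- int N)) p M) \<circ> map_prod Suc Suc) (i, j) =
      f (int j - int i - int N) * f (int i - int j - int N)"
      by (simp add: content_factor_def box_content_def f_def)
  qed
  have 2: "(\<Prod>p\<in>boxes \<mu>. hook_factor ?q \<mu> p M) =
     (\<Prod>(i, j)\<in>cells ?d. f (int (row ?d i) + int (row (mirror ?d) j) - int i - int j - 1) *
        f (- (int (row ?d i) + int (row (mirror ?d) j) - int i - int j - 1)))"
    unfolding boxes_eq[OF \<mu>] prod.reindex[OF inj]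
  proof (intro prod.cong refl, clarify)
    fix i j
    have "hook \<mu> (Suc i, Suc j) = int (row ?d i) + int (row (mirror ?d) j) - int i - int j - 1"
      using row_diag_part[OF \<mu>, of i] row_diag_part[OF is_partition_conjugate[OF \<mu>], of j]
      by (simp add: hook_def diag_conjugate[OF \<mu>])
    thus "((\<lambda>p. hook_factor ?q \<mu> p M) \<circ> map_prod Suc Suc) (i, j) =
      f (int (row ?d i) + int (row (mirror ?d) j) - int i - int j - 1) *
        f (- (int (row ?d i) + int (row (mirror ?d) j) - int i - int j - 1))"
      by (simp add: hook_factor_def f_def)
  qed
  show ?thesis unfolding 1 2 K0 unfolding K by (rule hook_product[OF f0 N'])
qed

section \<open>The ratio of the partition functions\<close>

definition Q_prod :: "'a::comm_ring_1 fps fps" where "Q_prod = fps_X * Qm_var"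

lemma ord_ge_Q_prod_power: "ord_ge (Q_prod ^ Suc j) 1"
  unfolding power_Suc Q_prod_def by (intro ord_ge_mult_right ord_ge_Q1)

lemma ord_ge_Qm_power: "ord_ge (Qm_var * Q_prod ^ j) 1" and ord_ge_Q1_power: "ord_ge (fps_X * Q_prod ^ j) 1"
  by (intro ord_ge_mult_right ord_ge_Q1 ord_ge_Qm)+

text \<open>Numerator and denominator are kept separate because each is polynomial in
  \<open>v\<close>, whereas their quotient is not.\<close>

definition box_num :: "'a::field \<Rightarrow> 'a \<Rightarrow> nat list \<Rightarrow> nat \<times> nat \<Rightarrow> nat \<Rightarrow> 'a fps fps" where
  "box_num q v \<mu> p j = hook_factor q \<mu> p (Qm_var * Q_prod ^ j) * hook_factor q \<mu> p (fps_X * Q_prod ^ j) *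
     (content_factor q v p (Q_prod ^ Suc j))\<^sup>2"

definition box_den :: "'a::field \<Rightarrow> 'a \<Rightarrow> nat list \<Rightarrow> nat \<times> nat \<Rightarrow> nat \<Rightarrow> 'a fps fps" where
  "box_den q v \<mu> p j = content_factor q v p (Qm_var * Q_prod ^ j) * content_factor q v p (fps_X * Q_prod ^ j) *
     (hook_factor q \<mu> p (Q_prod ^ Suc j))\<^sup>2"

text \<open>Split into three quotients so that it unfolds to the factor in the theorem.\<close>

definition box_ratio :: "'a::field \<Rightarrow> 'a \<Rightarrow> nat list \<Rightarrow> nat \<times> nat \<Rightarrow> nat \<Rightarrow> 'a fps fps" where
  "box_ratio q v \<mu> p j =
     hook_factor q \<mu> p (Qm_var * Q_prod ^ j) / content_factor q v p (Qm_var * Q_prod ^ j) *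
     (hook_factor q \<mu> p (fps_X * Q_prod ^ j) / content_factor q v p (fps_X * Q_prod ^ j)) *
     ((content_factor q v p (Q_prod ^ Suc j))\<^sup>2 / (hook_factor q \<mu> p (Q_prod ^ Suc j))\<^sup>2)"

lemma unital_box_num: "unital (box_num q v \<mu> p j)" and unital_box_den: "unital (box_den q v \<mu> p j)"
  unfolding box_num_def box_den_def
  by (intro unital_mult unital_power unital_hook_factor unital_content_factor
      ord_ge_Qm_power ord_ge_Q1_power ord_ge_Q_prod_power)+

lemma divide_unital: "unital U \<Longrightarrow> F / U * U = F" for U :: "'a::field fps fps"
  by (rule fps_divide_mult_unit(1), rule unit2) (simp add: unital_def)

lemma box_ratio_mult_den: "box_ratio q v \<mu> p j * box_den q v \<mu> p j = box_num q v \<mu> p j"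
proof -
  have *: "(a / d1) * (b / d2) * (c / d3) * (d1 * d2 * d3) = a * b * c"
    if "unital d1" "unital d2" "unital d3" for a b c d1 d2 d3 :: "'a fps fps"
  proof -
    have "(a / d1) * (b / d2) * (c / d3) * (d1 * d2 * d3) = (a / d1 * d1) * (b / d2 * d2) * (c / d3 * d3)"
      by (simp only: mult_ac)
    thus ?thesis using that by (simp add: divide_unital)
  qed
  show ?thesis unfolding box_ratio_def box_den_def box_num_def
    by (rule *) (intro unital_power unital_hook_factor unital_content_factor
      ord_ge_Qm_power ord_ge_Q1_power ord_ge_Q_prod_power)+
qed

text \<open>\<open>schur_cyc_limit\<close> for \<mu> and for the empty partition has the same
  remaining sum \<open>Z\<close>. Eliminating \<open>Z\<close> leaves a relation in which the
  kernels occur only in quotients known from \<open>kern_maya\<close>; they are cancelled as a unit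
  at the end.\<close>

lemma vertex_series_ratio_mod_finite:
  fixes qh :: "'a::field"
  assumes qh: "qh \<noteq> 0" and q: "\<And>n. n > 0 \<Longrightarrow> (qh\<^sup>2) ^ n \<noteq> 1"
    and \<mu>: "is_partition \<mu>" and N: "length \<mu> \<le> N" "length (conjugate \<mu>) \<le> N"
  defines "v \<equiv> (qh\<^sup>2) powi (- int N)"
  shows "ord_ge (vertex_series qh v \<mu> * (\<Prod>j<2*m. \<Prod>p\<in>boxes \<mu>. box_den (qh\<^sup>2) v \<mu> p j) -
    vertex_series qh v [] * (\<Prod>j<2*m. \<Prod>p\<in>boxes \<mu>. box_num (qh\<^sup>2) v \<mu> p j)) m"
proof -
  let ?q = "qh\<^sup>2"
  define K where "K d = kern (\<lambda>i. const2 (qh * maya ?q d i)) (\<lambda>i. const2 (qh * maya ?q (mirror d) i)) N" for d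
  define A where "A d = (\<Prod>j<2*m. (K d (Q_prod ^ Suc j))\<^sup>2)" for d
  define B where "B d = (\<Prod>j<2*m. K d (Qm_var * Q_prod ^ j) * K d (fps_X * Q_prod ^ j))" for d
  define Z :: "'a fps fps" where "Z = fsum (cyc (- Qm_var) (- fps_X) id_mat id_mat id_mat id_mat)"
  have p0: "is_partition []" by (simp add: is_partition_def)
  have c0: "conjugate [] = []" by (simp add: conjugate_def part_def)
  have zw: "(- Qm_var) * (- fps_X) = (Q_prod :: 'a fps fps)" by (simp add: Q_prod_def mult.commute)
  have lim: "ord_ge (A (diag l) * vertex_series qh v l - B (diag l) * Z) m"
    if "is_partition l" "length l \<le> N" "length (conjugate l) \<le> N" for l
  proof -
    have "ord_ge (- Qm_var :: 'a fps fps) 1" "ord_ge (- fps_X :: 'a fps fps) 1"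
      by (intro ord_ge_uminus ord_ge_Qm ord_ge_Q1)+
    note limit = schur_cyc_limit[OF this, where m = m and x = "\<lambda>i. const2 (qh * maya ?q (diag l) i)" and
        y = "\<lambda>i. const2 (qh * maya ?q (mirror (diag l)) i)" and N = N]
    have series: "vertex_series qh v l = schur_cyc (\<lambda>i. const2 (qh * maya ?q (diag l) i))
        (\<lambda>i. const2 (qh * maya ?q (mirror (diag l)) i)) N (- Qm_var) (- fps_X) 1 1 1 1"
      unfolding v_def by (rule vertex_series_finite[OF qh q that])
    show ?thesis unfolding series A_def B_def Z_def K_def
      using limit[unfolded zw minus_minus] .
  qed
  note L1 = lim[OF \<mu> N]
  have L0: "ord_ge (A (diag []) * vertex_series qh v [] - B (diag []) * Z) m"
    by (rule lim) (simp_all add: p0 c0)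
  define CA where "CA = (\<Prod>j<2*m. \<Prod>p\<in>boxes \<mu>. (content_factor ?q v p (Q_prod ^ Suc j))\<^sup>2)"
  define HA where "HA = (\<Prod>j<2*m. \<Prod>p\<in>boxes \<mu>. (hook_factor ?q \<mu> p (Q_prod ^ Suc j))\<^sup>2)"
  define CB where "CB = (\<Prod>j<2*m. \<Prod>p\<in>boxes \<mu>. content_factor ?q v p (Qm_var * Q_prod ^ j) *
     content_factor ?q v p (fps_X * Q_prod ^ j))"
  define HB where "HB = (\<Prod>j<2*m. \<Prod>p\<in>boxes \<mu>. hook_factor ?q \<mu> p (Qm_var * Q_prod ^ j) *
     hook_factor ?q \<mu> p (fps_X * Q_prod ^ j))"
  have KM: "K (diag \<mu>) M * (\<Prod>p\<in>boxes \<mu>. content_factor ?q v p M) =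
     K (diag []) M * (\<Prod>p\<in>boxes \<mu>. hook_factor ?q \<mu> p M)" if "ord_ge M 1" for M
    unfolding K_def v_def by (rule kern_maya[OF qh \<mu> N that])
  have E1: "A (diag \<mu>) * CA = A (diag []) * HA"
  proof -
    have "(K (diag \<mu>) (Q_prod ^ Suc j))\<^sup>2 * (\<Prod>p\<in>boxes \<mu>. (content_factor ?q v p (Q_prod ^ Suc j))\<^sup>2) =
      (K (diag []) (Q_prod ^ Suc j))\<^sup>2 * (\<Prod>p\<in>boxes \<mu>. (hook_factor ?q \<mu> p (Q_prod ^ Suc j))\<^sup>2)" for j
      unfolding prod_power_distrib[symmetric] power_mult_distrib[symmetric] KM[OF ord_ge_Q_prod_power] ..
    thus ?thesis unfolding A_def CA_def HA_def prod.distrib[symmetric] by simp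
  qed
  have E2: "B (diag \<mu>) * CB = B (diag []) * HB"
  proof -
    have "K (diag \<mu>) (Qm_var * Q_prod ^ j) * K (diag \<mu>) (fps_X * Q_prod ^ j) *
       (\<Prod>p\<in>boxes \<mu>. content_factor ?q v p (Qm_var * Q_prod ^ j) * content_factor ?q v p (fps_X * Q_prod ^ j)) =
       K (diag []) (Qm_var * Q_prod ^ j) * K (diag []) (fps_X * Q_prod ^ j) *
       (\<Prod>p\<in>boxes \<mu>. hook_factor ?q \<mu> p (Qm_var * Q_prod ^ j) * hook_factor ?q \<mu> p (fps_X * Q_prod ^ j))" for j
    proof -
      have mmult: "a * b * (c * d) = a' * b' * (c' * d')" if "a * c = a' * c'" "b * d = b' * d'"
        for a b c d a' b' c' d' :: "'a fps fps"
      proof -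
        have "a * b * (c * d) = (a * c) * (b * d)" by (simp only: mult_ac)
        also have "\<dots> = a' * b' * (c' * d')" unfolding that by (simp only: mult_ac)
        finally show ?thesis .
      qed
      show ?thesis unfolding prod.distrib by (intro mmult KM ord_ge_Qm_power ord_ge_Q1_power)
    qed
    thus ?thesis unfolding B_def CB_def HB_def prod.distrib[symmetric] by simp
  qed
  let ?T = "vertex_series qh v \<mu>" and ?TE = "vertex_series qh v []"
  let ?A = "A (diag \<mu>)" and ?AE = "A (diag [])" and ?B = "B (diag \<mu>)" and ?BE = "B (diag [])"
  have D: "(\<Prod>j<2*m. \<Prod>p\<in>boxes \<mu>. box_den ?q v \<mu> p j) = CB * HA"
    "(\<Prod>j<2*m. \<Prod>p\<in>boxes \<mu>. box_num ?q v \<mu> p j) = HB * CA"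
    unfolding box_den_def box_num_def CB_def HA_def HB_def CA_def by (simp_all only: prod.distrib)
  \<comment> \<open>Written as a combination of the two limit relations; the rest is a multiple of
    \<open>Z\<close> and vanishes by \<open>E1\<close> and \<open>E2\<close>.\<close>
  have "?A * ?AE * (?T * (CB * HA) - ?TE * (HB * CA)) =
    (?A * ?T - ?B * Z) * (?AE * CB * HA) + Z * ((?B * CB) * (?AE * HA) - (?BE * HB) * (?A * CA)) -
    (?AE * ?TE - ?BE * Z) * (HB * ?A * CA)"
    by (simp add: algebra_simps)
  also have "(?B * CB) * (?AE * HA) - (?BE * HB) * (?A * CA) = 0" unfolding E1 E2 by simp
  finally have "?A * ?AE * (?T * (CB * HA) - ?TE * (HB * CA)) =
    (?A * ?T - ?B * Z) * (?AE * CB * HA) - (?AE * ?TE - ?BE * Z) * (HB * ?A * CA)" by simp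
  moreover have "ord_ge ((?A * ?T - ?B * Z) * (?AE * CB * HA) - (?AE * ?TE - ?BE * Z) * (HB * ?A * CA)) m"
    by (rule ord_ge_diff[OF ord_ge_mult_right[OF L1] ord_ge_mult_right[OF L0]])
  ultimately have O: "ord_ge (?A * ?AE * (?T * (CB * HA) - ?TE * (HB * CA))) m"
    by (simp only:)
  have U: "unital (?A * ?AE)"
    unfolding A_def K_def kern_def
    by (intro unital_mult unital_prod unital_power unital_1_minus' ord_ge_Q_prod_power)
  show ?thesis unfolding D by (rule ord_ge_cancel_unit[OF unital_ord_ge[OF U] O])
qed

lemma poly_ser_content_factor: "poly_ser (\<lambda>v. content_factor q v p M)"
  unfolding content_factor_def
  by (intro poly_ser_mult poly_ser_diff poly_ser_const poly_ser_const2 poly_fun_mult poly_fun_id poly_fun_const)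

text \<open>For fixed \<open>m\<close> the products have the same number of factors for every
  \<open>N\<close>, so a coefficient of degree below \<open>m\<close> is a single polynomial in
  \<open>v\<close>. It vanishes at q^(-N) for all large \<open>N\<close>, hence everywhere.\<close>

lemma vertex_series_ratio_mod:
  fixes qh :: "'a::field"
  assumes qh: "qh \<noteq> 0" and q: "\<And>n. n > 0 \<Longrightarrow> (qh\<^sup>2) ^ n \<noteq> 1" and \<mu>: "is_partition \<mu>"
  shows "ord_ge (vertex_series qh v \<mu> * (\<Prod>j<2*m. \<Prod>p\<in>boxes \<mu>. box_den (qh\<^sup>2) v \<mu> p j) -
    vertex_series qh v [] * (\<Prod>j<2*m. \<Prod>p\<in>boxes \<mu>. box_num (qh\<^sup>2) v \<mu> p j)) m"
proof -
  let ?q = "qh\<^sup>2"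
  define F where "F v = vertex_series qh v \<mu> * (\<Prod>j<2*m. \<Prod>p\<in>boxes \<mu>. box_den ?q v \<mu> p j) -
    vertex_series qh v [] * (\<Prod>j<2*m. \<Prod>p\<in>boxes \<mu>. box_num ?q v \<mu> p j)" for v
  define N0 where "N0 = length \<mu> + length (conjugate \<mu>)"
  have q0: "?q \<noteq> 0" using qh by simp
  have "poly_ser F" unfolding F_def box_den_def box_num_def
    by (intro poly_ser_diff poly_ser_mult poly_ser_prod poly_ser_power poly_ser_const
        poly_ser_content_factor poly_ser_vertex_series)
  hence P: "poly_fun (\<lambda>v. F v $ b $ c)" for b c by (simp add: poly_ser_def)
  \<comment> \<open>Equal values would make \<open>q\<close> a root of unity.\<close>
  have inj: "inj (\<lambda>N. ?q powi (- int N))"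
  proof -
    have "i = j" if "?q powi (- int i) = ?q powi (- int j)" "i \<le> j" for i j
    proof (rule ccontr)
      assume "i \<noteq> j"
      have "?q ^ i = ?q ^ j" using that q0 by (simp add: power_int_minus)
      also have "\<dots> = ?q ^ i * ?q ^ (j - i)" using that(2) by (simp flip: power_add)
      finally have "?q ^ (j - i) = 1" using q0 by simp
      thus False using q[of "j - i"] that(2) \<open>i \<noteq> j\<close> by simp
    qed
    thus ?thesis by (intro injI) (metis nat_le_linear)
  qed
  have "infinite ((\<lambda>N. ?q powi (- int N)) ` {N0..})"
    using inj by (simp add: finite_image_iff inj_on_subset infinite_Ici)
  have "F v $ b $ c = 0" if "b + c < m" for b c
  proof (rule poly_fun_zero[OF P])
    have "F (?q powi (- int N)) $ b $ c = 0" if "N0 \<le> N" for N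
      using vertex_series_ratio_mod_finite[OF qh q \<mu>, of N m] that \<open>b + c < m\<close>
      unfolding F_def ord_ge_def N0_def by auto
    hence "(\<lambda>N. ?q powi (- int N)) ` {N0..} \<subseteq> {v. F v $ b $ c = 0}" by auto
    thus "infinite {v. F v $ b $ c = 0}"
      using \<open>infinite _\<close> finite_subset by blast
  qed
  thus ?thesis by (simp add: ord_ge_def F_def)
qed

section \<open>Convergence of the infinite products\<close>

lemma fps_X_dvd_nth: "fps_X ^ k dvd F \<Longrightarrow> b < k \<Longrightarrow> F $ b = (0 :: 'b::comm_ring_1)"
  by (auto simp: dvd_def fps_X_power_mult_nth)

lemma dvd_mult_minus_1: "(d :: 'b::comm_ring_1) dvd U - 1 \<Longrightarrow> d dvd V - 1 \<Longrightarrow> d dvd U * V - 1"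
proof -
  assume "d dvd U - 1" "d dvd V - 1"
  hence "d dvd U * (V - 1) + (U - 1)" by (intro dvd_add dvd_mult)
  thus ?thesis by (simp add: algebra_simps)
qed

text \<open>\<open>prodinf\<close> refers to the topology of the outer variable
  \<open>Q\<^sub>1\<close>. Factor \<open>k\<close> is 1 modulo its \<open>k\<close>-th power, so
  the coefficients of the partial products stabilize in this topology as well as in total
  degree.\<close>

lemma prodinf_fps:
  fixes R :: "nat \<Rightarrow> 'a::field fps fps"
  assumes R: "\<And>k. fps_X ^ k dvd R k - 1" and u: "\<And>k. unital (R k)"
  shows "ord_ge ((\<Prod>k<n. R k) - prodinf R) n"
proof -
  \<comment> \<open>The coefficient of index \<open>b\<close> no longer changes once factor number
    \<open>b\<close> has been included.\<close>
  define P where "P = Abs_fps (\<lambda>b. (\<Prod>i\<le>b. R i) $ b)"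
  have P: "(\<Prod>i\<le>n. R i) $ b = P $ b" if "b \<le> n" for n b
    using that
  proof (induction n rule: dec_induct)
    case base
    show ?case by (simp add: P_def)
  next
    case (step n)
    have "fps_X ^ Suc n dvd (\<Prod>i\<le>n. R i) * (R (Suc n) - 1)" by (rule dvd_mult[OF R])
    hence "((\<Prod>i\<le>n. R i) * (R (Suc n) - 1)) $ b = 0" by (rule fps_X_dvd_nth) (use step in simp)
    thus ?case using step by (simp add: right_diff_distrib mult.commute)
  qed
  have "(\<lambda>n. \<Prod>i\<le>n. R i) \<longlonglongrightarrow> P"
    by (rule tendsto_fpsI) (use P in \<open>auto simp: eventually_at_top_linorder\<close>)
  \<comment> \<open>\<open>has_prod\<close> demands a nonzero limit; the constant coefficient
    provides it.\<close>
  moreover have "P \<noteq> 0"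
  proof
    assume "P = 0"
    hence "R 0 $ 0 = 0" using P[of 0 0] by simp
    thus False using u[of 0] by (simp add: unital_def)
  qed
  ultimately have "R has_prod P" by (simp add: has_prod_def raw_has_prod_def)
  hence "prodinf R = P" using has_prod_unique by metis
  moreover have "ord_ge ((\<Prod>k<n. R k) - P) n"
  proof (cases n)
    case (Suc n')
    thus ?thesis using P[of _ n'] by (auto simp: ord_ge_def lessThan_Suc_atMost)
  qed simp
  ultimately show ?thesis by simp
qed

lemma fps_X_dvd_factor: "(fps_X :: 'a::field fps fps) ^ k dvd M \<Longrightarrow> fps_X ^ k dvd hook_factor q \<mu> p M - 1"
  "(fps_X :: 'a::field fps fps) ^ k dvd M \<Longrightarrow> fps_X ^ k dvd content_factor q v p M - 1"
proof -
  assume "(fps_X :: 'a fps fps) ^ k dvd M"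
  hence *: "fps_X ^ k dvd (1 - c * M) - 1" for c by (simp add: dvd_mult)
  show "fps_X ^ k dvd hook_factor q \<mu> p M - 1" "fps_X ^ k dvd content_factor q v p M - 1"
    unfolding hook_factor_def content_factor_def by (intro dvd_mult_minus_1 *)+
qed

text \<open>All three monomials in factor \<open>k\<close> are divisible by
  \<open>Q\<^sub>\<rho> ^ k\<close>, hence by the \<open>k\<close>-th power of
  \<open>Q\<^sub>1\<close>. Numerator and denominator are both 1 modulo it, and so is their
  quotient.\<close>

lemma box_ratio_tail: "(fps_X :: 'a::field fps fps) ^ k dvd box_ratio q v \<mu> p k - 1"
proof -
  let ?X = "fps_X :: 'a fps fps"
  have d: "?X ^ k dvd Q_prod ^ k" unfolding Q_prod_def power_mult_distrib by simp
  hence d': "?X ^ k dvd Qm_var * Q_prod ^ k" "?X ^ k dvd fps_X * Q_prod ^ k" "?X ^ k dvd Q_prod ^ Suc k"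
    unfolding power_Suc by (rule dvd_mult)+
  have "?X ^ k dvd box_num q v \<mu> p k - 1" "?X ^ k dvd box_den q v \<mu> p k - 1"
    unfolding box_num_def box_den_def power2_eq_square
    by (intro dvd_mult_minus_1 fps_X_dvd_factor d')+
  hence "?X ^ k dvd (box_num q v \<mu> p k - 1) - (box_den q v \<mu> p k - 1)" by (rule dvd_diff)
  moreover have "box_ratio q v \<mu> p k - 1 =
    ((box_num q v \<mu> p k - 1) - (box_den q v \<mu> p k - 1)) * inverse (box_den q v \<mu> p k)"
  proof -
    have i: "box_den q v \<mu> p k * inverse (box_den q v \<mu> p k) = 1"
      by (rule fps_mult_inverse_unit[OF unit2]) (use unital_box_den in \<open>simp add: unital_def\<close>)
    have "((box_num q v \<mu> p k - 1) - (box_den q v \<mu> p k - 1)) * inverse (box_den q v \<mu> p k) =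
      (box_ratio q v \<mu> p k - 1) * (box_den q v \<mu> p k * inverse (box_den q v \<mu> p k))"
      by (simp add: box_ratio_mult_den[symmetric] algebra_simps)
    thus ?thesis by (simp add: i)
  qed
  ultimately show ?thesis by (metis dvd_mult2)
qed

lemma unital_box_ratio: "unital (box_ratio q v \<mu> p k)"
proof -
  have "(box_ratio q v \<mu> p k * box_den q v \<mu> p k) $ 0 $ 0 = 1"
    using unital_box_num by (simp only: box_ratio_mult_den unital_def)
  thus ?thesis using unital_box_den[of q v \<mu> p k] by (simp add: unital_def)
qed

lemma prod_cong_mod: "(\<And>i. i \<in> A \<Longrightarrow> ord_ge (f i - g i) n) \<Longrightarrow> ord_ge (prod f A - prod g A) n"
  by (induction A rule: infinite_finite_induct) (auto intro: ord_ge_diff_mult)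

text \<open>Once the unit \<open>D\<close> is cancelled, the truncated product over
  \<open>2*m\<close> factors agrees with the infinite one modulo degree \<open>m\<close>; as
  \<open>m\<close> is arbitrary, equality follows.\<close>

lemma vertex_series_ratio:
  fixes qh :: "'a::field"
  assumes qh: "qh \<noteq> 0" and q: "\<And>n. n > 0 \<Longrightarrow> (qh\<^sup>2) ^ n \<noteq> 1" and \<mu>: "is_partition \<mu>"
  shows "vertex_series qh v \<mu> = vertex_series qh v [] * (\<Prod>p\<in>boxes \<mu>. prodinf (box_ratio (qh\<^sup>2) v \<mu> p))"
proof (rule ord_ge_eqI)
  fix m
  let ?R = "box_ratio (qh\<^sup>2) v \<mu>" and ?T = "vertex_series qh v"
  define D where "D = (\<Prod>j<2*m. \<Prod>p\<in>boxes \<mu>. box_den (qh\<^sup>2) v \<mu> p j)"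
  have "(\<Prod>j<2*m. \<Prod>p\<in>boxes \<mu>. box_num (qh\<^sup>2) v \<mu> p j) = (\<Prod>j<2*m. \<Prod>p\<in>boxes \<mu>. ?R p j) * D"
    unfolding D_def prod.distrib[symmetric] box_ratio_mult_den ..
  hence "?T \<mu> * D - ?T [] * (\<Prod>j<2*m. \<Prod>p\<in>boxes \<mu>. box_num (qh\<^sup>2) v \<mu> p j) =
    D * (?T \<mu> - ?T [] * (\<Prod>j<2*m. \<Prod>p\<in>boxes \<mu>. ?R p j))"
    by (simp add: algebra_simps)
  hence O: "ord_ge (D * (?T \<mu> - ?T [] * (\<Prod>j<2*m. \<Prod>p\<in>boxes \<mu>. ?R p j))) m"
    using vertex_series_ratio_mod[OF qh q \<mu>, of v m] by (simp add: D_def)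
  have U: "unital D" unfolding D_def by (intro unital_prod unital_box_den)
  have 1: "ord_ge (?T \<mu> - ?T [] * (\<Prod>j<2*m. \<Prod>p\<in>boxes \<mu>. ?R p j)) m"
    by (rule ord_ge_cancel_unit[OF unital_ord_ge[OF U] O])
  have "ord_ge ((\<Prod>j<2*m. ?R p j) - prodinf (?R p)) m" for p
    by (rule ord_ge_mono[OF prodinf_fps[where n = "2*m", OF box_ratio_tail unital_box_ratio]]) simp
  hence "ord_ge ((\<Prod>p\<in>boxes \<mu>. \<Prod>j<2*m. ?R p j) - (\<Prod>p\<in>boxes \<mu>. prodinf (?R p))) m"
    by (intro prod_cong_mod)
  hence "ord_ge (?T [] * ((\<Prod>j<2*m. \<Prod>p\<in>boxes \<mu>. ?R p j) - (\<Prod>p\<in>boxes \<mu>. prodinf (?R p)))) m"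
    by (subst prod.swap) (rule ord_ge_mult_left)
  hence 2: "ord_ge (?T [] * (\<Prod>j<2*m. \<Prod>p\<in>boxes \<mu>. ?R p j) - ?T [] * (\<Prod>p\<in>boxes \<mu>. prodinf (?R p))) m"
    by (simp only: right_diff_distrib)
  show "ord_ge (?T \<mu> - ?T [] * (\<Prod>p\<in>boxes \<mu>. prodinf (?R p))) m"
    by (rule ord_ge_trans[OF 1 2])
qed

section \<open>Prefactors of the two vertices\<close>

lemma card_boxes: "is_partition l \<Longrightarrow> card (boxes l) = sum_list l"
proof -
  assume l: "is_partition l"
  have "inj_on (map_prod Suc Suc) (cells (diag l))"
    by (rule inj_on_subset[of _ UNIV]) (auto intro: prod.inj_map)
  thus "card (boxes l) = sum_list l"
    by (simp_all add: boxes_eq[OF l] finite_cells card_image card_cells dsize_diag[OF l])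
qed

lemma boxes_conjugate: "is_partition l \<Longrightarrow> boxes (conjugate l) = prod.swap ` boxes l"
  by (force simp: boxes_eq is_partition_conjugate diag_conjugate cells_mirror image_image)

text \<open>The reason why the framing factors of a vertex and of its transposed partner
  cancel.\<close>

lemma kappa_conjugate: "is_partition l \<Longrightarrow> kappa (conjugate l) = - kappa l"
  by (simp add: kappa_def boxes_conjugate sum.reindex inj_on_subset[OF inj_swap] box_content_def
      sum_negf[symmetric])

lemma hook_conjugate: "is_partition l \<Longrightarrow> hook (conjugate l) (prod.swap p) = hook l p"
  by (simp add: hook_def conjugate_conjugate)

text \<open>Transposition negates contents and preserves hook lengths, so the two quantum dimensions
  combine box by box. The sign and the powers of \<open>eh\<close> give a factor \<open>- v\<close>
  per box, which is why the formula has \<open>Q\<close> in place of \<open>-Q\<close>.\<close>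

lemma vertex_weight:
  fixes qh eh :: "'a::field"
  assumes qh: "qh \<noteq> 0" and eh: "eh \<noteq> 0" and \<mu>: "is_partition \<mu>"
  defines "q \<equiv> qh\<^sup>2" and "v \<equiv> inverse (eh\<^sup>2)"
  shows "(- 1) ^ sum_list \<mu> * ((eh powi (- int (sum_list \<mu>)) * quantum_dim qh eh \<mu>) *
      (eh powi (- int (sum_list \<mu>)) * quantum_dim qh eh (conjugate \<mu>))) =
    (\<Prod>x\<in>boxes \<mu>. (1 - v * q powi box_content x) * (1 - v * q powi (- box_content x)) /
              ((1 - q powi hook \<mu> x) * (1 - q powi (- hook \<mu> x))))"
proof -
  let ?c = "box_content" and ?h = "hook \<mu>"
  have "quantum_dim qh eh (conjugate \<mu>) = (\<Prod>x\<in>boxes \<mu>.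
     (eh * qh powi (- ?c x) - inverse eh * qh powi ?c x) / (qh powi ?h x - qh powi (- ?h x)))"
    unfolding quantum_dim_def boxes_conjugate[OF \<mu>]
    by (subst prod.reindex) (auto simp: hook_conjugate[OF \<mu>] box_content_def intro!: prod.cong)
  moreover have "(- 1) ^ sum_list \<mu> * (eh powi (- int (sum_list \<mu>)) * eh powi (- int (sum_list \<mu>))) = (\<Prod>x\<in>boxes \<mu>. - v)"
  proof -
    have "eh powi (- int n) = inverse eh ^ n" for n by (simp add: power_int_minus power_inverse)
    hence "(- 1) ^ sum_list \<mu> * (eh powi (- int (sum_list \<mu>)) * eh powi (- int (sum_list \<mu>))) =
      ((- 1) * (inverse eh * inverse eh)) ^ sum_list \<mu>"
      by (simp only: power_mult_distrib)
    also have "(- 1) * (inverse eh * inverse eh) = - v" by (simp add: v_def power2_eq_square)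
    finally show ?thesis by (simp add: card_boxes[OF \<mu>])
  qed
  ultimately have "(- 1) ^ sum_list \<mu> * ((eh powi (- int (sum_list \<mu>)) * quantum_dim qh eh \<mu>) *
      (eh powi (- int (sum_list \<mu>)) * quantum_dim qh eh (conjugate \<mu>))) = (\<Prod>x\<in>boxes \<mu>. - v) * 
     ((\<Prod>x\<in>boxes \<mu>. (eh * qh powi ?c x - inverse eh * qh powi (- ?c x)) / (qh powi ?h x - qh powi (- ?h x))) *
     (\<Prod>x\<in>boxes \<mu>. (eh * qh powi (- ?c x) - inverse eh * qh powi ?c x) / (qh powi ?h x - qh powi (- ?h x))))"
    by (simp add: quantum_dim_def[of _ _ \<mu>] mult_ac)
  also have "\<dots> = (\<Prod>x\<in>boxes \<mu>. - v * 
     ((eh * qh powi ?c x - inverse eh * qh powi (- ?c x)) / (qh powi ?h x - qh powi (- ?h x)) *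
     ((eh * qh powi (- ?c x) - inverse eh * qh powi ?c x) / (qh powi ?h x - qh powi (- ?h x)))))"
    by (simp only: prod.distrib)
  also have "\<dots> = (\<Prod>x\<in>boxes \<mu>. (1 - v * q powi box_content x) * (1 - v * q powi (- box_content x)) /
              ((1 - q powi hook \<mu> x) * (1 - q powi (- hook \<mu> x))))"
  proof (intro prod.cong refl)
    fix x
    define C H where "C = qh powi ?c x" and "H = qh powi ?h x"
    have nz: "C \<noteq> 0" "H \<noteq> 0" using qh by (simp_all add: C_def H_def)
    have s: "qh powi (- ?c x) = inverse C" "qh powi (- ?h x) = inverse H"
      "q powi ?c x = C * C" "q powi (- ?c x) = inverse C * inverse C"
      "q powi ?h x = H * H" "q powi (- ?h x) = inverse H * inverse H"
      by (simp_all add: C_def H_def q_def power_int_minus power2_eq_square power_int_mult_distrib)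
    \<comment> \<open>Multiplying by \<open>- v\<close> yields the product of the factors
      \<open>1 - ...\<close> up to one sign, and the squared denominator yields its product up to
      one sign as well; the two signs cancel.\<close>
    have 1: "- v * ((eh * C - inverse eh * inverse C) * (eh * inverse C - inverse eh * C)) =
      - ((1 - v * (C * C)) * (1 - v * (inverse C * inverse C)))"
      using nz eh by (simp add: v_def field_simps power2_eq_square)
    have 2: "(H - inverse H) * (H - inverse H) = - ((1 - H * H) * (1 - inverse H * inverse H))"
      using nz by (simp add: field_simps)
    have "- v * ((eh * C - inverse eh * inverse C) / (H - inverse H) *
       ((eh * inverse C - inverse eh * C) / (H - inverse H))) =
      (- v * ((eh * C - inverse eh * inverse C) * (eh * inverse C - inverse eh * C))) /
        ((H - inverse H) * (H - inverse H))" by simp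
    also have "\<dots> = ((1 - v * (C * C)) * (1 - v * (inverse C * inverse C))) /
        ((1 - H * H) * (1 - inverse H * inverse H))"
      unfolding 1 2 by simp
    finally show "- v * ((eh * qh powi ?c x - inverse eh * qh powi (- ?c x)) / (qh powi ?h x - qh powi (- ?h x)) *
     ((eh * qh powi (- ?c x) - inverse eh * qh powi ?c x) / (qh powi ?h x - qh powi (- ?h x)))) =
     (1 - v * q powi box_content x) * (1 - v * q powi (- box_content x)) /
              ((1 - q powi hook \<mu> x) * (1 - q powi (- hook \<mu> x)))"
      unfolding s C_def[symmetric] H_def[symmetric] .
  qed
  finally show ?thesis .
qed

lemma boxes_Nil: "boxes [] = {}"
  by (auto simp: boxes_def)

lemma Z_pert_eq: assumes "qh \<noteq> 0" shows "Z_pert qh eh = vertex_series qh (inverse (eh\<^sup>2)) []"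
proof -
  have c0: "conjugate [] = []" by (simp add: conjugate_def part_def)
  have qd: "quantum_dim qh eh [] = 1" by (simp add: quantum_dim_def boxes_Nil)
  have "vertex qh eh \<eta> [] \<nu> * vertex qh eh (conjugate \<eta>) [] (conjugate \<nu>) =
    vertex_sum qh (inverse (eh\<^sup>2)) [] \<eta> \<nu> * vertex_sum qh (inverse (eh\<^sup>2)) (conjugate []) (conjugate \<eta>) (conjugate \<nu>)"
    if "is_partition \<nu>" for \<eta> \<nu>
  proof -
    have "qh powi kappa \<nu> * qh powi (- kappa \<nu>) = 1" using assms by (simp add: power_int_minus)
    moreover have "vertex qh eh \<eta> [] \<nu> * vertex qh eh (conjugate \<eta>) [] (conjugate \<nu>) =
      (qh powi kappa \<nu> * qh powi (- kappa \<nu>)) *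
      (vertex_sum qh (inverse (eh\<^sup>2)) [] \<eta> \<nu> * vertex_sum qh (inverse (eh\<^sup>2)) (conjugate []) (conjugate \<eta>) (conjugate \<nu>))"
      using that by (simp add: vertex_eq c0 qd kappa_conjugate mult_ac)
    ultimately show ?thesis by simp
  qed
  thus ?thesis unfolding Z_pert_def vertex_series_def
    by (auto intro!: fps_ext sum.cong simp: partitions_def mult.assoc)
qed

lemma Z_full_nth:
  fixes qh eh :: "'a::field"
  assumes qh: "qh \<noteq> 0" and eh: "eh \<noteq> 0"
  defines "q \<equiv> qh\<^sup>2" and "v \<equiv> inverse (eh\<^sup>2)"
  shows "Z_full qh eh $ a = (\<Sum>\<mu>\<in>partitions a. const2 (\<Prod>x\<in>boxes \<mu>.
     (1 - v * q powi box_content x) * (1 - v * q powi (- box_content x)) /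
              ((1 - q powi hook \<mu> x) * (1 - q powi (- hook \<mu> x)))) * vertex_series qh v \<mu>)"
proof (intro fps_ext)
  fix b c
  define g where "g \<mu> = (eh powi (- int (sum_list \<mu>)) * quantum_dim qh eh \<mu>) *
      (eh powi (- int (sum_list \<mu>)) * quantum_dim qh eh (conjugate \<mu>))" for \<mu>
  have V: "vertex qh eh \<eta> \<mu> \<nu> * vertex qh eh (conjugate \<eta>) (conjugate \<mu>) (conjugate \<nu>) =
    g \<mu> * (vertex_sum qh v \<mu> \<eta> \<nu> * vertex_sum qh v (conjugate \<mu>) (conjugate \<eta>) (conjugate \<nu>))"
    if "is_partition \<mu>" "is_partition \<nu>" for \<eta> \<mu> \<nu>
  proof -
    have "qh powi kappa \<nu> * qh powi (- kappa \<nu>) = 1" using qh by (simp add: power_int_minus)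
    moreover have "vertex qh eh \<eta> \<mu> \<nu> * vertex qh eh (conjugate \<eta>) (conjugate \<mu>) (conjugate \<nu>) =
      (qh powi kappa \<nu> * qh powi (- kappa \<nu>)) *
      (g \<mu> * (vertex_sum qh v \<mu> \<eta> \<nu> * vertex_sum qh v (conjugate \<mu>) (conjugate \<eta>) (conjugate \<nu>)))"
      using that by (simp add: vertex_eq g_def v_def kappa_conjugate sum_list_conjugate mult_ac)
    ultimately show ?thesis by simp
  qed
  have "Z_full qh eh $ a $ b $ c = (\<Sum>\<mu>\<in>partitions a. \<Sum>\<nu>\<in>partitions b. \<Sum>\<eta>\<in>partitions c.
       (- 1) ^ a * g \<mu> * ((- 1) ^ b * (- 1) ^ c *
       (vertex_sum qh v \<mu> \<eta> \<nu> * vertex_sum qh v (conjugate \<mu>) (conjugate \<eta>) (conjugate \<nu>))))"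
    unfolding Z_full_def fps_nth_Abs_fps
  proof (intro sum.cong refl)
    fix \<mu> \<nu> \<eta> assume "\<mu> \<in> partitions a" "\<nu> \<in> partitions b"
    hence "is_partition \<mu>" "is_partition \<nu>" by (auto simp: partitions_def)
    from V[OF this, of \<eta>]
    show "(- 1) ^ a * (- 1) ^ b * (- 1) ^ c *
       vertex qh eh \<eta> \<mu> \<nu> * vertex qh eh (conjugate \<eta>) (conjugate \<mu>) (conjugate \<nu>) = (- 1) ^ a * g \<mu> * ((- 1) ^ b * (- 1) ^ c *
       (vertex_sum qh v \<mu> \<eta> \<nu> * vertex_sum qh v (conjugate \<mu>) (conjugate \<eta>) (conjugate \<nu>)))"
      by (simp only: mult_ac)
  qed
  also have "\<dots> = (\<Sum>\<mu>\<in>partitions a. ((- 1) ^ a * g \<mu>) * vertex_series qh v \<mu> $ b $ c)"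
    by (simp add: vertex_series_def sum_distrib_left)
  also have "\<dots> = (\<Sum>\<mu>\<in>partitions a. (\<Prod>x\<in>boxes \<mu>.
     (1 - v * q powi box_content x) * (1 - v * q powi (- box_content x)) /
              ((1 - q powi hook \<mu> x) * (1 - q powi (- hook \<mu> x)))) * vertex_series qh v \<mu> $ b $ c)"
  proof (intro sum.cong refl)
    fix \<mu> assume "\<mu> \<in> partitions a"
    hence "is_partition \<mu>" "a = sum_list \<mu>" by (auto simp: partitions_def)
    thus "(- 1) ^ a * g \<mu> * vertex_series qh v \<mu> $ b $ c = (\<Prod>x\<in>boxes \<mu>.
     (1 - v * q powi box_content x) * (1 - v * q powi (- box_content x)) /
              ((1 - q powi hook \<mu> x) * (1 - q powi (- hook \<mu> x)))) * vertex_series qh v \<mu> $ b $ c"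
      using vertex_weight[OF qh eh] by (simp add: g_def q_def v_def)
  qed
  finally show "Z_full qh eh $ a $ b $ c = (\<Sum>\<mu>\<in>partitions a. const2 (\<Prod>x\<in>boxes \<mu>.
     (1 - v * q powi box_content x) * (1 - v * q powi (- box_content x)) /
              ((1 - q powi hook \<mu> x) * (1 - q powi (- hook \<mu> x)))) * vertex_series qh v \<mu>) $ b $ c"
    by (simp add: fps_sum_nth const2_def)
qed

lemma partitions_0: "partitions 0 = {[]}"
proof -
  have "l = []" if "is_partition l" "sum_list l = 0" for l
    using that by (cases l) (auto simp: is_partition_def)
  thus ?thesis by (auto simp: partitions_def is_partition_def)
qed

text \<open>Valid for every series \<open>E\<close>, hence for arbitrary \<open>v\<close> and not
  only for finite alphabets. The expansion of the constant 1 is found by uniqueness.\<close>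

lemma specialize_skew_schur_Nil: "specialize (skew_schur [] []) E = 1"
proof -
  have "skew_ssyt [] [] N = {\<lambda>_. undefined}" for N
    by (auto simp: skew_ssyt_def boxes_Nil)
  hence 1: "skew_schur [] [] N = mpoly_eval 1 (\<lambda>n. elem_sym (Suc n) N)" for N
    by (simp add: skew_schur_def boxes_Nil)
  hence e: "elem_poly (skew_schur [] [])" unfolding elem_poly_def by blast
  have "elem_expansion (skew_schur [] []) - 1 = 0"
    by (rule elem_sym_independent) (simp only: mpoly_eval_diff elem_expansion_eq[OF e, symmetric] 1 diff_self)
  thus ?thesis by (simp add: specialize_def)
qed

text \<open>Constant term 1 makes \<open>Z_pert\<close> invertible, so that the quotient in the
  theorem is a true division.\<close>

lemma vertex_series_empty_nth: "vertex_series qh v [] $ 0 $ 0 = 1"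
proof -
  have c0: "conjugate [] = []" by (simp add: conjugate_def part_def)
  have "\<sigma> = []" if "is_partition \<sigma>" "boxes \<sigma> = {}" for \<sigma>
    using card_boxes[OF that(1)] that partitions_0 by (auto simp: partitions_def)
  hence "{\<sigma>. is_partition \<sigma> \<and> boxes \<sigma> \<subseteq> boxes [] \<and> boxes \<sigma> \<subseteq> boxes (conjugate [])} = {[]}"
    by (auto simp: boxes_Nil c0 is_partition_def)
  hence "vertex_sum qh v [] [] [] = 1"
    unfolding vertex_sum_def by (simp add: c0 specialize_skew_schur_Nil)
  thus ?thesis by (simp add: vertex_series_def partitions_0 c0)
qed

theorem theorem6p6:
  fixes qh eh :: "'a::field_char_0"
  assumes "qh \<noteq> 0" and "eh \<noteq> 0" and "\<And>n. n > 0 \<Longrightarrow> (qh\<^sup>2) ^ n \<noteq> 1"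
  shows "let q = qh\<^sup>2; v = inverse (eh\<^sup>2) in
    Z_full qh eh / fps_const (Z_pert qh eh) =
    Abs_fps (\<lambda>n. \<Sum>\<mu>\<in>partitions n. \<Prod>x\<in>boxes \<mu>.
      scalar ((1 - v * q powi box_content x) * (1 - v * q powi (- box_content x)) /
              ((1 - q powi hook \<mu> x) * (1 - q powi (- hook \<mu> x)))) *
      prodinf (\<lambda>k.
        ((1 - scalar (q powi hook \<mu> x) * Q\<^sub>m * Q\<^sub>\<rho> ^ k) *
         (1 - scalar (q powi (- hook \<mu> x)) * Q\<^sub>m * Q\<^sub>\<rho> ^ k)) /
        ((1 - scalar (v * q powi box_content x) * Q\<^sub>m * Q\<^sub>\<rho> ^ k) *
         (1 - scalar (v * q powi (- box_content x)) * Q\<^sub>m * Q\<^sub>\<rho> ^ k)) *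
        (((1 - scalar (q powi hook \<mu> x) * Q\<^sub>1 * Q\<^sub>\<rho> ^ k) *
          (1 - scalar (q powi (- hook \<mu> x)) * Q\<^sub>1 * Q\<^sub>\<rho> ^ k)) /
         ((1 - scalar (v * q powi box_content x) * Q\<^sub>1 * Q\<^sub>\<rho> ^ k) *
          (1 - scalar (v * q powi (- box_content x)) * Q\<^sub>1 * Q\<^sub>\<rho> ^ k))) *
        (((1 - scalar (v * q powi box_content x) * Q\<^sub>\<rho> ^ Suc k)\<^sup>2 *
          (1 - scalar (v * q powi (- box_content x)) * Q\<^sub>\<rho> ^ Suc k)\<^sup>2) /
         ((1 - scalar (q powi hook \<mu> x) * Q\<^sub>\<rho> ^ Suc k)\<^sup>2 *
          (1 - scalar (q powi (- hook \<mu> x)) * Q\<^sub>\<rho> ^ Suc k)\<^sup>2))))"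
proof -
  define q v where "q = qh\<^sup>2" and "v = inverse (eh\<^sup>2)"
  define w where "w \<mu> x = (1 - v * q powi box_content x) * (1 - v * q powi (- box_content x)) /
              ((1 - q powi hook \<mu> x) * (1 - q powi (- hook \<mu> x)))" for \<mu> x
  define S where "S = Abs_fps (\<lambda>n. \<Sum>\<mu>\<in>partitions n. \<Prod>x\<in>boxes \<mu>. const2 (w \<mu> x) * prodinf (\<lambda>k. box_ratio q v \<mu> x k))"
  have "Z_full qh eh = S * fps_const (Z_pert qh eh)"
  proof (rule fps_ext)
    fix a
    have "Z_full qh eh $ a = (\<Sum>\<mu>\<in>partitions a. const2 (\<Prod>x\<in>boxes \<mu>. w \<mu> x) *
      (Z_pert qh eh * (\<Prod>x\<in>boxes \<mu>. prodinf (box_ratio q v \<mu> x))))"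
      unfolding Z_full_nth[OF assms(1,2)] w_def q_def v_def
    proof (intro sum.cong refl)
      fix \<mu> assume "\<mu> \<in> partitions a"
      hence \<mu>: "is_partition \<mu>" by (simp add: partitions_def)
      show "const2 W * vertex_series qh (inverse (eh\<^sup>2)) \<mu> = const2 W * (Z_pert qh eh *
        (\<Prod>x\<in>boxes \<mu>. prodinf (box_ratio (qh\<^sup>2) (inverse (eh\<^sup>2)) \<mu> x)))" for W
        using vertex_series_ratio[OF assms(1) _ \<mu>, of "inverse (eh\<^sup>2)"] assms(3)
        by (simp add: Z_pert_eq[OF assms(1)])
    qed
    also have "\<dots> = (S * fps_const (Z_pert qh eh)) $ a"
      by (simp add: S_def const2_prod prod.distrib sum_distrib_left mult_ac)
    finally show "Z_full qh eh $ a = (S * fps_const (Z_pert qh eh)) $ a" .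
  qed
  moreover have "Z_pert qh eh * inverse (Z_pert qh eh) = 1"
    by (intro fps_mult_inverse_unit unit2) (simp add: Z_pert_eq[OF assms(1)] vertex_series_empty_nth)
  \<comment> \<open>Here \<open>Z_pert\<close> is the constant coefficient of a series in
    \<open>Q\<close>, so its invertibility as a bivariate series is what the division
    requires.\<close>
  ultimately have "Z_full qh eh / fps_const (Z_pert qh eh) = S"
    using fps_divide_mult_unit(2)[of "fps_const (Z_pert qh eh)" S] by simp
  thus ?thesis
    unfolding S_def w_def const2_def q_def v_def Let_def box_ratio_def hook_factor_def content_factor_def
      Q_prod_def Qm_var_def power_mult_distrib[of "1 - _"] mult.assoc[of "fps_const (fps_const _)"] .
qed

end
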